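(* Let $F$ be a smooth compact manifold. Assume that $D\in C^\infty(F\times F,\mathbb{R})$ is symmetric, $D(x,y)=D(y,x)$ for all $x,y\in F$, and strictly positive on the diagonal, $D(x,x)>0$ for all $x\in F$. Furthermore, assume that for every $x\in F$ and $y\in K(x)$ there is a smooth curve $c$ joining the points $x$ and $y$, parametrized such that $c(0)=x$, such that $D$ is locally translation symmetric at $x$ with respect to $c$, and such that the function $D(c(t),y)$ changes sign at $t=0$. Then the following statement holds, provided that the curve $c$ is analytic in a neighborhood of $t=0$: (A) If $F$ and $D$ are real analytic, then a minimizing measure $\rho$ is either generically timelike or the interior of $\operatorname{supp}\rho$ is empty. Assume, furthermore (beyond the assumptions made before the analyticity proviso for (A)), that there is $p\in\mathbb{N}$ with $$\frac{d^p}{dt^p}D\big(c(t),y\big)\Big|_{t=0}\neq0 .$$ Then the following statement holds: (B) If $D$ is smooth and if there is a differential operator $\Delta$ (of any finite order) on $C^\infty(F)$ which vanishes on the constant functions such that $$\Delta_xD(x,y)<0 \qquad \text{for all } y\in I(x)$$ (for every $x\in F$, where $\Delta_x$ means that $\Delta$ acts on the variable $x$), then the interior of $\operatorname{supp}\rho$ is empty for every minimizing measure $\rho$.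
   Context: Set $L=\max(0,D)$. Let $\mathfrak{M}$ be the set of all normalized (total mass one) positive regular Borel measures on $F$, and for $\rho\in\mathfrak{M}$ let $S[\rho]=\iint_{F\times F}L(x,y)\,d\rho(x)\,d\rho(y)$. A minimizing measure (minimizer) is a $\rho\in\mathfrak{M}$ with $S[\rho]=\inf_{\tilde\rho\in\mathfrak{M}}S[\tilde\rho]$. For $x\in F$: $I(x)=\{y\in F: D(x,y)>0\}$, $J(x)=\{y\in F: D(x,y)\ge 0\}$, and $K(x)=\partial I(x)\cap\partial(F\setminus J(x))$ ($\partial$ = topological boundary in $F$). Thus $y\in K(x)$ if and only if $D(x,\cdot)$ changes sign in every neighborhood of $y$. $D$ is called locally translation symmetric at $x$ with respect to a curve $c(t)$ with $c(0)=x$ if there are $\varepsilon>0$ and a function $f\in C^\infty((-2\varepsilon,2\varepsilon))$ such that $c$ is defined on the interval $(-\varepsilon,\varepsilon)$ and $D(c(t),c(t'))=f(t-t')$ for all $t,t'\in(-\varepsilon,\varepsilon)$. The support is $\operatorname{supp}\rho=\{x\in F:\rho(U)\neq0 \text{ for every open neighborhood } U \text{ of } x\}$; its interior is taken in $F$. A minimizing measure $\rho$ is called generically timelike if (i) $D(x,y)\ge0$ for all $x,y\in\operatorname{supp}\rho$, and (ii) the function $d(x)=\int_F D(x,y)\,d\rho(y)$ is constant on $F$.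
   Formalization: In (A) the manifold F is assumed connected; without this (A) fails, e.g. for F a disjoint union of two parts with D=1 within each part and D=-1 across, where a full-support minimizer is not generically timelike. *)

theory Defs
  imports "HOL-Analysis.Analysis"
begin

section \<open>Smooth and real analytic maps between Euclidean spaces\<close>

text \<open>The predicates below are only meant for open sets \<open>S\<close>.\<close>

primrec Ck_on :: "nat \<Rightarrow> 'e::euclidean_space set \<Rightarrow> ('e \<Rightarrow> 'b::real_normed_vector) \<Rightarrow> bool" where
  "Ck_on 0 S f \<longleftrightarrow> continuous_on S f"
| "Ck_on (Suc k) S f \<longleftrightarrow>
     (\<forall>x\<in>S. f differentiable (at x)) \<and>
     (\<forall>v. Ck_on k S (\<lambda>x. frechet_derivative f (at x) v))"

definition smooth_on :: "'e::euclidean_space set \<Rightarrow> ('e \<Rightarrow> 'b::real_normed_vector) \<Rightarrow> bool" where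
  "smooth_on S f \<longleftrightarrow> (\<forall>k. Ck_on k S f)"

text \<open>Multi-indices are functions \<open>\<alpha>\<close> on the standard basis; the local power series are
  required to converge unconditionally.\<close>

definition real_analytic_on :: "'e::euclidean_space set \<Rightarrow> ('e \<Rightarrow> 'b::real_normed_vector) \<Rightarrow> bool" where
  "real_analytic_on S f \<longleftrightarrow>
     (\<forall>x\<in>S. \<exists>r>0. \<exists>a :: ('e \<Rightarrow> nat) \<Rightarrow> 'b. \<forall>h. norm h < r \<longrightarrow>
        ((\<lambda>\<alpha>. (\<Prod>b\<in>Basis. (h \<bullet> b) ^ \<alpha> b) *\<^sub>R a \<alpha>) has_sum f (x + h))
          (Basis \<rightarrow>\<^sub>E UNIV))"


section \<open>Manifolds\<close>

text \<open>The manifold is the whole type \<open>'a\<close>. A chart is a pair \<open>(U, \<phi>)\<close> of an open domain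
  and a map which is a homeomorphism from \<open>U\<close> onto an open subset of the model space
  \<open>'e\<close>; its inverse is \<open>inv_into U \<phi>\<close>. Atlases need not be maximal. The parameter \<open>P\<close> is the
  regularity class, to be instantiated with \<open>smooth_on\<close> or \<open>real_analytic_on\<close>.\<close>

type_synonym ('a, 'e) chart = "'a set \<times> ('a \<Rightarrow> 'e)"

definition manifold_atlas ::
  "('e set \<Rightarrow> ('e \<Rightarrow> 'e) \<Rightarrow> bool) \<Rightarrow> ('a::topological_space, 'e::euclidean_space) chart set \<Rightarrow> bool" where
  "manifold_atlas P A \<longleftrightarrow>
     (\<forall>(U, \<phi>)\<in>A. open U \<and> open (\<phi> ` U) \<and> homeomorphism U (\<phi> ` U) \<phi> (inv_into U \<phi>)) \<and>
     (\<Union>(U, \<phi>)\<in>A. U) = UNIV \<and>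
     (\<forall>(U, \<phi>)\<in>A. \<forall>(V, \<psi>)\<in>A. P (\<phi> ` (U \<inter> V)) (\<psi> \<circ> inv_into U \<phi>))"

definition smooth_fun :: "('a::topological_space, 'e::euclidean_space) chart set \<Rightarrow> ('a \<Rightarrow> real) \<Rightarrow> bool" where
  "smooth_fun A f \<longleftrightarrow> (\<forall>(U, \<phi>)\<in>A. smooth_on (\<phi> ` U) (f \<circ> inv_into U \<phi>))"

definition kernel_of_class ::
  "(('e \<times> 'e) set \<Rightarrow> ('e \<times> 'e \<Rightarrow> real) \<Rightarrow> bool) \<Rightarrow>
   ('a::topological_space, 'e::euclidean_space) chart set \<Rightarrow> ('a \<Rightarrow> 'a \<Rightarrow> real) \<Rightarrow> bool" where
  "kernel_of_class P A D \<longleftrightarrow>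
     (\<forall>(U, \<phi>)\<in>A. \<forall>(V, \<psi>)\<in>A.
        P (\<phi> ` U \<times> \<psi> ` V) (\<lambda>(u, v). D (inv_into U \<phi> u) (inv_into V \<psi> v)))"

definition curve_of_class ::
  "(real set \<Rightarrow> (real \<Rightarrow> 'e) \<Rightarrow> bool) \<Rightarrow>
   ('a::topological_space, 'e::euclidean_space) chart set \<Rightarrow> real set \<Rightarrow> (real \<Rightarrow> 'a) \<Rightarrow> bool" where
  "curve_of_class P A T c \<longleftrightarrow>
     open T \<and> continuous_on T c \<and>
     (\<forall>(U, \<phi>)\<in>A. P {t \<in> T. c t \<in> U} (\<phi> \<circ> c))"

text \<open>A curve joining \<open>x\<close> and \<open>y\<close> is parametrized on an open interval \<open>T\<close>, which need not end
  at the parameter value of \<open>y\<close>.\<close>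

definition smooth_curve_joining ::
  "('a::topological_space, 'e::euclidean_space) chart set \<Rightarrow> 'a \<Rightarrow> 'a \<Rightarrow> real set \<Rightarrow> (real \<Rightarrow> 'a) \<Rightarrow> bool" where
  "smooth_curve_joining A x y T c \<longleftrightarrow>
     is_interval T \<and> curve_of_class smooth_on A T c \<and> 0 \<in> T \<and> c 0 = x \<and> (\<exists>t\<in>T. c t = y)"


section \<open>Differential operators\<close>

fun iterated_partial :: "'e::euclidean_space list \<Rightarrow> ('e \<Rightarrow> real) \<Rightarrow> 'e \<Rightarrow> real" where
  "iterated_partial [] f = f"
| "iterated_partial (b # bs) f = (\<lambda>x. frechet_derivative (iterated_partial bs f) (at x) b)"

text \<open>In every chart, the operator is a linear combination with smooth coefficients of partial
  derivatives up to order \<open>k\<close>. Partial derivatives are indexed by lists of basis vectors rather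
  than by multi-indices; on smooth functions both give the same operators.\<close>

definition differential_operator ::
  "('a::topological_space, 'e::euclidean_space) chart set \<Rightarrow> (('a \<Rightarrow> real) \<Rightarrow> ('a \<Rightarrow> real)) \<Rightarrow> bool" where
  "differential_operator A \<Delta> \<longleftrightarrow>
     (\<exists>k::nat. \<forall>(U, \<phi>)\<in>A. \<exists>a :: 'e list \<Rightarrow> 'e \<Rightarrow> real.
        (\<forall>bs. smooth_on (\<phi> ` U) (a bs)) \<and>
        (\<forall>f. smooth_fun A f \<longrightarrow>
          (\<forall>x\<in>U. \<Delta> f x =
             (\<Sum>bs | set bs \<subseteq> Basis \<and> length bs \<le> k.
                a bs (\<phi> x) * iterated_partial bs (f \<circ> inv_into U \<phi>) (\<phi> x)))))"


section \<open>The causal variational principle\<close>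

definition lagrangian :: "('a \<Rightarrow> 'a \<Rightarrow> real) \<Rightarrow> 'a \<Rightarrow> 'a \<Rightarrow> real" where
  "lagrangian D x y = max 0 (D x y)"

definition regular_prob_measures :: "'a::topological_space measure set" where
  "regular_prob_measures = {\<rho>.
     sets \<rho> = sets borel \<and> emeasure \<rho> UNIV = 1 \<and>
     (\<forall>B\<in>sets borel.
        emeasure \<rho> B = (SUP C\<in>{C. compact C \<and> C \<subseteq> B}. emeasure \<rho> C) \<and>
        emeasure \<rho> B = (INF U\<in>{U. open U \<and> B \<subseteq> U}. emeasure \<rho> U))}"

definition action :: "('a \<Rightarrow> 'a \<Rightarrow> real) \<Rightarrow> 'a measure \<Rightarrow> real" where
  "action D \<rho> = (\<integral>x. (\<integral>y. lagrangian D x y \<partial>\<rho>) \<partial>\<rho>)"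

definition minimizer :: "('a::topological_space \<Rightarrow> 'a \<Rightarrow> real) \<Rightarrow> 'a measure \<Rightarrow> bool" where
  "minimizer D \<rho> \<longleftrightarrow>
     \<rho> \<in> regular_prob_measures \<and> action D \<rho> = (INF \<mu>\<in>regular_prob_measures. action D \<mu>)"

definition supp :: "'a::topological_space measure \<Rightarrow> 'a set" where
  "supp \<rho> = {x. \<forall>U. open U \<longrightarrow> x \<in> U \<longrightarrow> emeasure \<rho> U \<noteq> 0}"

definition generically_timelike :: "('a::topological_space \<Rightarrow> 'a \<Rightarrow> real) \<Rightarrow> 'a measure \<Rightarrow> bool" where
  "generically_timelike D \<rho> \<longleftrightarrow>
     minimizer D \<rho> \<and>
     (\<forall>x\<in>supp \<rho>. \<forall>y\<in>supp \<rho>. D x y \<ge> 0) \<and>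
     (\<exists>k. \<forall>x. (\<integral>y. D x y \<partial>\<rho>) = k)"

definition I_set :: "('a \<Rightarrow> 'a \<Rightarrow> real) \<Rightarrow> 'a \<Rightarrow> 'a set" where
  "I_set D x = {y. D x y > 0}"

definition J_set :: "('a \<Rightarrow> 'a \<Rightarrow> real) \<Rightarrow> 'a \<Rightarrow> 'a set" where
  "J_set D x = {y. D x y \<ge> 0}"

definition K_set :: "('a::topological_space \<Rightarrow> 'a \<Rightarrow> real) \<Rightarrow> 'a \<Rightarrow> 'a set" where
  "K_set D x = frontier (I_set D x) \<inter> frontier (UNIV - J_set D x)"

definition locally_translation_symmetric ::
  "('a \<Rightarrow> 'a \<Rightarrow> real) \<Rightarrow> 'a \<Rightarrow> real set \<Rightarrow> (real \<Rightarrow> 'a) \<Rightarrow> bool" where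
  "locally_translation_symmetric D x T c \<longleftrightarrow>
     c 0 = x \<and>
     (\<exists>\<epsilon>>0. \<exists>f :: real \<Rightarrow> real.
        smooth_on {-2*\<epsilon><..<2*\<epsilon>} f \<and> {-\<epsilon><..<\<epsilon>} \<subseteq> T \<and>
        (\<forall>t\<in>{-\<epsilon><..<\<epsilon>}. \<forall>t'\<in>{-\<epsilon><..<\<epsilon>}. D (c t) (c t') = f (t - t')))"

text \<open>Both signs occur in every neighborhood of \<open>0\<close>. If \<open>g\<close> is smooth near \<open>0\<close> and has a
  nonvanishing derivative of some order at \<open>0\<close>, or if \<open>g\<close> is analytic near \<open>0\<close>, this is the
  same as having strict opposite signs on the two sides of \<open>0\<close>.\<close>

definition changes_sign_at_0 :: "(real \<Rightarrow> real) \<Rightarrow> bool" where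
  "changes_sign_at_0 g \<longleftrightarrow>
     (\<forall>\<delta>>0. (\<exists>t. \<bar>t\<bar> < \<delta> \<and> g t > 0) \<and> (\<exists>t. \<bar>t\<bar> < \<delta> \<and> g t < 0))"

end

theory Submission
  imports Defs "HOL-Complex_Analysis.Complex_Analysis" "HOL-Probability.Probability"
begin

text \<open>Let \<open>\<rho>\<close> be a minimizer whose support has an interior point. The second variation of the action
  shows that \<open>L\<close> is a positive semidefinite kernel on \<open>supp \<rho>\<close>. If \<open>x\<close> is an interior point of the
  support and \<open>y \<in> K(x)\<close> lies in the support, then by the Cauchy-Schwarz inequality the function
  \<open>t \<mapsto> L(c(t), y)\<close> is as smooth as the translation invariant kernel along the curve, whereas it is the
  positive part of a function that changes sign to finite order; hence \<open>K(x) \<inter> supp \<rho>\<close> is empty.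
  A Baire category argument then yields an open subset \<open>U\<close> of the support and a closed set \<open>E\<close> with
  \<open>L(z, y) = 1\<^sub>E(y) D(z, y)\<close> for all \<open>z \<in> U\<close> and \<open>y \<in> supp \<rho>\<close>. By the Euler-Lagrange equations, the function
  \<open>h(z) = \<integral>\<^sub>E D(z, y) d\<rho>(y)\<close> is constant on \<open>U\<close>. In the smooth case this contradicts
  \<open>\<Delta> h < 0\<close> at a suitable point of \<open>U\<close>. In the analytic case \<open>h\<close> is constant everywhere, and comparing
  it with the Euler-Lagrange equations on all of \<open>supp \<rho>\<close> shows that \<open>E\<close> has full measure and
  that \<open>D \<ge> 0\<close> on the support.\<close>

section \<open>Calculus of \<open>C\<^sup>k\<close> functions and charts\<close>

text \<open>The obstacle is that \<open>max 0 D\<close> is not differentiable where \<open>D\<close>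
  changes sign, so neither \<open>\<Delta>\<close> nor analytic continuation applies to the
  Euler-Lagrange equations directly. The set \<open>E\<close>, the same for all
  \<open>z \<in> U\<close>, replaces the moving set I(z) and turns the nonsmoothness into a bounded
  weight in \<open>y\<close>. Order count behind the curve argument: for differences of order p + 1
  at step r, the quadratic form is O(r^(2p+2)), whereas the square of the difference of
  \<open>L (q t) y\<close> is at least of order r^(2p). Smoothness and analyticity enter there only
  through a leading term a t^n. The smooth case works at one generic point x: if
  \<open>y \<in> E\<close> lies in the support but outside the closure of I(x), then
  \<open>D z y\<close> vanishes for all z near x, so this y contributes nothing to
  \<open>\<Delta> h\<close> at x. In the analytic case one complex variable suffices: in a chart the
  integral is restricted to segments, where it extends holomorphically. The final comparison rests
  on \<open>max 0 D \<ge> 1_E D\<close>, which holds for all pairs of points.\<close>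

lemma frechet_derivative_cong_open:
  assumes "open S" "x \<in> S" "\<And>y. y \<in> S \<Longrightarrow> f y = g y"
  shows "frechet_derivative f (at x) = frechet_derivative g (at x)"
proof -
  \<comment> \<open>\<open>frechet_derivative\<close> is a choice among all derivatives. Equivalence
    of the two predicates therefore gives equality even at points where no derivative
    exists.\<close>
  have "(f has_derivative F) (at x) \<longleftrightarrow> (g has_derivative F) (at x)" for F
    using has_derivative_transform_within_open[of _ _ x UNIV S] assms by metis
  then show ?thesis
    unfolding frechet_derivative_def by simp
qed

lemma differentiable_cong_open:
  assumes "open S" "x \<in> S" "\<And>y. y \<in> S \<Longrightarrow> f y = g y"
  shows "f differentiable (at x) \<longleftrightarrow> g differentiable (at x)"
  unfolding differentiable_def
  using has_derivative_transform_within_open[of _ _ x UNIV S] assms by metis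

lemma frechet_derivative_eqI:
  "(f has_derivative F) (at x) \<Longrightarrow> frechet_derivative f (at x) = F"
  by (metis frechet_derivative_at)

lemma Ck_on_cong:
  assumes "open S" "\<And>x. x \<in> S \<Longrightarrow> f x = g x"
  shows "Ck_on k S f \<longleftrightarrow> Ck_on k S g"
  using assms(2)
proof (induction k arbitrary: f g)
  case 0
  then show ?case
    by (auto intro: continuous_on_cong)
next
  case (Suc k)
  have "Ck_on k S (\<lambda>x. frechet_derivative f (at x) v) \<longleftrightarrow> Ck_on k S (\<lambda>x. frechet_derivative g (at x) v)" for v
    by (rule Suc.IH) (simp add: frechet_derivative_cong_open[OF assms(1) _ Suc.prems])
  moreover have "f differentiable (at x) \<longleftrightarrow> g differentiable (at x)" if "x \<in> S" for x
    by (rule differentiable_cong_open[OF assms(1) that Suc.prems])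
  ultimately show ?case
    by simp
qed

lemma Ck_on_subset:
  "Ck_on k S f \<Longrightarrow> T \<subseteq> S \<Longrightarrow> Ck_on k T f"
  by (induction k arbitrary: f) (auto intro: continuous_on_subset)

lemma Ck_on_Suc_imp: "Ck_on (Suc k) S f \<Longrightarrow> Ck_on k S f"
proof (induction k arbitrary: f)
  case 0
  then show ?case
    by (auto intro!: differentiable_imp_continuous_on differentiable_at_imp_differentiable_on)
qed auto

lemma Ck_on_imp_continuous_on: "Ck_on k S f \<Longrightarrow> continuous_on S f"
  by (induction k) (use Ck_on_Suc_imp in auto)

lemma Ck_on_const: "Ck_on k S (\<lambda>_. c)"
  by (induction k arbitrary: c) (auto simp: frechet_derivative_const)

lemma Ck_on_add:
  assumes "open S" "Ck_on k S f" "Ck_on k S g"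
  shows "Ck_on k S (\<lambda>x. f x + g x)"
  using assms(2,3)
proof (induction k arbitrary: f g)
  case (Suc k)
  have *: "frechet_derivative (\<lambda>x. f x + g x) (at x) v =
    frechet_derivative f (at x) v + frechet_derivative g (at x) v" if "x \<in> S" for x v
    by (rule fun_cong[OF frechet_derivative_eqI])
      (use Suc.prems that frechet_derivative_works in \<open>auto intro!: has_derivative_add\<close>)
  show ?case
    using Suc by (auto simp: Ck_on_cong[OF assms(1) *] intro!: Suc.IH)
qed (auto intro: continuous_on_add)

lemma Ck_on_sum:
  assumes "open S" "finite I" "\<And>i. i \<in> I \<Longrightarrow> Ck_on k S (f i)"
  shows "Ck_on k S (\<lambda>x. \<Sum>i\<in>I. f i x)"
  using assms(2,3)
  by (induction I rule: finite_induct) (auto intro: Ck_on_const Ck_on_add assms(1))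

lemma Ck_on_mult:
  fixes f g :: "'e::euclidean_space \<Rightarrow> real"
  assumes "open S" "Ck_on k S f" "Ck_on k S g"
  shows "Ck_on k S (\<lambda>x. f x * g x)"
  using assms(2,3)
proof (induction k arbitrary: f g)
  case (Suc k)
  have *: "frechet_derivative (\<lambda>x. f x * g x) (at x) v =
    f x * frechet_derivative g (at x) v + frechet_derivative f (at x) v * g x" if "x \<in> S" for x v
    by (rule fun_cong[OF frechet_derivative_eqI])
      (use Suc.prems that frechet_derivative_works in \<open>auto intro!: has_derivative_mult\<close>)
  show ?case
    using Suc Suc.prems[THEN Ck_on_Suc_imp]
    by (auto simp: Ck_on_cong[OF assms(1) *] intro!: Ck_on_add Suc.IH assms(1))
qed (auto intro: continuous_on_mult)

lemma Ck_on_inner: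
  assumes "open S" "Ck_on k S f"
  shows "Ck_on k S (\<lambda>x. f x \<bullet> b)"
  using assms(2)
proof (induction k arbitrary: f)
  case (Suc k)
  have *: "frechet_derivative (\<lambda>x. f x \<bullet> b) (at x) v = frechet_derivative f (at x) v \<bullet> b"
    if "x \<in> S" for x v
    by (rule fun_cong[OF frechet_derivative_eqI])
      (use Suc.prems that frechet_derivative_works in \<open>auto intro!: has_derivative_inner_left\<close>)
  show ?case
    using Suc by (auto simp: Ck_on_cong[OF assms(1) *] intro!: Suc.IH differentiable_inner)
qed (auto intro!: continuous_intros)

lemma Ck_on_compose:
  fixes f :: "'e::euclidean_space \<Rightarrow> real" and g :: "'d::euclidean_space \<Rightarrow> 'e"
  assumes "open S" "open T" "g ` T \<subseteq> S" "Ck_on k S f" "Ck_on k T g"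
  shows "Ck_on k T (\<lambda>x. f (g x))"
  using assms(4,5)
proof (induction k arbitrary: f)
  case 0
  then show ?case
    using assms(3) by (auto intro: continuous_on_compose2)
next
  case (Suc k)
  have f: "(f has_derivative frechet_derivative f (at y)) (at y)" if "y \<in> S" for y
    using Suc.prems that by (auto simp: frechet_derivative_works[symmetric])
  have g: "(g has_derivative frechet_derivative g (at x)) (at x)" if "x \<in> T" for x
    using Suc.prems that by (auto simp: frechet_derivative_works[symmetric])
  have fg: "((\<lambda>x. f (g x)) has_derivative (\<lambda>v. frechet_derivative f (at (g x)) (frechet_derivative g (at x) v))) (at x)"
    if "x \<in> T" for x
    using has_derivative_compose[OF g[OF that] f] that assms(3) by blast
  \<comment> \<open>\<open>Ck_on\<close> speaks of derivatives in fixed directions, but here the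
    direction depends on \<open>x\<close>. Expanding it in the basis leaves products of functions to
    which the induction applies.\<close>
  have *: "frechet_derivative (\<lambda>x. f (g x)) (at x) v =
    (\<Sum>b\<in>Basis. (frechet_derivative g (at x) v \<bullet> b) * frechet_derivative f (at (g x)) b)"
    if "x \<in> T" for x v
  proof -
    have "frechet_derivative (\<lambda>x. f (g x)) (at x) v = frechet_derivative f (at (g x)) (frechet_derivative g (at x) v)"
      by (rule fun_cong[OF frechet_derivative_eqI[OF fg[OF that]]])
    also have "\<dots> = frechet_derivative f (at (g x)) (\<Sum>b\<in>Basis. (frechet_derivative g (at x) v \<bullet> b) *\<^sub>R b)"
      by (simp add: euclidean_representation)
    also have "\<dots> = (\<Sum>b\<in>Basis. (frechet_derivative g (at x) v \<bullet> b) * frechet_derivative f (at (g x)) b)"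
      using f[of "g x"] that assms(3)
      by (subst linear_sum) (auto simp: has_derivative_linear linear_cmul image_subset_iff)
    finally show ?thesis .
  qed
  have "Ck_on k T (\<lambda>x. \<Sum>b\<in>Basis. (frechet_derivative g (at x) v \<bullet> b) * frechet_derivative f (at (g x)) b)" for v
    using Suc.prems Ck_on_Suc_imp[OF Suc.prems(2)]
    by (auto intro!: Ck_on_sum Ck_on_mult Ck_on_inner Suc.IH assms(2))
  then show ?case
    using fg by (auto simp: Ck_on_cong[OF assms(2) *] differentiable_def)
qed

lemma iterated_partial_cong:
  assumes "open S" "\<And>y. y \<in> S \<Longrightarrow> f y = g y" "x \<in> S"
  shows "iterated_partial bs f x = iterated_partial bs g x"
  using assms(3)
proof (induction bs arbitrary: x)
  case (Cons b bs)
  then show ?case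
    by (simp add: frechet_derivative_cong_open[OF assms(1) Cons.prems Cons.IH])
qed (simp add: assms(2))

lemma atlas_chart:
  assumes "manifold_atlas P A" "(U, \<phi>) \<in> A"
  shows "open U" "open (\<phi> ` U)" "homeomorphism U (\<phi> ` U) \<phi> (inv_into U \<phi>)"
  using assms unfolding manifold_atlas_def by auto

lemma atlas_cover:
  assumes "manifold_atlas P A"
  obtains U \<phi> where "(U, \<phi>) \<in> A" "x \<in> U"
proof -
  have "x \<in> (\<Union>(U, \<phi>)\<in>A. U)"
    using assms by (simp add: manifold_atlas_def)
  then show ?thesis
    using that by auto
qed

lemma smooth_on_const: "smooth_on S (\<lambda>_. c)"
  by (simp add: smooth_on_def Ck_on_const)


section \<open>Smooth dependence of weighted integrals on parameters\<close>

lemma continuous_on_slice: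
  assumes "continuous_on (S \<times> UNIV) (\<lambda>(u, y). f u y)" "u \<in> S"
  shows "continuous_on UNIV (f u)"
proof -
  have "continuous_on UNIV ((\<lambda>(u, y). f u y) \<circ> Pair u)"
    by (intro continuous_on_compose continuous_on_subset[OF assms(1)] continuous_intros) (use assms(2) in auto)
  then show ?thesis
    by (simp add: o_def)
qed

lemma continuous_on_slice_fst:
  assumes "continuous_on (S \<times> UNIV) (\<lambda>(u, y). f u y)"
  shows "continuous_on S (\<lambda>u. f u y)"
proof -
  have "continuous_on S ((\<lambda>(u, y). f u y) \<circ> (\<lambda>u. (u, y)))"
    by (intro continuous_on_compose continuous_on_subset[OF assms(1)] continuous_intros) auto
  then show ?thesis
    by (simp add: o_def)
qed

text \<open>The second variable runs through a space without linear structure, so only derivatives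
  in \<open>u\<close> are taken. Their joint continuity is what makes estimates uniform in
  \<open>y\<close> on a compact space.\<close>

primrec Ck_fst :: "nat \<Rightarrow> 'e::euclidean_space set \<Rightarrow> ('e \<Rightarrow> 'a::topological_space \<Rightarrow> real) \<Rightarrow> bool" where
  "Ck_fst 0 S g \<longleftrightarrow> continuous_on (S \<times> UNIV) (\<lambda>(u, y). g u y)"
| "Ck_fst (Suc k) S g \<longleftrightarrow> continuous_on (S \<times> UNIV) (\<lambda>(u, y). g u y) \<and>
     (\<forall>y. \<forall>u\<in>S. (\<lambda>u. g u y) differentiable (at u)) \<and>
     (\<forall>v. Ck_fst k S (\<lambda>u y. frechet_derivative (\<lambda>u. g u y) (at u) v))"

definition smooth_fst :: "'e::euclidean_space set \<Rightarrow> ('e \<Rightarrow> 'a::topological_space \<Rightarrow> real) \<Rightarrow> bool" where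
  "smooth_fst S g \<longleftrightarrow> (\<forall>k. Ck_fst k S g)"

lemma Ck_fst_continuous: "Ck_fst k S g \<Longrightarrow> continuous_on (S \<times> UNIV) (\<lambda>(u, y). g u y)"
  by (cases k) auto

lemma smooth_fst_iterated_partial:
  assumes "smooth_fst S g"
  shows "smooth_fst S (\<lambda>u y. iterated_partial bs (\<lambda>u. g u y) u)"
proof (induction bs)
  case (Cons b bs)
  have "Ck_fst (Suc k) S (\<lambda>u y. iterated_partial bs (\<lambda>u. g u y) u)" for k
    using Cons by (simp add: smooth_fst_def del: Ck_fst.simps)
  then show ?case
    by (simp add: smooth_fst_def)
qed (simp add: assms)

lemma Ck_fst_imp_Ck_on: "Ck_fst k S g \<Longrightarrow> Ck_on k S (\<lambda>u. g u y)"
proof (induction k arbitrary: g)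
  case 0
  then show ?case
    by (simp add: continuous_on_slice_fst)
qed auto

text \<open>A derivative in \<open>u\<close> in direction \<open>w\<close> is the full derivative in
  direction \<open>(w, 0)\<close> in each product chart. The chartwise property \<open>Q\<close>
  thus passes from a function to its \<open>u\<close>-derivatives, which drives the
  induction.\<close>

lemma Ck_fst_chartwise:
  fixes A :: "('a::topological_space, 'd::euclidean_space) chart set"
    and g :: "'e::euclidean_space \<Rightarrow> 'a \<Rightarrow> real"
  assumes A: "manifold_atlas P A" and S: "open S"
    and g: "\<And>V \<psi>. (V, \<psi>) \<in> A \<Longrightarrow> Ck_on k (S \<times> \<psi> ` V) (\<lambda>(u, v). g u (inv_into V \<psi> v))"
  shows "Ck_fst k S g"
proof -
  define Q where "Q k g \<longleftrightarrow> (\<forall>V \<psi>. (V, \<psi>) \<in> A \<longrightarrow> Ck_on k (S \<times> \<psi> ` V) (\<lambda>(u, v). g u (inv_into V \<psi> v)))"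
    for k and g :: "'e \<Rightarrow> 'a \<Rightarrow> real"
  have cont: "continuous_on (S \<times> UNIV) (\<lambda>(u, y). g u y)"
    if g: "\<And>V \<psi>. (V, \<psi>) \<in> A \<Longrightarrow> continuous_on (S \<times> \<psi> ` V) (\<lambda>(u, v). g u (inv_into V \<psi> v))" for g :: "'e \<Rightarrow> 'a \<Rightarrow> real"
  proof -
    have eq: "S \<times> UNIV = (\<Union>(V, \<psi>)\<in>A. S \<times> V)"
      using A unfolding manifold_atlas_def by auto
    have "continuous_on (S \<times> V) (\<lambda>(u, y). g u y)" "open (S \<times> V)" if "(V, \<psi>) \<in> A" for V \<psi>
    proof -
      note V = atlas_chart(1)[OF A that] and h = atlas_chart(3)[OF A that]
      have "continuous_on (S \<times> V) (\<lambda>p. (case (fst p, \<psi> (snd p)) of (u, v) \<Rightarrow> g u (inv_into V \<psi> v)))"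
        by (rule continuous_on_compose2[OF g[OF that], where f="\<lambda>p. (fst p, \<psi> (snd p))"])
          (use homeomorphism_cont1[OF h] in \<open>auto intro!: continuous_on_Pair continuous_on_fst continuous_on_snd
            continuous_on_compose2[of V \<psi> "S \<times> V" snd]\<close>)
      then show "continuous_on (S \<times> V) (\<lambda>(u, y). g u y)"
        by (rule continuous_on_eq) (use homeomorphism_apply1[OF h] in auto)
      show "open (S \<times> V)"
        using S V by (rule open_Times)
    qed
    then have "continuous_on (S \<times> fst c) (\<lambda>(u, y). g u y)" "open (S \<times> fst c)" if "c \<in> A" for c
      using that by (metis prod.collapse)+
    then have "continuous_on (\<Union>c\<in>A. S \<times> fst c) (\<lambda>(u, y). g u y)"
      by (rule continuous_on_open_UN[rotated])
    then show ?thesis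
      by (simp add: eq case_prod_unfold)
  qed
  have "Q k g \<Longrightarrow> Ck_fst k S g"
  proof (induction k arbitrary: g)
    case 0
    show ?case
      unfolding Ck_fst.simps by (rule cont[of g], rule 0[unfolded Q_def Ck_on.simps, rule_format])
  next
    case (Suc k)
    note Q = Suc.prems[unfolded Q_def, rule_format]
    have ex: "\<exists>V \<psi>. (V, \<psi>) \<in> A \<and> y \<in> V" for y
      using atlas_cover[OF A] by metis
    have d: "((\<lambda>u. g u (inv_into V \<psi> v)) has_derivative
        (\<lambda>w. frechet_derivative (\<lambda>(u, v). g u (inv_into V \<psi> v)) (at (u, v)) (w, 0))) (at u)"
      if "(V, \<psi>) \<in> A" "u \<in> S" "v \<in> \<psi> ` V" for u v V \<psi>
    proof -
      have "((\<lambda>(u, v). g u (inv_into V \<psi> v)) has_derivative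
          frechet_derivative (\<lambda>(u, v). g u (inv_into V \<psi> v)) (at (u, v))) (at (u, v))"
        using Q[OF that(1)] that by (auto simp: frechet_derivative_works[symmetric])
      moreover have "((\<lambda>u. (u, v)) has_derivative (\<lambda>w. (w, 0))) (at u)"
        by (auto intro!: derivative_eq_intros)
      ultimately show ?thesis
        using has_derivative_compose[of "\<lambda>u. (u, v)" "\<lambda>w. (w, 0)" u UNIV "\<lambda>(u, v). g u (inv_into V \<psi> v)"]
        by fastforce
    qed
    have o: "open (S \<times> \<psi> ` V)" and h: "homeomorphism V (\<psi> ` V) \<psi> (inv_into V \<psi>)" if "(V, \<psi>) \<in> A" for V \<psi>
      using atlas_chart[OF A that] S by (auto intro!: open_Times)
    have "(\<lambda>u. g u y) differentiable (at u)" if "u \<in> S" for u y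
    proof -
      obtain V \<psi> where V: "(V, \<psi>) \<in> A" "y \<in> V"
        using ex by blast
      show ?thesis
        using d[OF V(1) that imageI[OF V(2)]] homeomorphism_apply1[OF h[OF V(1)] V(2)]
        by (auto simp: differentiable_def)
    qed
    moreover have "Ck_fst k S (\<lambda>u y. frechet_derivative (\<lambda>u. g u y) (at u) w)" for w
    proof (rule Suc.IH, unfold Q_def, intro allI impI)
      fix V \<psi> assume V: "(V, \<psi>) \<in> A"
      have eq: "(case p of (u, v) \<Rightarrow> frechet_derivative (\<lambda>u. g u (inv_into V \<psi> v)) (at u) w) =
          frechet_derivative (\<lambda>(u, v). g u (inv_into V \<psi> v)) (at p) (w, 0)"
        if "p \<in> S \<times> \<psi> ` V" for p
        using frechet_derivative_eqI[OF d[OF V, of "fst p" "snd p"]] that by (simp add: case_prod_unfold mem_Times_iff)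
      have "Ck_on k (S \<times> \<psi> ` V) (\<lambda>p. frechet_derivative (\<lambda>(u, v). g u (inv_into V \<psi> v)) (at p) (w, 0))"
        using Q[OF V] unfolding Ck_on.simps by blast
      moreover have "Ck_on k (S \<times> \<psi> ` V) (\<lambda>(u, v). frechet_derivative (\<lambda>u. g u (inv_into V \<psi> v)) (at u) w) \<longleftrightarrow>
          Ck_on k (S \<times> \<psi> ` V) (\<lambda>p. frechet_derivative (\<lambda>(u, v). g u (inv_into V \<psi> v)) (at p) (w, 0))"
        by (rule Ck_on_cong[OF o[OF V]]) (rule eq)
      ultimately show "Ck_on k (S \<times> \<psi> ` V) (\<lambda>(u, v). frechet_derivative (\<lambda>u. g u (inv_into V \<psi> v)) (at u) w)"
        by (rule rev_iffD2)
    qed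
    moreover have "continuous_on (S \<times> UNIV) (\<lambda>(u, y). g u y)"
      by (rule cont[of g], rule Ck_on_imp_continuous_on[of "Suc k"], rule Q)
    ultimately show ?case
      by simp
  qed
  moreover have "Q k g"
    unfolding Q_def
  proof (intro allI impI)
    fix V \<psi> assume "(V, \<psi>) \<in> A"
    then show "Ck_on k (S \<times> \<psi> ` V) (\<lambda>(u, v). g u (inv_into V \<psi> v))"
      by (rule g)
  qed
  ultimately show ?thesis
    by blast
qed

lemma integrable_bounded_weight:
  fixes f w :: "'a::topological_space \<Rightarrow> real"
  assumes "compact (UNIV :: 'a set)" "finite_measure \<rho>" "sets \<rho> = sets borel"
    and "w \<in> borel_measurable borel" "\<And>y. \<bar>w y\<bar> \<le> K" "continuous_on UNIV f"
  shows "integrable \<rho> (\<lambda>y. w y * f y)"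
proof -
  interpret finite_measure \<rho> by fact
  have "bounded (range f)"
    using compact_continuous_image[OF assms(6,1)] by (rule compact_imp_bounded)
  then obtain C where C: "\<And>y. \<bar>f y\<bar> \<le> C"
    unfolding bounded_iff by auto
  have "f \<in> borel_measurable borel"
    using assms(6) by (rule borel_measurable_continuous_onI)
  then have "(\<lambda>y. w y * f y) \<in> borel_measurable \<rho>"
    using assms(3,4) by (simp cong: measurable_cong_sets)
  moreover have "norm (w y * f y) \<le> K * C" for y
    using mult_mono[OF assms(5)[of y] C[of y]] assms(5)[of y] by (simp add: abs_mult)
  ultimately show ?thesis
    by (intro integrable_const_bound[where B="K * C"]) auto
qed

text \<open>Compactness of the second factor makes continuity in \<open>u\<close> uniform in
  \<open>y\<close>; the uniform error is then multiplied by at most \<open>K\<close> times the total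
  mass.\<close>

lemma continuous_on_weighted_integral:
  fixes g :: "'b::topological_space \<Rightarrow> 'a::topological_space \<Rightarrow> real"
  assumes compact: "compact (UNIV :: 'a set)" and \<rho>: "finite_measure \<rho>" "sets \<rho> = sets borel"
    and w: "w \<in> borel_measurable borel" "\<And>y. \<bar>w y\<bar> \<le> K"
    and cg: "continuous_on (S \<times> UNIV) (\<lambda>(u, y). g u y)"
  shows "continuous_on S (\<lambda>u. \<integral>y. w y * g u y \<partial>\<rho>)"
  unfolding continuous_on_def tendsto_iff
proof (intro ballI allI impI)
  interpret finite_measure \<rho> by (rule \<rho>)
  fix u and e :: real assume u: "u \<in> S" and e: "e > 0"
  define M where "M = K * measure \<rho> (space \<rho>)"
  have K0: "0 \<le> K"
    using w(2)[of undefined] by linarith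
  then have M: "0 \<le> M"
    by (simp add: M_def)
  define e' where "e' = e / (M + 1)"
  have e': "e' > 0"
    using e M by (simp add: e'_def)
  obtain X where X: "u \<in> X" "open X" "\<forall>x\<in>X \<inter> S. \<forall>t. \<bar>g x t - g u t\<bar> \<le> e'"
    by (rule continuous_on_prod_compactE[OF cg compact u e']) (auto simp: dist_real_def)
  have "dist (\<integral>y. w y * g u' y \<partial>\<rho>) (\<integral>y. w y * g u y \<partial>\<rho>) < e" if u': "u' \<in> X \<inter> S" for u'
  proof -
    note i = integrable_bounded_weight[OF compact \<rho> w continuous_on_slice[OF cg]]
    have "(\<integral>y. w y * g u' y \<partial>\<rho>) - (\<integral>y. w y * g u y \<partial>\<rho>) = (\<integral>y. w y * (g u' y - g u y) \<partial>\<rho>)"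
      using i[of u] i[of u'] u u' by (simp add: right_diff_distrib)
    also have "norm \<dots> \<le> (\<integral>y. K * e' \<partial>\<rho>)"
    proof (rule order_trans[OF integral_norm_bound integral_mono])
      show "integrable \<rho> (\<lambda>y. norm (w y * (g u' y - g u y)))"
        using i[of u] i[of u'] u u' by (simp add: right_diff_distrib)
      show "norm (w y * (g u' y - g u y)) \<le> K * e'" for y
        using mult_mono[OF w(2)[of y], of "\<bar>g u' y - g u y\<bar>" e'] X(3) u' K0 by (simp add: abs_mult)
    qed simp
    also have "\<dots> = M * e'"
      by (simp add: M_def)
    also have "\<dots> < e"
      using M e by (auto simp: e'_def field_simps)
    finally show ?thesis
      by (simp add: dist_real_def)
  qed
  then show "\<forall>\<^sub>F u' in at u within S. dist (\<integral>y. w y * g u' y \<partial>\<rho>) (\<integral>y. w y * g u y \<partial>\<rho>) < e"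
    unfolding eventually_at_topological using X(1,2) by blast
qed

text \<open>The linearization error of \<open>g\<close> is o(|u' - u|) uniformly in
  \<open>y\<close>, by the mean value inequality and the uniform continuity of the derivatives; this
  survives integration against a bounded weight.\<close>

lemma has_derivative_weighted_integral:
  fixes g :: "'e::euclidean_space \<Rightarrow> 'a::topological_space \<Rightarrow> real"
  assumes K: "compact (UNIV :: 'a set)" and \<rho>: "finite_measure \<rho>" "sets \<rho> = sets borel"
    and w: "w \<in> borel_measurable borel" "\<And>y. \<bar>w y\<bar> \<le> K"
    and S: "open S" "u \<in> S"
    and g: "Ck_fst (Suc 0) S g"
  shows "((\<lambda>u. \<integral>y. w y * g u y \<partial>\<rho>) has_derivative
    (\<lambda>v. \<integral>y. w y * frechet_derivative (\<lambda>u. g u y) (at u) v \<partial>\<rho>)) (at u)"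
proof -
  interpret finite_measure \<rho> by (rule \<rho>)
  define g' where "g' = (\<lambda>u y. frechet_derivative (\<lambda>u. g u y) (at u))"
  have d: "((\<lambda>u. g u y) has_derivative g' u y) (at u)" if "u \<in> S" for u y
    using g that by (auto simp: g'_def frechet_derivative_works[symmetric])
  have lin: "bounded_linear (g' u y)" if "u \<in> S" for u y
    using d[OF that] by (rule has_derivative_bounded_linear)
  have cg: "continuous_on (S \<times> UNIV) (\<lambda>(u, y). g u y)" and cg': "continuous_on (S \<times> UNIV) (\<lambda>(u, y). g' u y v)" for v
    using g by (auto simp: g'_def)
  have ig: "integrable \<rho> (\<lambda>y. w y * g u y)" and ig': "integrable \<rho> (\<lambda>y. w y * g' u y v)" if "u \<in> S" for u v
    by (rule integrable_bounded_weight[OF K \<rho> w continuous_on_slice[OF cg that]],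
        rule integrable_bounded_weight[OF K \<rho> w continuous_on_slice[OF cg' that]])
  define M where "M = K * measure \<rho> (space \<rho>)"
  have K0: "0 \<le> K"
    using w(2)[of undefined] by linarith
  then have M: "0 \<le> M"
    by (simp add: M_def)
  have "bounded_linear (\<lambda>v. \<integral>y. w y * g' u y v \<partial>\<rho>)"
    unfolding linear_conv_bounded_linear[symmetric]
  proof (rule linearI)
    note l = bounded_linear.linear[OF lin[OF S(2)]]
    show "(\<integral>y. w y * g' u y (a + b) \<partial>\<rho>) = (\<integral>y. w y * g' u y a \<partial>\<rho>) + (\<integral>y. w y * g' u y b \<partial>\<rho>)" for a b
      using ig'[OF S(2)] by (simp add: linear_add[OF l] distrib_left)
    have "(\<integral>y. w y * g' u y (r *\<^sub>R b) \<partial>\<rho>) = (\<integral>y. r * (w y * g' u y b) \<partial>\<rho>)" for r b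
      by (simp add: linear_cmul[OF l] mult.left_commute)
    then show "(\<integral>y. w y * g' u y (r *\<^sub>R b) \<partial>\<rho>) = r *\<^sub>R (\<integral>y. w y * g' u y b \<partial>\<rho>)" for r b
      by simp
  qed
  moreover have "\<exists>d>0. \<forall>u'. norm (u' - u) < d \<longrightarrow>
      norm ((\<integral>y. w y * g u' y \<partial>\<rho>) - (\<integral>y. w y * g u y \<partial>\<rho>) - (\<integral>y. w y * g' u y (u' - u) \<partial>\<rho>))
        \<le> e * norm (u' - u)" if e: "e > 0" for e
  proof -
    define e' where "e' = e / (M + 1)"
    have e': "e' > 0"
      using e M by (simp add: e'_def)
    \<comment> \<open>The tube argument controls one basis direction at a time; summing
      \<open>DIM('e)\<close> such errors gives the operator norm bound \<open>e'\<close>.\<close>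
    define e'' where "e'' = e' / DIM('e)"
    have e'': "e'' > 0"
      using e' by (simp add: e''_def)
    have "\<exists>X. u \<in> X \<and> open X \<and> (\<forall>x\<in>X \<inter> S. \<forall>t. \<bar>g' x t b - g' u t b\<bar> \<le> e'')" for b
      by (rule continuous_on_prod_compactE[OF cg'[of b] K S(2) e'']) (auto simp: dist_real_def)
    then obtain X where X': "\<And>b. u \<in> X b \<and> open (X b) \<and> (\<forall>x\<in>X b \<inter> S. \<forall>t. \<bar>g' x t b - g' u t b\<bar> \<le> e'')"
      by metis
    then have X: "\<And>b. u \<in> X b" "\<And>b. open (X b)"
        "\<And>b x t. x \<in> X b \<Longrightarrow> x \<in> S \<Longrightarrow> \<bar>g' x t b - g' u t b\<bar> \<le> e''"
      by auto
    have "open (S \<inter> (\<Inter>b\<in>Basis. X b))" "u \<in> S \<inter> (\<Inter>b\<in>Basis. X b)"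
      by (rule open_Int[OF S(1) open_INT[OF finite_Basis]]) (use X S in auto)
    then obtain d where d0: "d > 0" and dsub: "ball u d \<subseteq> S \<inter> (\<Inter>b\<in>Basis. X b)"
      using openE by blast
    have bd: "norm (g u' y - g u y - g' u y (u' - u)) \<le> e' * norm (u' - u)" if "norm (u' - u) < d" for u' y
    proof -
      \<comment> \<open>After subtracting the linear map \<open>g' u y\<close>, the derivative on
        the ball has operator norm at most \<open>e'\<close>, so the mean value inequality bounds
        the remainder.\<close>
      have "norm ((g u' y - g' u y u') - (g u y - g' u y u)) \<le> e' * norm (u' - u)"
      proof (rule differentiable_bound[where S="ball u d" and f="\<lambda>u'. g u' y - g' u y u'" and f'="\<lambda>x v. g' x y v - g' u y v"])
        fix x assume x: "x \<in> ball u d"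
        then have xS: "x \<in> S"
          using dsub by blast
        show "((\<lambda>u'. g u' y - g' u y u') has_derivative (\<lambda>v. g' x y v - g' u y v)) (at x within ball u d)"
          by (intro has_derivative_diff has_derivative_at_withinI[OF d[OF xS]] bounded_linear_imp_has_derivative lin S)
        show "onorm (\<lambda>v. g' x y v - g' u y v) \<le> e'"
        proof (rule onorm_le)
          fix v :: 'e
          have lin': "linear (\<lambda>v. g' x y v - g' u y v)"
            using bounded_linear_sub[OF lin[OF xS] lin[OF S(2)]] by (rule bounded_linear.linear)
          have "norm (g' x y v - g' u y v) = norm (\<Sum>b\<in>Basis. (v \<bullet> b) *\<^sub>R (g' x y b - g' u y b))"
            using linear_sum[OF lin', of "\<lambda>b. (v \<bullet> b) *\<^sub>R b" Basis] linear_cmul[OF lin']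
            by (simp add: euclidean_representation)
          also have "\<dots> \<le> (\<Sum>b\<in>(Basis::'e set). norm v * e'')"
          proof (rule sum_norm_le)
            fix b :: 'e assume b: "b \<in> Basis"
            have "\<bar>g' x y b - g' u y b\<bar> \<le> e''"
              using X(3)[of x b y] xS x dsub b by blast
            then show "norm ((v \<bullet> b) *\<^sub>R (g' x y b - g' u y b)) \<le> norm v * e''"
              using Basis_le_norm[OF b, of v] by (auto simp: abs_mult intro!: mult_mono)
          qed
          also have "\<dots> = e' * norm v"
            by (simp add: e''_def)
          finally show "norm (g' x y v - g' u y v) \<le> e' * norm v" .
        qed
      qed (use that d0 in \<open>auto simp: dist_norm norm_minus_commute\<close>)
      moreover have "g' u y (u' - u) = g' u y u' - g' u y u"
        by (rule linear_diff[OF bounded_linear.linear[OF lin[OF S(2)]]])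
      ultimately show ?thesis
        by (simp add: algebra_simps)
    qed
    have "norm ((\<integral>y. w y * g u' y \<partial>\<rho>) - (\<integral>y. w y * g u y \<partial>\<rho>) - (\<integral>y. w y * g' u y (u' - u) \<partial>\<rho>))
        \<le> e * norm (u' - u)" if u': "norm (u' - u) < d" for u'
    proof -
      have "u' \<in> S"
        using dsub u' by (auto simp: dist_norm norm_minus_commute)
      note i = ig[OF this] ig[OF S(2)] ig'[OF S(2)]
      have "(\<integral>y. w y * g u' y \<partial>\<rho>) - (\<integral>y. w y * g u y \<partial>\<rho>) - (\<integral>y. w y * g' u y (u' - u) \<partial>\<rho>) =
          (\<integral>y. w y * (g u' y - g u y - g' u y (u' - u)) \<partial>\<rho>)"
        using i by (simp add: right_diff_distrib)
      also have "norm \<dots> \<le> (\<integral>y. K * (e' * norm (u' - u)) \<partial>\<rho>)"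
      proof (rule order_trans[OF integral_norm_bound integral_mono])
        show "integrable \<rho> (\<lambda>y. norm (w y * (g u' y - g u y - g' u y (u' - u))))"
          using i by (simp add: right_diff_distrib)
        show "norm (w y * (g u' y - g u y - g' u y (u' - u))) \<le> K * (e' * norm (u' - u))" for y
          using mult_mono[OF w(2)[of y] bd[OF u', of y]] K0 by (simp add: abs_mult)
      qed simp
      also have "\<dots> = M * e' * norm (u' - u)"
        by (simp add: M_def)
      also have "\<dots> \<le> e * norm (u' - u)"
        using M e by (intro mult_right_mono) (auto simp: e'_def field_simps)
      finally show ?thesis .
    qed
    then show ?thesis
      using d0 by blast
  qed
  ultimately have "((\<lambda>u. \<integral>y. w y * g u y \<partial>\<rho>) has_derivative (\<lambda>v. \<integral>y. w y * g' u y v \<partial>\<rho>)) (at u)"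
    unfolding has_derivative_at_alt by blast
  then show ?thesis
    by (simp add: g'_def)
qed

context
  fixes \<rho> :: "'a::topological_space measure" and w :: "'a \<Rightarrow> real" and K :: real and S :: "'e::euclidean_space set"
  assumes compact: "compact (UNIV :: 'a set)" and \<rho>: "finite_measure \<rho>" "sets \<rho> = sets borel"
    and w: "w \<in> borel_measurable borel" "\<And>y. \<bar>w y\<bar> \<le> K"
    and S: "open S"
begin

lemma Ck_on_weighted_integral:
  assumes "Ck_fst k S g"
  shows "Ck_on k S (\<lambda>u. \<integral>y. w y * g u y \<partial>\<rho>)"
  using assms
proof (induction k arbitrary: g)
  case 0
  then show ?case
    by (simp add: continuous_on_weighted_integral[OF compact \<rho> w])
next
  case (Suc k)
  have "Ck_fst (Suc 0) S g"
    using Suc.prems Ck_fst_continuous[of k S "\<lambda>u y. frechet_derivative (\<lambda>u. g u y) (at u) v" for v]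
    by simp
  then have d: "((\<lambda>u. \<integral>y. w y * g u y \<partial>\<rho>) has_derivative
    (\<lambda>v. \<integral>y. w y * frechet_derivative (\<lambda>u. g u y) (at u) v \<partial>\<rho>)) (at u)" if "u \<in> S" for u
    using that by (intro has_derivative_weighted_integral[OF compact \<rho> w S])
  have *: "frechet_derivative (\<lambda>u. \<integral>y. w y * g u y \<partial>\<rho>) (at u) v =
      (\<integral>y. w y * frechet_derivative (\<lambda>u. g u y) (at u) v \<partial>\<rho>)" if "u \<in> S" for u v
    by (simp add: frechet_derivative_eqI[OF d[OF that]])
  show ?case
    using Suc d by (auto simp: Ck_on_cong[OF S *] differentiable_def)
qed

lemma iterated_partial_weighted_integral:
  assumes "smooth_fst S g" "u \<in> S"
  shows "iterated_partial bs (\<lambda>u. \<integral>y. w y * g u y \<partial>\<rho>) u =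
    (\<integral>y. w y * iterated_partial bs (\<lambda>u. g u y) u \<partial>\<rho>)"
  using assms(2)
proof (induction bs arbitrary: u)
  case (Cons b bs)
  have "Ck_fst (Suc 0) S (\<lambda>u y. iterated_partial bs (\<lambda>u. g u y) u)"
    using smooth_fst_iterated_partial[OF assms(1)] unfolding smooth_fst_def by blast
  from has_derivative_weighted_integral[OF compact \<rho> w S Cons.prems this]
  show ?case
    by (simp add: frechet_derivative_cong_open[OF S Cons.prems Cons.IH] frechet_derivative_eqI)
qed simp

end


section \<open>First and second variation of the action\<close>

text \<open>The new measure is at most \<open>K\<close> times the old one, so a set approximated up
  to \<open>e / K\<close> for \<open>\<rho>\<close> is approximated up to \<open>e\<close> for the
  density.\<close>

lemma regular_prob_measures_density:
  fixes \<rho> :: "'a::t2_space measure"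
  assumes \<rho>: "\<rho> \<in> regular_prob_measures"
    and f: "f \<in> borel_measurable borel" "\<And>x. 0 \<le> f x" "\<And>x. f x \<le> K" "(\<integral>x. f x \<partial>\<rho>) = 1"
  shows "density \<rho> (\<lambda>x. ennreal (f x)) \<in> regular_prob_measures"
proof -
  have sets [measurable_cong, simp]: "sets \<rho> = sets borel" and one: "emeasure \<rho> UNIV = 1"
    and reg: "\<And>B. B \<in> sets borel \<Longrightarrow> emeasure \<rho> B = (SUP C\<in>{C. compact C \<and> C \<subseteq> B}. emeasure \<rho> C)"
      "\<And>B. B \<in> sets borel \<Longrightarrow> emeasure \<rho> B = (INF U\<in>{U. open U \<and> B \<subseteq> U}. emeasure \<rho> U)"
    using \<rho> unfolding regular_prob_measures_def by blast+
  have space [simp]: "space \<rho> = UNIV"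
    using sets_eq_imp_space_eq[OF sets] by simp
  interpret prob_space \<rho>
    by standard (simp add: one)
  note f(1)[measurable]
  have K: "0 < K"
  proof (rule ccontr)
    assume "\<not> 0 < K"
    then have "f x = 0" for x
      using f(2)[of x] f(3)[of x] by linarith
    then show False
      using f(4) by simp
  qed
  define \<nu> where "\<nu> = density \<rho> (\<lambda>x. ennreal (f x))"
  have sets_\<nu>: "sets \<nu> = sets borel"
    by (simp add: \<nu>_def)
  have le: "emeasure \<nu> B \<le> ennreal K * emeasure \<rho> B" if [measurable]: "B \<in> sets borel" for B
  proof -
    have "emeasure \<nu> B = (\<integral>\<^sup>+ x. ennreal (f x) * indicator B x \<partial>\<rho>)"
      unfolding \<nu>_def by (rule emeasure_density) auto
    also have "\<dots> \<le> (\<integral>\<^sup>+ x. ennreal K * indicator B x \<partial>\<rho>)"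
      using f(3) by (intro nn_integral_mono mult_right_mono ennreal_leI) auto
    also have "\<dots> = ennreal K * emeasure \<rho> B"
      by (simp add: nn_integral_cmult_indicator)
    finally show ?thesis .
  qed
  have "emeasure \<nu> UNIV = (\<integral>\<^sup>+ x. ennreal (f x) \<partial>\<rho>)"
    unfolding \<nu>_def by (subst emeasure_density) auto
  also have "\<dots> = ennreal (\<integral>x. f x \<partial>\<rho>)"
    using f by (intro nn_integral_eq_integral integrable_const_bound[where B=K]) auto
  finally have one_\<nu>: "emeasure \<nu> UNIV = 1"
    by (simp add: f(4))
  have small: "emeasure \<nu> (X - Y) \<le> ennreal e"
    if X: "X \<in> sets borel" and Y: "Y \<in> sets borel" "Y \<subseteq> X"
      and lt: "emeasure \<rho> X < emeasure \<rho> Y + ennreal (e / K)" for X Y e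
  proof -
    have "emeasure \<rho> Y + emeasure \<rho> (X - Y) = emeasure \<rho> X"
      using X Y by (subst plus_emeasure) (auto simp: Un_absorb1)
    then have "emeasure \<rho> Y + emeasure \<rho> (X - Y) < emeasure \<rho> Y + ennreal (e / K)"
      using lt by simp
    then have "emeasure \<rho> (X - Y) \<le> ennreal (e / K)"
      using add_left_mono linorder_not_less by (metis less_imp_le linorder_linear)
    then have "ennreal K * emeasure \<rho> (X - Y) \<le> ennreal K * ennreal (e / K)"
      by (rule mult_left_mono) simp
    also have "\<dots> = ennreal e"
      using K by (simp flip: ennreal_mult')
    finally show ?thesis
      using le[of "X - Y"] X Y by auto
  qed
  have "emeasure \<nu> B = (SUP C\<in>{C. compact C \<and> C \<subseteq> B}. emeasure \<nu> C)" if B: "B \<in> sets borel" for B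
  proof (rule antisym)
    show "(SUP C\<in>{C. compact C \<and> C \<subseteq> B}. emeasure \<nu> C) \<le> emeasure \<nu> B"
      using B by (intro SUP_least emeasure_mono) (auto simp: sets_\<nu>)
    show "emeasure \<nu> B \<le> (SUP C\<in>{C. compact C \<and> C \<subseteq> B}. emeasure \<nu> C)"
    proof (rule ennreal_le_epsilon)
      fix e :: real assume e: "0 < e"
      have "\<exists>C\<in>{C. compact C \<and> C \<subseteq> B}. emeasure \<rho> B < emeasure \<rho> C + ennreal (e / K)"
        using e K by (intro SUP_approx_ennreal[OF _ _ reg(1)[OF B]]) auto
      then obtain C where C: "compact C" "C \<subseteq> B" "emeasure \<rho> B < emeasure \<rho> C + ennreal (e / K)"
        by blast
      have Cm: "C \<in> sets borel"
        using compact_imp_closed[OF C(1)] by auto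
      have "emeasure \<nu> B = emeasure \<nu> C + emeasure \<nu> (B - C)"
        using B C Cm by (subst plus_emeasure) (auto simp: Un_absorb1 sets_\<nu>)
      also have "\<dots> \<le> (SUP C\<in>{C. compact C \<and> C \<subseteq> B}. emeasure \<nu> C) + ennreal e"
        using C small[OF B Cm C(2,3)] by (intro add_mono SUP_upper) auto
      finally show "emeasure \<nu> B \<le> (SUP C\<in>{C. compact C \<and> C \<subseteq> B}. emeasure \<nu> C) + ennreal e" .
    qed
  qed
  moreover have "emeasure \<nu> B = (INF U\<in>{U. open U \<and> B \<subseteq> U}. emeasure \<nu> U)" if B: "B \<in> sets borel" for B
  proof (rule antisym)
    show "emeasure \<nu> B \<le> (INF U\<in>{U. open U \<and> B \<subseteq> U}. emeasure \<nu> U)"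
      by (intro INF_greatest emeasure_mono) (auto simp: sets_\<nu>)
    show "(INF U\<in>{U. open U \<and> B \<subseteq> U}. emeasure \<nu> U) \<le> emeasure \<nu> B"
    proof (rule ennreal_le_epsilon)
      fix e :: real assume e: "0 < e"
      have "\<exists>U\<in>{U. open U \<and> B \<subseteq> U}. emeasure \<rho> U < emeasure \<rho> B + ennreal (e / K)"
        using e K by (intro INF_approx_ennreal[OF _ reg(2)[OF B]]) (auto simp: emeasure_eq_measure)
      then obtain U where U: "open U" "B \<subseteq> U" "emeasure \<rho> U < emeasure \<rho> B + ennreal (e / K)"
        by blast
      have Um: "U \<in> sets borel"
        using U(1) by auto
      have "(INF U\<in>{U. open U \<and> B \<subseteq> U}. emeasure \<nu> U) \<le> emeasure \<nu> U"
        using U by (intro INF_lower) auto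
      also have "emeasure \<nu> U = emeasure \<nu> B + emeasure \<nu> (U - B)"
        using B U Um by (subst plus_emeasure) (auto simp: Un_absorb1 sets_\<nu>)
      also have "\<dots> \<le> emeasure \<nu> B + ennreal e"
        using small[OF Um B U(2,3)] by (intro add_mono) auto
      finally show "(INF U\<in>{U. open U \<and> B \<subseteq> U}. emeasure \<nu> U) \<le> emeasure \<nu> B + ennreal e" .
    qed
  qed
  ultimately show ?thesis
    unfolding \<nu>_def[symmetric] regular_prob_measures_def using sets_\<nu> one_\<nu> by blast
qed

text \<open>The complement of the support is a union of open null sets; a countable basis reduces it
  to a countable union.\<close>

lemma AE_supp:
  fixes \<rho> :: "'a::second_countable_topology measure"
  assumes "sets \<rho> = sets borel"
  shows "AE x in \<rho>. x \<in> supp \<rho>"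
proof -
  obtain \<B> :: "'a set set" where \<B>: "countable \<B>" "topological_basis \<B>"
    using ex_countable_basis by blast
  define N where "N = \<Union>{U \<in> \<B>. emeasure \<rho> U = 0}"
  have "N \<in> null_sets \<rho>"
  proof -
    have "U \<in> null_sets \<rho>" if "U \<in> {U \<in> \<B>. emeasure \<rho> U = 0}" for U
      using that topological_basis_open[OF \<B>(2)] assms by (auto intro!: null_setsI)
    then show ?thesis
      unfolding N_def using \<B>(1) null_sets_UN'[of "{U \<in> \<B>. emeasure \<rho> U = 0}" "\<lambda>U. U"] by auto
  qed
  moreover have "{x \<in> space \<rho>. x \<notin> supp \<rho>} \<subseteq> N"
  proof
    fix x assume "x \<in> {x \<in> space \<rho>. x \<notin> supp \<rho>}"
    then obtain U where U: "open U" "x \<in> U" "emeasure \<rho> U = 0"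
      by (auto simp: supp_def)
    obtain B where B: "B \<in> \<B>" "x \<in> B" "B \<subseteq> U"
      using topological_basisE[OF \<B>(2) U(1,2)] by blast
    have "emeasure \<rho> B \<le> emeasure \<rho> U"
      using U(1) by (intro emeasure_mono B) (auto simp: assms)
    then show "x \<in> N"
      using B U by (auto simp: N_def)
  qed
  ultimately show ?thesis
    by (rule AE_I')
qed

lemma closed_supp: "closed (supp \<rho>)"
proof -
  have "- supp \<rho> = \<Union>{U. open U \<and> emeasure \<rho> U = 0}"
    by (auto simp: supp_def)
  then show ?thesis
    by (simp add: closed_def open_Union)
qed

lemma quadratic_nonneg_near_0:
  fixes a b d :: real
  assumes d: "d > 0" and q: "\<And>t. \<bar>t\<bar> \<le> d \<Longrightarrow> 0 \<le> 2 * t * a + t\<^sup>2 * b"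
  shows "a = 0" "0 \<le> b"
proof -
  show a: "a = 0"
  proof (rule ccontr)
    assume "a \<noteq> 0"
    \<comment> \<open>For this step size t |b| is at most |a|, so the quadratic term cannot
      compensate the linear term 2 t |a| once the sign of t is chosen opposite to that of a.\<close>
    define t where "t = min d (\<bar>a\<bar> / (\<bar>b\<bar> + 1))"
    have t: "0 < t" "t \<le> d"
      using d \<open>a \<noteq> 0\<close> by (auto simp: t_def)
    have "t \<le> \<bar>a\<bar> / (\<bar>b\<bar> + 1)"
      by (simp add: t_def)
    then have "t * (\<bar>b\<bar> + 1) \<le> \<bar>a\<bar>"
      by (simp add: pos_le_divide_eq)
    then have tb: "t * \<bar>b\<bar> < 2 * \<bar>a\<bar>"
      using t \<open>a \<noteq> 0\<close> by (simp add: algebra_simps)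
    have "0 \<le> 2 * (- sgn a * t) * a + (- sgn a * t)\<^sup>2 * b"
      by (rule q) (use t in \<open>auto simp: abs_mult abs_sgn_eq\<close>)
    also have "\<dots> = t * (- 2 * \<bar>a\<bar> + t * b)"
      using \<open>a \<noteq> 0\<close> by (auto simp: sgn_if power2_eq_square algebra_simps)
    also have "\<dots> < 0"
    proof -
      have "t * b \<le> t * \<bar>b\<bar>"
        using t by (simp add: mult_left_mono)
      then have "- 2 * \<bar>a\<bar> + t * b < 0"
        using tb by linarith
      then show ?thesis
        by (rule mult_pos_neg[OF t(1)])
    qed
    finally show False
      by simp
  qed
  have "0 \<le> d\<^sup>2 * b"
    using q[of d] d a by simp
  then show "0 \<le> b"
    using d by (simp add: zero_le_mult_iff)
qed

text \<open>This is the class of test densities for variations: closed under products and containing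
  indicators of open sets, which later replace point masses.\<close>

definition bounded_borel :: "('a::topological_space \<Rightarrow> real) \<Rightarrow> bool" where
  "bounded_borel f \<longleftrightarrow> f \<in> borel_measurable borel \<and> bounded (range f)"

lemma bounded_borelI: "f \<in> borel_measurable borel \<Longrightarrow> (\<And>x. \<bar>f x\<bar> \<le> K) \<Longrightarrow> bounded_borel f"
  by (auto simp: bounded_borel_def bounded_iff)

lemma bounded_borelE:
  assumes "bounded_borel f"
  obtains K where "f \<in> borel_measurable borel" "\<And>x. \<bar>f x\<bar> \<le> K" "0 \<le> K"
proof -
  obtain K where K: "f \<in> borel_measurable borel" "\<And>x. \<bar>f x\<bar> \<le> K"
    using assms by (auto simp: bounded_borel_def bounded_iff)
  moreover have "0 \<le> K"
    using K(2)[of undefined] by linarith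
  ultimately show ?thesis
    using that by blast
qed

lemma bounded_borel_const [simp]: "bounded_borel (\<lambda>_. a)"
  by (rule bounded_borelI[where K="\<bar>a\<bar>"]) auto

lemma bounded_borel_add:
  assumes "bounded_borel f" "bounded_borel g"
  shows "bounded_borel (\<lambda>x. f x + g x)"
  using assms by (auto simp: bounded_borel_def bounded_plus_comp)

lemma bounded_borel_mult:
  assumes "bounded_borel f" "bounded_borel g"
  shows "bounded_borel (\<lambda>x. f x * g x)"
proof -
  obtain K where K: "f \<in> borel_measurable borel" "\<And>x. \<bar>f x\<bar> \<le> K" "0 \<le> K"
    using assms(1) by (rule bounded_borelE) blast
  obtain M where M: "g \<in> borel_measurable borel" "\<And>x. \<bar>g x\<bar> \<le> M" "0 \<le> M"
    using assms(2) by (rule bounded_borelE) blast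
  show ?thesis
    using K M by (intro bounded_borelI[where K="K * M"]) (auto simp: abs_mult intro!: mult_mono)
qed

lemma bounded_borel_diff:
  assumes "bounded_borel f" "bounded_borel g"
  shows "bounded_borel (\<lambda>x. f x - g x)"
  using assms by (auto simp: bounded_borel_def bounded_minus_comp)

lemma bounded_borel_indicator: "B \<in> sets borel \<Longrightarrow> bounded_borel (indicator B)"
  by (rule bounded_borelI[where K=1]) (auto simp: indicator_def)

lemma bounded_borel_sum:
  "finite I \<Longrightarrow> (\<And>i. i \<in> I \<Longrightarrow> bounded_borel (f i)) \<Longrightarrow> bounded_borel (\<lambda>x. \<Sum>i\<in>I. f i x)"
  by (induction I rule: finite_induct) (auto intro: bounded_borel_add)

lemma bounded_borel_continuous:
  fixes f :: "'a::topological_space \<Rightarrow> real"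
  assumes "compact (UNIV :: 'a set)" "continuous_on UNIV f"
  shows "bounded_borel f"
  unfolding bounded_borel_def
  using borel_measurable_continuous_onI[OF assms(2)] compact_continuous_image[OF assms(2,1)]
  by (auto intro: compact_imp_bounded)

section \<open>The quadratic form of a continuous symmetric kernel\<close>

locale continuous_kernel = prob_space \<rho>
  for \<rho> :: "'a::{t2_space, second_countable_topology} measure" +
  fixes L :: "'a \<Rightarrow> 'a \<Rightarrow> real"
  assumes compact_UNIV: "compact (UNIV :: 'a set)"
    and sets [measurable_cong, simp]: "sets \<rho> = sets borel"
    and cont_L: "continuous_on UNIV (\<lambda>(x, y). L x y)"
    and L_sym: "L x y = L y x"
begin

lemma space_UNIV [simp]: "space \<rho> = UNIV"
  using sets_eq_imp_space_eq[OF sets] by simp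

lemma measurable_L [measurable]: "(\<lambda>(x, y). L x y) \<in> borel_measurable (borel \<Otimes>\<^sub>M borel)"
  using borel_measurable_continuous_onI[OF cont_L] by (simp add: borel_prod)

lemma L_bounded: obtains K where "\<And>x y. \<bar>L x y\<bar> \<le> K" "0 \<le> K"
proof -
  have "compact (UNIV :: ('a \<times> 'a) set)"
    using compact_Times[OF compact_UNIV compact_UNIV] by simp
  then have "bounded_borel (\<lambda>(x, y). L x y)"
    using cont_L by (rule bounded_borel_continuous)
  then obtain K where "\<And>p. \<bar>(\<lambda>(x, y). L x y) p\<bar> \<le> K" "0 \<le> K"
    by (metis bounded_borelE)
  then show ?thesis
    using that by (metis case_prod_conv)
qed

lemma integrable_bounded_borel [simp]:
  assumes "bounded_borel f"
  shows "integrable \<rho> f"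
proof -
  obtain K where K: "f \<in> borel_measurable borel" "\<And>x. \<bar>f x\<bar> \<le> K"
    using assms by (rule bounded_borelE) blast
  then show ?thesis
    by (intro integrable_const_bound[where B=K]) auto
qed

lemma L_slice_continuous: "continuous_on UNIV (L x)"
  by (rule continuous_on_slice[of UNIV]) (use cont_L in auto)

lemma bounded_borel_slice: "bounded_borel (L x)"
  by (rule bounded_borel_continuous[OF compact_UNIV L_slice_continuous])

definition Lop :: "('a \<Rightarrow> real) \<Rightarrow> 'a \<Rightarrow> real" where
  "Lop f x = (\<integral>y. f y * L x y \<partial>\<rho>)"

lemma continuous_Lop:
  assumes "bounded_borel f"
  shows "continuous_on UNIV (Lop f)"
proof -
  obtain K where K: "f \<in> borel_measurable borel" "\<And>x. \<bar>f x\<bar> \<le> K"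
    using assms by (rule bounded_borelE) blast
  have "continuous_on UNIV (\<lambda>x. \<integral>y. f y * L x y \<partial>\<rho>)"
    by (rule continuous_on_weighted_integral[OF compact_UNIV finite_measure_axioms sets K])
      (use cont_L in simp)
  then show ?thesis
    by (simp add: Lop_def[abs_def])
qed

lemma bounded_borel_Lop: "bounded_borel f \<Longrightarrow> bounded_borel (Lop f)"
  by (rule bounded_borel_continuous[OF compact_UNIV continuous_Lop])

lemma Lop_add: "bounded_borel f \<Longrightarrow> bounded_borel g \<Longrightarrow> Lop (\<lambda>x. f x + g x) x = Lop f x + Lop g x"
  by (simp add: Lop_def distrib_right bounded_borel_mult bounded_borel_slice)

lemma Lop_cmult: "Lop (\<lambda>x. c * f x) x = c * Lop f x"
  by (simp add: Lop_def mult.assoc)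

text \<open>This is the mutual energy of the signed measures with densities \<open>f\<close> and
  \<open>g\<close> relative to \<open>\<rho>\<close>; the action of the measure with density
  \<open>f\<close> is \<open>form f f\<close>.\<close>

definition form :: "('a \<Rightarrow> real) \<Rightarrow> ('a \<Rightarrow> real) \<Rightarrow> real" where
  "form f g = (\<integral>x. f x * Lop g x \<partial>\<rho>)"

lemma form_sym:
  assumes f: "bounded_borel f" and g: "bounded_borel g"
  shows "form f g = form g f"
proof -
  interpret pair_prob_space \<rho> \<rho> ..
  obtain K where K: "\<And>x y. \<bar>L x y\<bar> \<le> K" "0 \<le> K"
    by (rule L_bounded) blast
  obtain A where A [measurable]: "f \<in> borel_measurable borel" and A': "\<And>x. \<bar>f x\<bar> \<le> A" "0 \<le> A"
    using f by (rule bounded_borelE) blast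
  obtain B where B [measurable]: "g \<in> borel_measurable borel" and B': "\<And>x. \<bar>g x\<bar> \<le> B" "0 \<le> B"
    using g by (rule bounded_borelE) blast
  have "\<bar>f x * (g y * L x y)\<bar> \<le> A * (B * K)" for x y
    unfolding abs_mult using A' B' K by (intro mult_mono) auto
  then have "integrable (\<rho> \<Otimes>\<^sub>M \<rho>) (\<lambda>(x, y). f x * (g y * L x y))"
    by (intro P.integrable_const_bound[where B="A * (B * K)"]) auto
  from Fubini_integral[OF this]
  have "(\<integral>x. (\<integral>y. f x * (g y * L x y) \<partial>\<rho>) \<partial>\<rho>) = (\<integral>y. (\<integral>x. f x * (g y * L x y) \<partial>\<rho>) \<partial>\<rho>)"
    by simp
  also have "\<dots> = (\<integral>y. (\<integral>x. g y * (f x * L y x) \<partial>\<rho>) \<partial>\<rho>)"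
    by (intro Bochner_Integration.integral_cong refl) (metis L_sym mult.left_commute)
  finally show ?thesis
    by (simp add: form_def Lop_def)
qed

lemma form_add_left:
  "bounded_borel f \<Longrightarrow> bounded_borel g \<Longrightarrow> bounded_borel h \<Longrightarrow> form (\<lambda>x. f x + g x) h = form f h + form g h"
  by (simp add: form_def distrib_right bounded_borel_mult bounded_borel_Lop)

lemma form_cmult_left: "form (\<lambda>x. c * f x) h = c * form f h"
  by (simp add: form_def mult.assoc)

lemma form_cmult_right: "form h (\<lambda>x. c * f x) = c * form h f"
  by (simp add: form_def Lop_cmult mult.left_commute)

lemma form_add_right:
  "bounded_borel f \<Longrightarrow> bounded_borel g \<Longrightarrow> bounded_borel h \<Longrightarrow> form h (\<lambda>x. f x + g x) = form h f + form h g"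
  by (simp add: form_def Lop_add distrib_left bounded_borel_mult bounded_borel_Lop)

lemma form_sum_left:
  assumes "finite I" "\<And>i. i \<in> I \<Longrightarrow> bounded_borel (f i)" "bounded_borel h"
  shows "form (\<lambda>x. \<Sum>i\<in>I. f i x) h = (\<Sum>i\<in>I. form (f i) h)"
  using assms(1,2)
proof (induction I rule: finite_induct)
  case empty
  show ?case
    by (simp add: form_def)
qed (use assms(3) in \<open>simp add: form_add_left bounded_borel_sum\<close>)

lemma form_sum_sum:
  assumes "finite I" "\<And>i. i \<in> I \<Longrightarrow> bounded_borel (f i)"
  shows "form (\<lambda>x. \<Sum>i\<in>I. f i x) (\<lambda>x. \<Sum>i\<in>I. f i x) = (\<Sum>i\<in>I. \<Sum>j\<in>I. form (f i) (f j))"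
proof -
  have b: "bounded_borel (\<lambda>x. \<Sum>i\<in>I. f i x)"
    using assms by (rule bounded_borel_sum)
  have "form (\<lambda>x. \<Sum>i\<in>I. f i x) (\<lambda>x. \<Sum>i\<in>I. f i x) = (\<Sum>i\<in>I. form (f i) (\<lambda>x. \<Sum>i\<in>I. f i x))"
    using form_sum_left[OF assms b] by simp
  also have "\<dots> = (\<Sum>i\<in>I. \<Sum>j\<in>I. form (f i) (f j))"
  proof (rule sum.cong[OF refl])
    fix i assume i: "i \<in> I"
    have "form (f i) (\<lambda>x. \<Sum>i\<in>I. f i x) = (\<Sum>j\<in>I. form (f j) (f i))"
      using form_sym[OF assms(2)[OF i] b] form_sum_left[OF assms assms(2)[OF i]] by simp
    then show "form (f i) (\<lambda>x. \<Sum>i\<in>I. f i x) = (\<Sum>j\<in>I. form (f i) (f j))"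
      using form_sym assms(2) i by (simp cong: sum.cong)
  qed
  finally show ?thesis .
qed

end

section \<open>Variations around a minimizer and positive semidefiniteness\<close>

locale minimizing_kernel = continuous_kernel +
  assumes regular: "\<rho> \<in> regular_prob_measures"
    and L_nonneg: "0 \<le> L x y"
    and minimal: "\<nu> \<in> regular_prob_measures \<Longrightarrow>
      (\<integral>x. (\<integral>y. L x y \<partial>\<rho>) \<partial>\<rho>) \<le> (\<integral>x. (\<integral>y. L x y \<partial>\<nu>) \<partial>\<nu>)"
begin

definition S :: real where "S = form (\<lambda>_. 1) (\<lambda>_. 1)"

lemma S_nonneg: "0 \<le> S"
  by (simp add: S_def form_def Lop_def L_nonneg)

text \<open>A measure with a bounded density relative to \<open>\<rho>\<close> is an admissible
  competitor, and its action is \<open>form f f\<close>.\<close>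

lemma S_le_form:
  assumes f: "bounded_borel f" "\<And>x. 0 \<le> f x" "(\<integral>x. f x \<partial>\<rho>) = 1"
  shows "S \<le> form f f"
proof -
  obtain K where K: "f \<in> borel_measurable borel" "\<And>x. \<bar>f x\<bar> \<le> K"
    using f(1) by (rule bounded_borelE) blast
  note K(1)[measurable]
  define \<nu> where "\<nu> = density \<rho> (\<lambda>x. ennreal (f x))"
  have "\<nu> \<in> regular_prob_measures"
    unfolding \<nu>_def
    by (rule regular_prob_measures_density[OF regular K(1) f(2) _ f(3)]) (use K(2) in \<open>auto simp: abs_le_iff\<close>)
  from minimal[OF this] have "S \<le> (\<integral>x. (\<integral>y. L x y \<partial>\<nu>) \<partial>\<nu>)"
    by (simp add: S_def form_def Lop_def)
  also have "(\<lambda>x. \<integral>y. L x y \<partial>\<nu>) = Lop f"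
  proof
    fix x
    have "L x \<in> borel_measurable \<rho>"
      using bounded_borel_slice[of x] by (simp add: bounded_borel_def cong: measurable_cong_sets)
    then show "(\<integral>y. L x y \<partial>\<nu>) = Lop f x"
      unfolding \<nu>_def Lop_def by (subst integral_density) (use f(2) in auto)
  qed
  also have "(\<integral>x. Lop f x \<partial>\<nu>) = form f f"
  proof -
    have "Lop f \<in> borel_measurable \<rho>"
      using bounded_borel_Lop[OF f(1)] by (simp add: bounded_borel_def cong: measurable_cong_sets)
    then show ?thesis
      unfolding \<nu>_def form_def by (subst integral_density) (use f(2) in auto)
  qed
  finally show ?thesis .
qed

lemma variation_mean_zero:
  assumes \<psi>: "bounded_borel \<psi>" "(\<integral>x. \<psi> x \<partial>\<rho>) = 0"
  shows "form \<psi> (\<lambda>_. 1) = 0" "0 \<le> form \<psi> \<psi>"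
proof -
  obtain K where K: "\<psi> \<in> borel_measurable borel" "\<And>x. \<bar>\<psi> x\<bar> \<le> K" "0 \<le> K"
    using \<psi>(1) by (rule bounded_borelE) blast
  have b: "bounded_borel (\<lambda>x. t * \<psi> x)" for t
    using \<psi>(1) by (intro bounded_borel_mult) auto
  \<comment> \<open>For such \<open>t\<close> the function \<open>1 + t * \<psi>\<close> is
    nonnegative with integral one, so it is the density of a competitor for either sign of
    \<open>t\<close>.\<close>
  have "0 \<le> 2 * t * form \<psi> (\<lambda>_. 1) + t\<^sup>2 * form \<psi> \<psi>" if t: "\<bar>t\<bar> \<le> 1 / (K + 1)" for t
  proof -
    have "\<bar>t * \<psi> x\<bar> \<le> 1 / (K + 1) * (K + 1)" for x
      unfolding abs_mult using t K(2)[of x] K(3) by (intro mult_mono) auto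
    then have "0 \<le> 1 + t * \<psi> x" for x
      using K(3) by (auto simp: abs_le_iff) (smt (verit))
    then have "S \<le> form (\<lambda>x. 1 + t * \<psi> x) (\<lambda>x. 1 + t * \<psi> x)"
      using \<psi> b[of t] by (intro S_le_form) (auto simp: bounded_borel_add prob_space[unfolded space_UNIV])
    also have "\<dots> = S + 2 * t * form \<psi> (\<lambda>_. 1) + t\<^sup>2 * form \<psi> \<psi>"
      using \<psi>(1) b[of t] form_sym[OF \<psi>(1), of "\<lambda>_. 1"]
      by (simp add: form_add_left form_add_right bounded_borel_add S_def form_cmult_left form_cmult_right power2_eq_square algebra_simps)
    finally show ?thesis
      by simp
  qed
  moreover have "0 < 1 / (K + 1)"
    using K(3) by simp
  ultimately show "form \<psi> (\<lambda>_. 1) = 0" "0 \<le> form \<psi> \<psi>"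
    using quadratic_nonneg_near_0[of "1 / (K + 1)"] by blast+
qed

text \<open>Subtracting the mean \<open>m\<close> reduces to test functions of mean zero. The mixed
  terms vanish by the first variation, and the constant part contributes S m^2 to the quadratic
  form, which is nonnegative.\<close>

lemma first_and_second_variation:
  assumes \<phi>: "bounded_borel \<phi>"
  shows "form \<phi> (\<lambda>_. 1) = S * (\<integral>x. \<phi> x \<partial>\<rho>)" "0 \<le> form \<phi> \<phi>"
proof -
  define m where "m = (\<integral>x. \<phi> x \<partial>\<rho>)"
  define \<psi> where "\<psi> = (\<lambda>x. \<phi> x + (- m) * 1)"
  have \<psi>: "bounded_borel \<psi>"
    unfolding \<psi>_def using \<phi> by (intro bounded_borel_add) auto
  have "(\<integral>x. \<psi> x \<partial>\<rho>) = 0"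
    using \<phi> by (simp add: \<psi>_def m_def prob_space[unfolded space_UNIV])
  note v = variation_mean_zero[OF \<psi> this]
  have 1: "form \<psi> h = form \<phi> h - m * form (\<lambda>_. 1) h" if "bounded_borel h" for h
    unfolding \<psi>_def using \<phi> that form_cmult_left[of "- m" "\<lambda>_. 1" h] by (subst form_add_left) auto
  show *: "form \<phi> (\<lambda>_. 1) = S * m"
    using v(1) 1[of "\<lambda>_. 1"] by (simp add: S_def mult.commute)
  have "form \<psi> \<psi> = form \<phi> \<phi> - m * (S * m)"
    using 1[OF \<psi>] 1[OF \<phi>] 1[of "\<lambda>_. 1"] form_sym[OF \<phi> \<psi>] form_sym[OF \<psi>, of "\<lambda>_. 1"] form_sym[OF \<phi>, of "\<lambda>_. 1"] *
    by (simp add: v(1))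
  moreover have "0 \<le> m * (S * m)"
    using S_nonneg by (simp add: mult.left_commute[of m])
  ultimately show "0 \<le> form \<phi> \<phi>"
    using v(2) by simp
qed

definition ell :: "'a \<Rightarrow> real" where "ell x = (\<integral>y. L x y \<partial>\<rho>)"

lemma continuous_ell: "continuous_on UNIV ell"
  using continuous_Lop[of "\<lambda>_. 1"] by (simp add: Lop_def[abs_def] ell_def[abs_def])

text \<open>The first variation is tested with the indicator of the open set where
  \<open>ell\<close> lies strictly on one side of \<open>S\<close>. This set must be null, hence it
  contains no point of the support; the sign \<open>s\<close> treats both sides at once.\<close>

lemma ell_eq_S:
  assumes x: "x \<in> supp \<rho>"
  shows "ell x = S"
proof -
  have no: "\<not> 0 < s * (ell x - S)" if s: "s = 1 \<or> s = - 1" for s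
  proof
    assume pos: "0 < s * (ell x - S)"
    define W where "W = {x. 0 < s * (ell x - S)}"
    have W: "open W"
      unfolding W_def by (intro open_Collect_less continuous_intros continuous_ell)
    then have "emeasure \<rho> W \<noteq> 0"
      using x pos unfolding supp_def W_def by blast
    have bell: "bounded_borel ell"
      by (rule bounded_borel_continuous[OF compact_UNIV continuous_ell])
    have bW: "bounded_borel (indicator W :: 'a \<Rightarrow> real)"
      using W by (intro bounded_borel_indicator) auto
    have b: "bounded_borel (\<lambda>x. indicator W x * (s * (ell x - S)))"
      using bW bell by (intro bounded_borel_mult bounded_borel_diff bounded_borel_const) auto
    have "(\<integral>x. indicator W x * ell x \<partial>\<rho>) = S * (\<integral>x. indicator W x \<partial>\<rho>)"
      using first_and_second_variation(1)[OF bW] by (simp add: form_def Lop_def ell_def)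
    then have "(\<integral>x. indicator W x * (s * (ell x - S)) \<partial>\<rho>) = 0"
      using bounded_borel_mult[OF bW bell] bW
      by (simp add: right_diff_distrib mult.left_commute[of _ s] mult.commute[of _ S])
    then have "AE x in \<rho>. indicator W x * (s * (ell x - S)) = 0"
      by (subst (asm) integral_nonneg_eq_0_iff_AE) (use b in \<open>auto simp: W_def indicator_def\<close>)
    then have "AE x in \<rho>. x \<notin> W"
      by eventually_elim (auto simp: W_def indicator_def)
    then have "emeasure \<rho> W = 0"
      using W by (subst (asm) AE_iff_measurable[where N=W]) auto
    then show False
      using \<open>emeasure \<rho> W \<noteq> 0\<close> by blast
  qed
  show ?thesis
    using no[of 1] no[of "- 1"] by simp
qed

text \<open>Divided by the two measures, indicators of small open sets act on the kernel like point
  masses.\<close>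

lemma form_indicator_approx:
  assumes A: "open A" and B: "open B"
    and close: "\<And>x y. x \<in> A \<Longrightarrow> y \<in> B \<Longrightarrow> \<bar>L x y - l\<bar> \<le> e"
  shows "\<bar>form (indicator A) (indicator B) - measure \<rho> A * measure \<rho> B * l\<bar> \<le> e * (measure \<rho> A * measure \<rho> B)"
proof -
  have bA: "bounded_borel (indicator A :: 'a \<Rightarrow> real)" and bB: "bounded_borel (indicator B :: 'a \<Rightarrow> real)"
    using A B by (auto intro!: bounded_borel_indicator)
  have int: "(\<integral>x. indicator C x * r \<partial>\<rho>) = measure \<rho> C * r" for C and r :: real
    by (simp add: mult.commute)
  have Lop: "\<bar>Lop (indicator B) x - measure \<rho> B * l\<bar> \<le> measure \<rho> B * e" if x: "x \<in> A" for x
  proof -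
    have i: "integrable \<rho> (\<lambda>y. indicator B y * L x y)" "integrable \<rho> (\<lambda>y. indicator B y * r)" for r :: real
      using bB bounded_borel_slice[of x] by (auto intro!: integrable_bounded_borel bounded_borel_mult)
    have "Lop (indicator B) x - measure \<rho> B * l = (\<integral>y. indicator B y * L x y - indicator B y * l \<partial>\<rho>)"
      by (subst Bochner_Integration.integral_diff[OF i]) (simp only: Lop_def int)
    also have "\<bar>\<dots>\<bar> \<le> (\<integral>y. indicator B y * e \<partial>\<rho>)"
      unfolding real_norm_def[symmetric]
      by (rule order_trans[OF integral_norm_bound integral_mono])
        (use i close[OF x] in \<open>auto simp: indicator_def intro!: integrable_norm Bochner_Integration.integrable_diff\<close>)
    also have "\<dots> = measure \<rho> B * e"
      by (rule int)
    finally show ?thesis .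
  qed
  have i: "integrable \<rho> (\<lambda>x. indicator A x * Lop (indicator B) x)" "integrable \<rho> (\<lambda>x. indicator A x * r)" for r :: real
    using bA bounded_borel_Lop[OF bB] by (auto intro!: integrable_bounded_borel bounded_borel_mult)
  have "form (indicator A) (indicator B) - measure \<rho> A * (measure \<rho> B * l) =
      (\<integral>x. indicator A x * Lop (indicator B) x - indicator A x * (measure \<rho> B * l) \<partial>\<rho>)"
    by (subst Bochner_Integration.integral_diff[OF i]) (simp only: form_def int)
  also have "\<bar>\<dots>\<bar> \<le> (\<integral>x. indicator A x * (measure \<rho> B * e) \<partial>\<rho>)"
    unfolding real_norm_def[symmetric]
    by (rule order_trans[OF integral_norm_bound integral_mono])
      (use i Lop in \<open>auto simp: indicator_def intro!: integrable_norm Bochner_Integration.integrable_diff\<close>)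
  also have "\<dots> = measure \<rho> A * (measure \<rho> B * e)"
    by (rule int)
  finally show ?thesis
    by (simp add: mult_ac)
qed

text \<open>Point masses need not be variations with a density, so each is replaced by a normalized
  indicator of a small neighborhood. That neighborhood has positive measure because its point lies
  in the support.\<close>

theorem positive_semidefinite:
  fixes a :: "'i \<Rightarrow> real" and x :: "'i \<Rightarrow> 'a"
  assumes I: "finite I" and x: "\<And>i. i \<in> I \<Longrightarrow> x i \<in> supp \<rho>"
  shows "0 \<le> (\<Sum>i\<in>I. \<Sum>j\<in>I. a i * a j * L (x i) (x j))"
proof (rule field_le_epsilon)
  fix d :: real assume d: "d > 0"
  define A where "A = (\<Sum>i\<in>I. \<Sum>j\<in>I. \<bar>a i\<bar> * \<bar>a j\<bar>)"
  have A: "0 \<le> A"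
    unfolding A_def by (intro sum_nonneg) auto
  define e where "e = d / (A + 1)"
  have e: "e > 0"
    using d A by (simp add: e_def)
  have "\<exists>U V. open U \<and> open V \<and> x i \<in> U \<and> x j \<in> V \<and> (\<forall>u\<in>U. \<forall>v\<in>V. \<bar>L u v - L (x i) (x j)\<bar> \<le> e)" for i j
  proof -
    have "open {p. \<bar>(\<lambda>(x, y). L x y) p - L (x i) (x j)\<bar> < e}"
      by (intro open_Collect_less continuous_intros cont_L)
    then obtain U V where "open U" "open V" "(x i, x j) \<in> U \<times> V"
        "U \<times> V \<subseteq> {p. \<bar>(\<lambda>(x, y). L x y) p - L (x i) (x j)\<bar> < e}"
      by (rule open_prod_elim[where x="(x i, x j)"]) (use e in auto)
    then show ?thesis
      by (intro exI[of _ U] exI[of _ V]) (auto simp: subset_iff less_imp_le)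
  qed
  then obtain U V where UV: "\<And>i j. open (U i j)" "\<And>i j. open (V i j)" "\<And>i j. x i \<in> U i j" "\<And>i j. x j \<in> V i j"
      "\<And>i j u v. u \<in> U i j \<Longrightarrow> v \<in> V i j \<Longrightarrow> \<bar>L u v - L (x i) (x j)\<bar> \<le> e"
    by metis
  \<comment> \<open>The point \<open>x i\<close> occurs as first argument paired with every
    \<open>j\<close> and as second argument paired with every \<open>j\<close>; one neighborhood
    must serve all these pairs.\<close>
  define W where "W i = (\<Inter>j\<in>I. U i j \<inter> V j i)" for i
  have W: "open (W i)" for i
    unfolding W_def by (intro open_INT I ballI open_Int UV)
  have m: "measure \<rho> (W i) > 0" if "i \<in> I" for i
  proof -
    have "x i \<in> W i"
      using UV(3,4) by (auto simp: W_def)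
    then have "emeasure \<rho> (W i) \<noteq> 0"
      using x[OF that] W[of i] by (auto simp: supp_def)
    then show ?thesis
      using emeasure_eq_measure[of "W i"] by (auto simp: less_le)
  qed
  define b where "b i = a i / measure \<rho> (W i)" for i
  define \<phi> where "\<phi> i y = b i * indicator (W i) y" for i y
  have "bounded_borel (\<phi> i)" for i
    unfolding \<phi>_def using W[of i] by (intro bounded_borel_mult bounded_borel_indicator) auto
  then have "0 \<le> (\<Sum>i\<in>I. \<Sum>j\<in>I. form (\<phi> i) (\<phi> j))"
    using first_and_second_variation(2)[OF bounded_borel_sum[OF I]] form_sum_sum[OF I] by metis
  also have "\<dots> \<le> (\<Sum>i\<in>I. \<Sum>j\<in>I. a i * a j * L (x i) (x j) + e * (\<bar>a i\<bar> * \<bar>a j\<bar>))"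
  proof (intro sum_mono)
    fix i j assume ij: "i \<in> I" "j \<in> I"
    let ?m = "measure \<rho> (W i) * measure \<rho> (W j)"
    have m0: "?m > 0"
      using m ij by simp
    have "form (\<phi> i) (\<phi> j) = b i * (b j * form (indicator (W i)) (indicator (W j)))"
      by (simp add: \<phi>_def[abs_def] form_cmult_left form_cmult_right)
    then have "form (\<phi> i) (\<phi> j) - a i * a j * L (x i) (x j) =
        (a i * a j / ?m) * (form (indicator (W i)) (indicator (W j)) - ?m * L (x i) (x j))"
      using m[OF ij(1)] m[OF ij(2)]
      by (simp add: b_def field_simps)
    also have "\<dots> \<le> \<bar>a i * a j / ?m\<bar> * (e * ?m)"
    proof -
      have "\<bar>form (indicator (W i)) (indicator (W j)) - ?m * L (x i) (x j)\<bar> \<le> e * ?m"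
        by (rule form_indicator_approx[OF W W], rule UV(5)[of _ i j]) (use ij in \<open>auto simp: W_def\<close>)
      then have "\<bar>a i * a j / ?m\<bar> * \<bar>form (indicator (W i)) (indicator (W j)) - ?m * L (x i) (x j)\<bar> \<le> \<bar>a i * a j / ?m\<bar> * (e * ?m)"
        by (rule mult_left_mono) simp
      then show ?thesis
        unfolding abs_mult[symmetric] by (rule order_trans[OF abs_ge_self])
    qed
    also have "\<dots> = e * (\<bar>a i\<bar> * \<bar>a j\<bar>)"
      using m0 m[OF ij(1)] m[OF ij(2)] by (simp add: abs_mult)
    finally show "form (\<phi> i) (\<phi> j) \<le> a i * a j * L (x i) (x j) + e * (\<bar>a i\<bar> * \<bar>a j\<bar>)"
      by simp
  qed
  also have "\<dots> = (\<Sum>i\<in>I. \<Sum>j\<in>I. a i * a j * L (x i) (x j)) + e * A"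
    by (simp add: sum.distrib sum_distrib_left A_def)
  also have "e * A \<le> d"
    using A d by (simp add: e_def field_simps)
  finally show "0 \<le> (\<Sum>i\<in>I. \<Sum>j\<in>I. a i * a j * L (x i) (x j)) + d"
    by simp
qed

end


section \<open>Finite differences along translation symmetric curves\<close>

text \<open>An \<open>n\<close>-th finite difference annihilates polynomials of degree below
  \<open>n\<close>. The absorption identity for k times a binomial coefficient lowers both
  \<open>n\<close> and the exponent by one.\<close>

lemma alternating_binomial_power_sum:
  "i < n \<Longrightarrow> (\<Sum>k\<le>n. (- 1) ^ k * real (n choose k) * real k ^ i) = 0"
proof (induction n arbitrary: i)
  case (Suc n)
  show ?case
  proof (cases i)
    case 0
    then show ?thesis
      using choose_alternating_sum[of "Suc n", where ?'a=real] by simp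
  next
    case (Suc j)
    have "(\<Sum>k\<le>Suc n. (- 1) ^ k * real (Suc n choose k) * real k ^ i) =
        (\<Sum>k\<le>n. (- 1) ^ Suc k * real (Suc n choose Suc k) * real (Suc k) ^ i)"
      by (subst sum.atMost_Suc_shift) (simp add: Suc)
    also have "\<dots> = (\<Sum>k\<le>n. (- 1) ^ Suc k * (real (Suc k * (Suc n choose Suc k)) * (1 + real k) ^ j))"
      by (intro sum.cong refl) (simp add: Suc algebra_simps del: binomial_Suc_Suc)
    also have "\<dots> = (\<Sum>k\<le>n. (- 1) ^ Suc k * (real (Suc n * (n choose k)) * (\<Sum>m\<le>j. real (j choose m) * real k ^ m)))"
      using binomial_ring[of "real k" 1 j for k]
      by (intro sum.cong refl) (simp only: Suc_times_binomial_eq binomial_ring add.commute[of 1], simp add: mult_ac)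
    also have "\<dots> = - real (Suc n) * (\<Sum>k\<le>n. \<Sum>m\<le>j. real (j choose m) * ((- 1) ^ k * real (n choose k) * real k ^ m))"
      by (simp only: sum_distrib_left) (intro sum.cong refl, simp add: algebra_simps)
    also have "(\<Sum>k\<le>n. \<Sum>m\<le>j. real (j choose m) * ((- 1) ^ k * real (n choose k) * real k ^ m)) =
        (\<Sum>m\<le>j. real (j choose m) * (\<Sum>k\<le>n. (- 1) ^ k * real (n choose k) * real k ^ m))"
      by (subst sum.swap) (simp add: sum_distrib_left)
    also have "\<dots> = 0"
      using Suc.prems Suc by (intro sum.neutral ballI) (simp add: Suc.IH)
    finally show ?thesis
      by simp
  qed
qed simp

text \<open>In the binomial expansion of (l - k)^m one of the two exponents is below
  \<open>n\<close> as soon as m < 2n. This doubling of the order is what the curve argument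
  exploits.\<close>

lemma double_difference_power:
  fixes w :: "nat \<Rightarrow> real"
  assumes w: "\<And>i. i < n \<Longrightarrow> (\<Sum>k\<le>n. w k * real k ^ i) = 0" and m: "m < 2 * n"
  shows "(\<Sum>k\<le>n. \<Sum>l\<le>n. w k * w l * (real l - real k) ^ m) = 0"
proof -
  have prod: "c * (sum u A * sum v B) = (\<Sum>k\<in>B. \<Sum>l\<in>A. c * (u l * v k))"
    for c :: real and u v :: "nat \<Rightarrow> real" and A B
    unfolding sum_product[of u A v B] by (subst sum.swap) (simp only: sum_distrib_left)
  have "(\<Sum>k\<le>n. \<Sum>l\<le>n. w k * w l * (real l - real k) ^ m) =
      (\<Sum>k\<le>n. \<Sum>l\<le>n. \<Sum>i\<le>m. (real (m choose i) * (- 1) ^ (m - i)) * ((w l * real l ^ i) * (w k * real k ^ (m - i))))"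
    by (intro sum.cong refl)
      (simp add: binomial_ring[of "real _" "- real _", simplified] sum_distrib_left power_minus[of "real _"] mult_ac)
  also have "\<dots> = (\<Sum>i\<le>m. \<Sum>k\<le>n. \<Sum>l\<le>n. (real (m choose i) * (- 1) ^ (m - i)) * ((w l * real l ^ i) * (w k * real k ^ (m - i))))"
    by (subst sum.swap[where A="{..m}" and B="{..n}"], rule sum.cong[OF refl], rule sum.swap)
  also have "\<dots> = (\<Sum>i\<le>m. (real (m choose i) * (- 1) ^ (m - i)) * ((\<Sum>l\<le>n. w l * real l ^ i) * (\<Sum>k\<le>n. w k * real k ^ (m - i))))"
    by (simp only: prod)
  also have "\<dots> = 0"
  proof (rule sum.neutral, rule ballI)
    fix i assume "i \<in> {..m}"
    then have "i < n \<or> m - i < n"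
      using m by auto
    then show "(real (m choose i) * (- 1) ^ (m - i)) * ((\<Sum>l\<le>n. w l * real l ^ i) * (\<Sum>k\<le>n. w k * real k ^ (m - i))) = 0"
      using w by auto
  qed
  finally show ?thesis .
qed

section \<open>Taylor expansion and leading terms in one real variable\<close>

lemma smooth_on_deriv:
  fixes f :: "real \<Rightarrow> real"
  assumes "open S" "smooth_on S f"
  shows "smooth_on S (deriv f)"
    and "x \<in> S \<Longrightarrow> (f has_real_derivative deriv f x) (at x)"
proof -
  have d: "f differentiable (at x)" if "x \<in> S" for x
    using assms(2) that unfolding smooth_on_def by (metis Ck_on.simps(2))
  then show *: "(f has_real_derivative deriv f x) (at x)" if "x \<in> S" for x
    using that by (simp add: DERIV_deriv_iff_real_differentiable)
  have eq: "deriv f x = frechet_derivative f (at x) 1" if "x \<in> S" for x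
    using frechet_derivative_eqI[OF *[OF that, unfolded has_field_derivative_def]] by simp
  show "smooth_on S (deriv f)"
    unfolding smooth_on_def
  proof
    fix k
    have "Ck_on (Suc k) S f"
      using assms(2) unfolding smooth_on_def by blast
    then have "Ck_on k S (\<lambda>x. frechet_derivative f (at x) 1)"
      by simp
    then show "Ck_on k S (deriv f)"
      by (rule Ck_on_cong[OF assms(1) eq, THEN iffD2, rotated])
  qed
qed

lemma smooth_on_funpow_deriv:
  fixes f :: "real \<Rightarrow> real"
  assumes "open S" "smooth_on S f"
  shows "smooth_on S ((deriv ^^ m) f)"
  by (induction m) (use assms smooth_on_deriv(1) in auto)

lemma smooth_on_taylor:
  fixes f :: "real \<Rightarrow> real"
  assumes S: "open S" "0 \<in> S" and f: "smooth_on S f"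
  obtains d C where "d > 0" "{-d..d} \<subseteq> S" "0 \<le> C"
    "\<And>x. \<bar>x\<bar> \<le> d \<Longrightarrow> \<bar>f x - (\<Sum>m<n. (deriv ^^ m) f 0 / fact m * x ^ m)\<bar> \<le> C * \<bar>x\<bar> ^ n"
proof -
  obtain d where d: "d > 0" "cball 0 d \<subseteq> S"
    using S open_contains_cball by blast
  then have d': "{-d..d} \<subseteq> S"
    by (simp add: cball_eq_atLeastAtMost)
  have "continuous_on S ((deriv ^^ n) f)"
    using smooth_on_funpow_deriv[OF S(1) f] Ck_on_imp_continuous_on unfolding smooth_on_def by blast
  then have "bounded ((deriv ^^ n) f ` {-d..d})"
    using d' by (intro compact_imp_bounded compact_continuous_image compact_Icc) (rule continuous_on_subset)
  then obtain C where "\<forall>t\<in>{-d..d}. \<bar>(deriv ^^ n) f t\<bar> \<le> C"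
    unfolding bounded_iff by auto
  then have C: "\<bar>(deriv ^^ n) f t\<bar> \<le> C" if "\<bar>t\<bar> \<le> d" for t
    using that by (simp add: abs_le_iff)
  have C0: "0 \<le> C"
    using C[of 0] d(1) by simp
  have "\<bar>f x - (\<Sum>m<n. (deriv ^^ m) f 0 / fact m * x ^ m)\<bar> \<le> C * \<bar>x\<bar> ^ n" if x: "\<bar>x\<bar> \<le> d" for x
  proof -
    have "DERIV ((deriv ^^ m) f) t :> (deriv ^^ Suc m) f t" if "\<bar>t\<bar> \<le> \<bar>x\<bar>" for m t
    proof -
      have "\<bar>t\<bar> \<le> d"
        using that x by linarith
      then have "t \<in> S"
        using d' by (auto simp: abs_le_iff)
      then show ?thesis
        using smooth_on_deriv(2)[OF S(1) smooth_on_funpow_deriv[OF S(1) f]] by simp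
    qed
    then obtain t where t: "\<bar>t\<bar> \<le> \<bar>x\<bar>"
      "f x = (\<Sum>m<n. (deriv ^^ m) f 0 / fact m * x ^ m) + (deriv ^^ n) f t / fact n * x ^ n"
      using Maclaurin_bi_le[of "\<lambda>m. (deriv ^^ m) f" f n x] by auto
    have "\<bar>(deriv ^^ n) f t / fact n\<bar> \<le> C"
    proof -
      have "\<bar>(deriv ^^ n) f t / fact n\<bar> = \<bar>(deriv ^^ n) f t\<bar> / fact n"
        by simp
      also have "\<dots> \<le> \<bar>(deriv ^^ n) f t\<bar> / 1"
        by (intro divide_left_mono) auto
      also have "\<dots> \<le> C"
        using C[of t] t(1) x by simp
      finally show ?thesis .
    qed
    then have "\<bar>(deriv ^^ n) f t / fact n\<bar> * \<bar>x\<bar> ^ n \<le> C * \<bar>x\<bar> ^ n"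
      by (rule mult_right_mono) simp
    moreover have "f x - (\<Sum>m<n. (deriv ^^ m) f 0 / fact m * x ^ m) = (deriv ^^ n) f t / fact n * x ^ n"
      using t(2) by simp
    ultimately show ?thesis
      by (simp only: abs_mult power_abs)
  qed
  then show ?thesis
    using that d(1) d' C0 by blast
qed

text \<open>The exponent is the least order of a nonvanishing derivative, which may be smaller than
  \<open>p\<close>; the lower Taylor coefficients vanish.\<close>

lemma smooth_on_leading_term:
  fixes g :: "real \<Rightarrow> real"
  assumes S: "open S" "0 \<in> S" and g: "smooth_on S g" and p: "(deriv ^^ p) g 0 \<noteq> 0"
  obtains n a where "a \<noteq> 0" "((\<lambda>t. g t / t ^ n) \<longlongrightarrow> a) (at 0)"
proof -
  define n where "n = (LEAST n. (deriv ^^ n) g 0 \<noteq> 0)"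
  have n: "(deriv ^^ n) g 0 \<noteq> 0" "\<And>m. m < n \<Longrightarrow> (deriv ^^ m) g 0 = 0"
    unfolding n_def using p by (rule LeastI) (use not_less_Least in blast)
  define a where "a = (deriv ^^ n) g 0 / fact n"
  obtain d C where d: "d > 0" "0 \<le> C"
    and T: "\<And>x. \<bar>x\<bar> \<le> d \<Longrightarrow> \<bar>g x - (\<Sum>m<Suc n. (deriv ^^ m) g 0 / fact m * x ^ m)\<bar> \<le> C * \<bar>x\<bar> ^ Suc n"
    by (rule smooth_on_taylor[OF S g, of "Suc n"]) blast
  have T': "\<bar>g x / x ^ n - a\<bar> \<le> C * \<bar>x\<bar>" if x: "\<bar>x\<bar> \<le> d" "x \<noteq> 0" for x
  proof -
    have "\<bar>g x - a * x ^ n\<bar> \<le> C * \<bar>x\<bar> ^ Suc n"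
      using T[OF x(1)] n(2) by (simp add: a_def)
    then have "\<bar>g x - a * x ^ n\<bar> / \<bar>x\<bar> ^ n \<le> C * \<bar>x\<bar> ^ Suc n / \<bar>x\<bar> ^ n"
      by (rule divide_right_mono) simp
    also have "\<bar>g x - a * x ^ n\<bar> / \<bar>x\<bar> ^ n = \<bar>(g x - a * x ^ n) / x ^ n\<bar>"
      by (simp add: power_abs)
    also have "(g x - a * x ^ n) / x ^ n = g x / x ^ n - a"
      using x(2) by (simp add: diff_divide_distrib)
    finally show ?thesis
      using x(2) by simp
  qed
  have "((\<lambda>t. g t / t ^ n - a) \<longlongrightarrow> 0) (at 0)"
  proof (rule Lim_null_comparison)
    show "\<forall>\<^sub>F t in at 0. norm (g t / t ^ n - a) \<le> C * \<bar>t\<bar>"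
      unfolding eventually_at using T' d(1) by (intro exI[of _ d]) (auto simp: dist_real_def)
    show "((\<lambda>t. C * \<bar>t\<bar>) \<longlongrightarrow> 0) (at 0)"
      by (auto intro!: tendsto_eq_intros)
  qed
  then have "((\<lambda>t. g t / t ^ n) \<longlongrightarrow> a) (at 0)"
    by (rule Lim_null[THEN iffD2])
  moreover have "a \<noteq> 0"
    using n(1) by (simp add: a_def)
  ultimately show ?thesis
    using that by blast
qed

lemma changes_sign_leading_term:
  fixes g :: "real \<Rightarrow> real"
  assumes g: "((\<lambda>t. g t / t ^ p) \<longlongrightarrow> a) (at 0)" "a \<noteq> 0" and cont: "isCont g 0"
    and sign: "changes_sign_at_0 g"
  obtains s d where "s = 1 \<or> s = - 1" "d > 0"
    "\<And>t. 0 < t \<Longrightarrow> t < d \<Longrightarrow> \<bar>a\<bar> / 2 * t ^ p \<le> g (s * t)"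
    "\<And>t. - d < t \<Longrightarrow> t \<le> 0 \<Longrightarrow> g (s * t) \<le> 0"
proof -
  have "\<bar>a\<bar> / 2 > 0"
    using g(2) by simp
  from tendstoD[OF g(1) this]
  obtain d where d: "d > 0" "\<And>t. t \<noteq> 0 \<Longrightarrow> \<bar>t\<bar> < d \<Longrightarrow> \<bar>g t / t ^ p - a\<bar> < \<bar>a\<bar> / 2"
    unfolding eventually_at by (auto simp: dist_real_def)
  have aux: "\<bar>q - a\<bar> < \<bar>a\<bar> / 2 \<Longrightarrow> \<bar>a\<bar> / 2 \<le> sgn a * q" for q
    by (auto simp: sgn_if abs_if split: if_splits)
  have quot: "\<bar>a\<bar> / 2 \<le> sgn a * (g t / t ^ p)" if "t \<noteq> 0" "\<bar>t\<bar> < d" for t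
    using d(2)[OF that] by (rule aux)
  have lim: "(g \<longlongrightarrow> g 0) (at 0)"
    using cont by (simp add: isCont_def)
  \<comment> \<open>For even \<open>p\<close> the function \<open>sgn a * g\<close> is positive off
    0 and, by continuity, nonnegative at 0, so one of the two signs would be missing.\<close>
  have "odd p"
  proof
    assume "even p"
    then have pos: "0 < sgn a * g t" if "t \<noteq> 0" "\<bar>t\<bar> < d" for t
    proof -
      have "0 < \<bar>a\<bar> / 2 * t ^ p"
        using \<open>even p\<close> g(2) that by (auto simp: zero_less_power_eq)
      also have "\<dots> \<le> sgn a * (g t / t ^ p) * t ^ p"
        using quot[OF that] \<open>even p\<close> by (intro mult_right_mono) auto
      finally show ?thesis
        using that by simp
    qed
    have "0 \<le> sgn a * g 0"
    proof (rule tendsto_lowerbound)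
      show "((\<lambda>t. sgn a * g t) \<longlongrightarrow> sgn a * g 0) (at 0)"
        by (intro tendsto_intros lim)
      show "\<forall>\<^sub>F t in at 0. 0 \<le> sgn a * g t"
        unfolding eventually_at using pos d(1) by (intro exI[of _ d]) (auto simp: dist_real_def less_imp_le)
    qed simp
    then have "0 \<le> sgn a * g t" if "\<bar>t\<bar> < d" for t
      using pos[of t] that by (cases "t = 0") auto
    moreover obtain t t' where "\<bar>t\<bar> < d" "g t > 0" "\<bar>t'\<bar> < d" "g t' < 0"
      using sign d(1) unfolding changes_sign_at_0_def by blast
    ultimately show False
      using g(2) by (metis linorder_not_less mult_less_0_iff sgn_greater sgn_less linorder_neqE_linordered_idom)
  qed
  \<comment> \<open>Reversing the parameter when \<open>a\<close> is negative puts the positive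
    values at t > 0: as \<open>p\<close> is odd, a (s t)^p = |a| t^p.\<close>
  define s where "s = sgn a"
  have s: "s = 1 \<or> s = - 1" "s * s = 1" "s ^ p = s"
    using g(2) \<open>odd p\<close> by (auto simp: s_def sgn_if)
  have pos: "\<bar>a\<bar> / 2 * t ^ p \<le> g (s * t)" if "0 < t" "t < d" for t
  proof -
    have st: "s * t \<noteq> 0" "\<bar>s * t\<bar> < d"
      using s(1) that by auto
    have "\<bar>a\<bar> / 2 * t ^ p \<le> s * (g (s * t) / (s * t) ^ p) * t ^ p"
      using quot[OF st] that by (intro mult_right_mono) (auto simp: s_def)
    also have "\<dots> = g (s * t)"
      using s that by (auto simp: power_mult_distrib)
    finally show ?thesis .
  qed
  have neg: "g (s * t) < 0" if "- d < t" "t < 0" for t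
  proof -
    have st: "s * t \<noteq> 0" "\<bar>s * t\<bar> < d"
      using s(1) that by auto
    have "0 < \<bar>a\<bar> / 2"
      using g(2) by simp
    also have "\<dots> \<le> s * (g (s * t) / (s * t) ^ p)"
      using quot[OF st] by (auto simp: s_def)
    also have "\<dots> = g (s * t) / t ^ p"
      using s that by (auto simp: power_mult_distrib)
    finally have "0 < g (s * t) / t ^ p" .
    moreover have "t ^ p < 0"
      using that \<open>odd p\<close> by (simp add: power_less_zero_eq)
    ultimately show ?thesis
      by (simp add: zero_less_divide_iff)
  qed
  have "g 0 \<le> 0"
  proof (rule tendsto_upperbound)
    have "((\<lambda>t. g (s * t)) \<longlongrightarrow> g (s * 0)) (at_left 0)"
      by (rule isCont_tendsto_compose[where g=g]) (use cont in \<open>auto intro!: tendsto_eq_intros\<close>)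
    then show "((\<lambda>t. g (s * t)) \<longlongrightarrow> g 0) (at_left 0)"
      by simp
    show "\<forall>\<^sub>F t in at_left 0. g (s * t) \<le> 0"
      unfolding eventually_at using neg d(1) by (intro exI[of _ d]) (auto simp: dist_real_def less_imp_le)
  qed simp
  then have "g (s * t) \<le> 0" if "- d < t" "t \<le> 0" for t
    using neg[of t] that by (cases "t = 0") auto
  then show ?thesis
    using that s(1) d(1) pos by blast
qed

section \<open>Finite differences of the kernel of a minimizer\<close>

context minimizing_kernel
begin

text \<open>Positive semidefiniteness is applied to the family enlarged by the point
  \<open>y\<close> (the index \<open>None\<close>), with the coefficient \<open>l\<close> that
  minimizes the resulting quadratic polynomial. The points \<open>x i\<close> may repeat or coincide
  with \<open>y\<close>.\<close>

lemma cauchy_schwarz: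
  fixes a :: "'i \<Rightarrow> real" and x :: "'i \<Rightarrow> 'a"
  assumes I: "finite I" and x: "\<And>i. i \<in> I \<Longrightarrow> x i \<in> supp \<rho>" and y: "y \<in> supp \<rho>" and pos: "L y y > 0"
  shows "(\<Sum>i\<in>I. a i * L (x i) y)\<^sup>2 \<le> L y y * (\<Sum>i\<in>I. \<Sum>j\<in>I. a i * a j * L (x i) (x j))"
proof -
  define B where "B = (\<Sum>i\<in>I. a i * L (x i) y)"
  define Q where "Q = (\<Sum>i\<in>I. \<Sum>j\<in>I. a i * a j * L (x i) (x j))"
  define l where "l = - B / L y y"
  define a' where "a' i = (case i of None \<Rightarrow> l | Some i \<Rightarrow> a i)" for i
  define x' where "x' i = (case i of None \<Rightarrow> y | Some i \<Rightarrow> x i)" for i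
  have "0 \<le> (\<Sum>i\<in>insert None (Some ` I). \<Sum>j\<in>insert None (Some ` I). a' i * a' j * L (x' i) (x' j))"
    using I x y by (intro positive_semidefinite) (auto simp: x'_def)
  also have "\<dots> = l * l * L y y + (\<Sum>i\<in>I. l * (a i * L (x i) y)) + ((\<Sum>i\<in>I. l * (a i * L (x i) y)) + Q)"
    using I by (simp add: sum.reindex a'_def x'_def sum.distrib Q_def L_sym[of y "x _"] mult_ac)
  also have "\<dots> = l * l * L y y + 2 * l * B + Q"
    by (simp add: B_def sum_distrib_left mult_ac)
  also have "\<dots> = Q - B\<^sup>2 / L y y"
    using pos by (simp add: l_def power2_eq_square field_simps)
  finally have "B\<^sup>2 \<le> L y y * Q"
    using pos by (simp add: field_simps)
  then show ?thesis
    unfolding B_def Q_def .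
qed

text \<open>By the Cauchy-Schwarz inequality, the function \<open>t \<mapsto> L (q t) y\<close> inherits the smoothness of the
  translation invariant kernel \<open>f\<close>: its \<open>n\<close>-th differences at step \<open>r\<close> are \<open>O(r\<^sup>n)\<close>. On the other hand, the positive
  part of a function with leading term \<open>a t\<^sup>p\<close>, where \<open>p\<close> is odd, has a \<open>(p + 1)\<close>-st difference
  of order \<open>r\<^sup>p\<close> if all sample points but one are taken where the function is negative.\<close>

lemma no_sign_change_along_symmetric_curve:
  fixes q :: "real \<Rightarrow> 'a" and f g :: "real \<Rightarrow> real"
  assumes e: "e > 0" and q: "\<And>t. \<bar>t\<bar> < e \<Longrightarrow> q t \<in> supp \<rho>" and y: "y \<in> supp \<rho>" "L y y > 0"
    and f: "smooth_on {-2*e<..<2*e} f" "\<And>t t'. \<bar>t\<bar> < e \<Longrightarrow> \<bar>t'\<bar> < e \<Longrightarrow> L (q t) (q t') = f (t - t')"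
    and L: "\<And>t. L (q t) y = max 0 (g t)"
    and g: "((\<lambda>t. g t / t ^ p) \<longlongrightarrow> a) (at 0)" "a \<noteq> 0" "isCont g 0" "changes_sign_at_0 g"
  shows False
proof -
  obtain s d where s: "s = 1 \<or> s = - 1" and d: "d > 0"
    and g_pos: "\<And>t. 0 < t \<Longrightarrow> t < d \<Longrightarrow> \<bar>a\<bar> / 2 * t ^ p \<le> g (s * t)"
    and g_neg: "\<And>t. - d < t \<Longrightarrow> t \<le> 0 \<Longrightarrow> g (s * t) \<le> 0"
    by (rule changes_sign_leading_term[OF g]) blast
  \<comment> \<open>One order more than the leading exponent: the double difference then gains r^2
    against the square of r^p.\<close>
  define n where "n = Suc p"
  define w where "w k = (- 1) ^ k * real (n choose k)" for k
  define N where "N = 2 * n"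
  obtain d' C where d': "d' > 0" and C: "0 \<le> C"
    and taylor: "\<And>x. \<bar>x\<bar> \<le> d' \<Longrightarrow> \<bar>f x - (\<Sum>m<N. (deriv ^^ m) f 0 / fact m * x ^ m)\<bar> \<le> C * \<bar>x\<bar> ^ N"
    by (rule smooth_on_taylor[OF _ _ f(1), of N]) (use e in auto)
  define M where "M = (\<Sum>k\<le>n. \<Sum>l\<le>n. \<bar>w k * w l\<bar> * (C * real n ^ N))"
  have M: "0 \<le> M"
    unfolding M_def using C by (intro sum_nonneg) auto
  have key: "(\<bar>a\<bar> / 2)\<^sup>2 \<le> L y y * M * r\<^sup>2"
    if r: "0 < r" "r * real n < d" "r * real n < e" "r * real n < d'" for r
  proof -
    have rn: "r \<le> r * real n"
      using r(1) by (simp add: n_def)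
    have rd: "r < d"
      using rn r(2) by linarith
    \<comment> \<open>The shift by one puts the sample point for k = 0 at r, the one for k = 1 at 0,
      and all others at negative parameters, so that exactly one term survives the positive
      part.\<close>
    define t where "t k = (1 - real k) * r" for k
    have t: "\<bar>t k\<bar> \<le> r * real n" if "k \<le> n" for k
    proof -
      have "\<bar>1 - real k\<bar> \<le> real n"
        using that by (simp add: n_def)
      then show ?thesis
        using r(1) by (simp add: t_def abs_mult mult.commute[of r] mult_right_mono)
    qed
    have t_diff: "s * t k - s * t l = s * ((real l - real k) * r)" for k l
      by (simp add: t_def algebra_simps)
    have small: "\<bar>s * u\<bar> = \<bar>u\<bar>" for u
      using s by auto
    have lk: "\<bar>s * ((real l - real k) * r)\<bar> \<le> r * real n" if "k \<le> n" "l \<le> n" for k l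
    proof -
      have "\<bar>real l - real k\<bar> \<le> real n"
        using that by simp
      then show ?thesis
        unfolding small using r(1) by (simp add: abs_mult mult.commute[of r] mult_right_mono)
    qed
    have supp: "q (s * t k) \<in> supp \<rho>" if "k \<le> n" for k
      using t[OF that] r(3) by (intro q) (simp add: small)
    have "(\<Sum>k\<le>n. w k * L (q (s * t k)) y) = (\<Sum>k\<le>n. if k = 0 then g (s * r) else 0)"
    proof (rule sum.cong[OF refl])
      fix k assume k: "k \<in> {..n}"
      show "w k * L (q (s * t k)) y = (if k = 0 then g (s * r) else 0)"
      proof (cases "k = 0")
        case True
        have "0 \<le> \<bar>a\<bar> / 2 * r ^ p"
          using r(1) by simp
        also have "\<dots> \<le> g (s * r)"
          by (rule g_pos[OF r(1) rd])
        finally show ?thesis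
          using True by (simp add: w_def t_def L)
      next
        case False
        then have "t k \<le> 0"
          using r(1) by (simp add: t_def mult_nonpos_nonneg)
        then have "g (s * t k) \<le> 0"
          using t[of k] k r(2) by (intro g_neg) auto
        then show ?thesis
          using False by (simp add: L)
      qed
    qed
    then have *: "(\<Sum>k\<le>n. w k * L (q (s * t k)) y) = g (s * r)"
      by simp
    have "(\<bar>a\<bar> / 2 * r ^ p)\<^sup>2 \<le> (\<Sum>k\<le>n. w k * L (q (s * t k)) y)\<^sup>2"
      unfolding * using g_pos[OF r(1) rd] r(1) by (intro power_mono) auto
    also have "\<dots> \<le> L y y * (\<Sum>k\<le>n. \<Sum>l\<le>n. w k * w l * L (q (s * t k)) (q (s * t l)))"
      using supp y by (intro cauchy_schwarz) auto
    finally have cs: "(\<bar>a\<bar> / 2 * r ^ p)\<^sup>2 \<le> L y y * (\<Sum>k\<le>n. \<Sum>l\<le>n. w k * w l * L (q (s * t k)) (q (s * t l)))" .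
    \<comment> \<open>Only parameter differences enter, and these are multiples of r; the quadratic
      form becomes a double difference of \<open>f\<close> around 0.\<close>
    have "(\<Sum>k\<le>n. \<Sum>l\<le>n. w k * w l * L (q (s * t k)) (q (s * t l))) =
        (\<Sum>k\<le>n. \<Sum>l\<le>n. w k * w l * f (s * ((real l - real k) * r)))"
      using t r(3) by (intro sum.cong refl) (subst f(2), auto simp: small t_diff intro: le_less_trans)
    also have "\<dots> \<le> (\<Sum>k\<le>n. \<Sum>l\<le>n. w k * w l * (\<Sum>m<N. (deriv ^^ m) f 0 / fact m * (s * ((real l - real k) * r)) ^ m)
        + \<bar>w k * w l\<bar> * (C * real n ^ N) * r ^ N)"
    proof (intro sum_mono)
      fix k l assume kl: "k \<in> {..n}" "l \<in> {..n}"
      let ?u = "s * ((real l - real k) * r)"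
      have u: "\<bar>?u\<bar> \<le> r * real n"
        using lk kl by auto
      have "w k * w l * f ?u - w k * w l * (\<Sum>m<N. (deriv ^^ m) f 0 / fact m * ?u ^ m) \<le>
          \<bar>w k * w l\<bar> * \<bar>f ?u - (\<Sum>m<N. (deriv ^^ m) f 0 / fact m * ?u ^ m)\<bar>"
        unfolding abs_mult[symmetric] right_diff_distrib[symmetric] by (rule abs_ge_self)
      also have "\<dots> \<le> \<bar>w k * w l\<bar> * (C * (r * real n) ^ N)"
      proof (intro mult_left_mono order_trans[OF taylor] power_mono)
        show "\<bar>?u\<bar> \<le> d'"
          using u r(4) by simp
      qed (use u C in auto)
      finally show "w k * w l * f ?u \<le> w k * w l * (\<Sum>m<N. (deriv ^^ m) f 0 / fact m * ?u ^ m)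
        + \<bar>w k * w l\<bar> * (C * real n ^ N) * r ^ N"
        by (simp add: power_mult_distrib mult_ac)
    qed
    also have "\<dots> = (\<Sum>k\<le>n. \<Sum>l\<le>n. w k * w l * (\<Sum>m<N. (deriv ^^ m) f 0 / fact m * (s * ((real l - real k) * r)) ^ m)) + M * r ^ N"
      by (simp add: sum.distrib M_def sum_distrib_right)
    also have "(\<Sum>k\<le>n. \<Sum>l\<le>n. w k * w l * (\<Sum>m<N. (deriv ^^ m) f 0 / fact m * (s * ((real l - real k) * r)) ^ m)) =
        (\<Sum>k\<le>n. \<Sum>l\<le>n. \<Sum>m<N. ((deriv ^^ m) f 0 / fact m * (s * r) ^ m) * (w k * w l * (real l - real k) ^ m))"
      by (simp add: sum_distrib_left power_mult_distrib mult_ac)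
    also have "\<dots> = (\<Sum>m<N. ((deriv ^^ m) f 0 / fact m * (s * r) ^ m) * (\<Sum>k\<le>n. \<Sum>l\<le>n. w k * w l * (real l - real k) ^ m))"
      by (simp only: sum_distrib_left)
        (subst sum.swap[where A="{..<N}" and B="{..n}"], rule sum.cong[OF refl], rule sum.swap)
    \<comment> \<open>The Taylor polynomial has degree below N = 2n, so the double difference
      annihilates it and only the remainder of order r^N is left.\<close>
    also have "\<dots> = 0"
      using alternating_binomial_power_sum
      by (intro sum.neutral ballI) (subst double_difference_power, auto simp: N_def w_def)
    finally have "(\<Sum>k\<le>n. \<Sum>l\<le>n. w k * w l * L (q (s * t k)) (q (s * t l))) \<le> M * r ^ N"
      by (simp only: add_0_left)
    then have "(\<bar>a\<bar> / 2 * r ^ p)\<^sup>2 \<le> L y y * (M * r ^ N)"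
      using y(2) by (intro order_trans[OF cs] mult_left_mono) auto
    moreover have "r ^ N = r\<^sup>2 * r ^ (2 * p)"
      by (simp add: N_def n_def flip: power_add)
    moreover have "(\<bar>a\<bar> / 2 * r ^ p)\<^sup>2 = (\<bar>a\<bar> / 2)\<^sup>2 * r ^ (2 * p)"
      by (simp only: power_mult_distrib power_mult[symmetric] mult.commute[of p])
    ultimately have "(\<bar>a\<bar> / 2)\<^sup>2 * r ^ (2 * p) \<le> (L y y * M * r\<^sup>2) * r ^ (2 * p)"
      by (simp only: mult.assoc)
    then show ?thesis
      using r(1) by (simp only: mult_le_cancel_right_pos zero_less_power)
  qed
  define K where "K = L y y * M"
  have K: "0 \<le> K"
    using M y(2) by (simp add: K_def)
  \<comment> \<open>Letting r tend to 0 in \<open>key\<close> would force \<open>a\<close> to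
    vanish.\<close>
  have "((\<lambda>r. K * r\<^sup>2) \<longlongrightarrow> K * 0\<^sup>2) (at_right 0)"
    by (intro tendsto_intros)
  then have "\<forall>\<^sub>F r in at_right 0. K * r\<^sup>2 < (\<bar>a\<bar> / 2)\<^sup>2"
    using g(2) by (intro order_tendstoD) auto
  moreover have "\<forall>\<^sub>F r in at_right (0::real). r * real n < b" if "b > 0" for b
  proof -
    have "((\<lambda>r. r * real n) \<longlongrightarrow> 0 * real n) (at_right 0)"
      by (intro tendsto_intros)
    then show ?thesis
      using that by (intro order_tendstoD) auto
  qed
  from this[OF d] this[OF e] this[OF d'] eventually_at_right_less[of "0::real"]
  have "\<forall>\<^sub>F r in at_right 0. (\<bar>a\<bar> / 2)\<^sup>2 \<le> K * r\<^sup>2"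
    by eventually_elim (use key in \<open>simp add: K_def\<close>)
  ultimately have "\<forall>\<^sub>F r in at_right (0::real). False"
    by eventually_elim simp
  then show False
    by simp
qed

end


section \<open>Holomorphic extensions of real analytic functions\<close>

lemma uniform_limit_weighted_integral:
  fixes f :: "'i \<Rightarrow> 'a \<Rightarrow> real"
  assumes \<mu>: "finite_measure \<mu>" and w: "\<And>y. \<bar>w y\<bar> \<le> K"
    and lim: "uniform_limit UNIV f l F"
    and int: "\<And>i. integrable \<mu> (\<lambda>y. w y * f i y)" "integrable \<mu> (\<lambda>y. w y * l y)"
  shows "((\<lambda>i. \<integral>y. w y * f i y \<partial>\<mu>) \<longlongrightarrow> (\<integral>y. w y * l y \<partial>\<mu>)) F"
proof (rule tendstoI)
  interpret finite_measure \<mu> by fact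
  fix e :: real assume e: "e > 0"
  define M where "M = K * measure \<mu> (space \<mu>)"
  have K0: "0 \<le> K"
    using w[of undefined] by linarith
  then have M: "0 \<le> M"
    by (simp add: M_def)
  define e' where "e' = e / (M + 1)"
  have e': "e' > 0"
    using e M by (simp add: e'_def)
  from uniform_limitD[OF lim e']
  show "\<forall>\<^sub>F i in F. dist (\<integral>y. w y * f i y \<partial>\<mu>) (\<integral>y. w y * l y \<partial>\<mu>) < e"
  proof eventually_elim
    case (elim i)
    have "(\<integral>y. w y * f i y \<partial>\<mu>) - (\<integral>y. w y * l y \<partial>\<mu>) = (\<integral>y. w y * (f i y - l y) \<partial>\<mu>)"
      using int by (simp add: right_diff_distrib)
    also have "norm \<dots> \<le> (\<integral>y. K * e' \<partial>\<mu>)"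
    proof (rule order_trans[OF integral_norm_bound integral_mono])
      show "integrable \<mu> (\<lambda>y. norm (w y * (f i y - l y)))"
        using int by (simp add: right_diff_distrib)
      have "\<bar>f i y - l y\<bar> \<le> e'" for y
        using elim by (simp add: dist_real_def less_imp_le)
      then show "norm (w y * (f i y - l y)) \<le> K * e'" for y
        using mult_mono[OF w[of y], of "\<bar>f i y - l y\<bar>" e'] K0 by (simp add: abs_mult)
    qed simp
    also have "\<dots> = M * e'"
      by (simp add: M_def)
    also have "\<dots> < e"
      using M e by (auto simp: e'_def field_simps)
    finally show ?case
      by (simp add: dist_real_def)
  qed
qed

lemma norm_sum_scaleR_Basis_less:
  assumes "r > 0" "s = r / (2 * DIM('e::euclidean_space))" "\<And>b. b \<in> Basis \<Longrightarrow> \<bar>u b\<bar> \<le> s"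
  shows "norm (\<Sum>b\<in>(Basis :: 'e set). u b *\<^sub>R b) < r"
proof -
  have "norm (\<Sum>b\<in>(Basis :: 'e set). u b *\<^sub>R b) \<le> (\<Sum>b\<in>(Basis :: 'e set). s)"
    using assms(3) by (intro sum_norm_le) auto
  also have "\<dots> = r / 2"
    using DIM_positive[where 'a='e] by (simp add: assms(2))
  finally show ?thesis
    using assms(1) by simp
qed

text \<open>A locally convergent power series with the coordinates replaced by products \<open>P b z * q b y\<close>
  and integrated over \<open>y\<close> is again given by an absolutely convergent series of holomorphic
  functions in \<open>z\<close>: the multi-index sum only produces the moments of \<open>q\<close>.\<close>

lemma power_series_integral_holomorphic:
  fixes a :: "('e::euclidean_space \<Rightarrow> nat) \<Rightarrow> real" and F :: "'e \<Rightarrow> real"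
    and P :: "'e \<Rightarrow> complex \<Rightarrow> complex" and p :: "'e \<Rightarrow> real \<Rightarrow> real" and q :: "'e \<Rightarrow> 'a::topological_space \<Rightarrow> real"
  assumes r: "r > 0" "s = r / (2 * DIM('e))"
    and series: "\<And>h. norm h < r \<Longrightarrow>
      ((\<lambda>\<alpha>. (\<Prod>b\<in>Basis. (h \<bullet> b) ^ \<alpha> b) *\<^sub>R a \<alpha>) has_sum F h) (Basis \<rightarrow>\<^sub>E UNIV)"
    and W: "open W" and P: "\<And>b. b \<in> Basis \<Longrightarrow> P b holomorphic_on W"
    and P_le: "\<And>b z. b \<in> Basis \<Longrightarrow> z \<in> W \<Longrightarrow> norm (P b z) \<le> s"
    and P_real: "\<And>b t. b \<in> Basis \<Longrightarrow> complex_of_real t \<in> W \<Longrightarrow> P b (of_real t) = of_real (p b t)"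
    and q: "\<And>b. b \<in> Basis \<Longrightarrow> q b \<in> borel_measurable borel" "\<And>b y. b \<in> Basis \<Longrightarrow> \<bar>q b y\<bar> \<le> 1"
    and \<mu>: "finite_measure \<mu>" "sets \<mu> = sets borel"
    and w: "w \<in> borel_measurable borel" "\<And>y. \<bar>w y\<bar> \<le> K"
    and int: "\<And>t. complex_of_real t \<in> W \<Longrightarrow> integrable \<mu> (\<lambda>y. w y * F (\<Sum>b\<in>Basis. (p b t * q b y) *\<^sub>R b))"
  obtains G where "G holomorphic_on W"
    "\<And>t. complex_of_real t \<in> W \<Longrightarrow> G (of_real t) = of_real (\<integral>y. w y * F (\<Sum>b\<in>Basis. (p b t * q b y) *\<^sub>R b) \<partial>\<mu>)"
proof -
  interpret finite_measure \<mu> by (rule \<mu>)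
  note [measurable_cong] = \<mu>(2)
  note w(1)[measurable] q(1)[measurable]
  define I where "I = ((Basis :: 'e set) \<rightarrow>\<^sub>E (UNIV :: nat set))"
  \<comment> \<open>These are the absolute terms of the series at the corner point with all
    coordinates \<open>s\<close>. Its norm is at most r / 2, so they form a summable
    majorant.\<close>
  define A where "A \<alpha> = \<bar>(\<Prod>b\<in>(Basis :: 'e set). s ^ \<alpha> b) * a \<alpha>\<bar>" for \<alpha>
  have s: "s > 0"
    using r by simp
  have "norm (\<Sum>b\<in>(Basis :: 'e set). s *\<^sub>R b) < r"
    using s by (intro norm_sum_scaleR_Basis_less[OF r]) auto
  from has_sum_imp_summable[OF series[OF this]]
  have "(\<lambda>\<alpha>. (\<Prod>b\<in>(Basis :: 'e set). s ^ \<alpha> b) * a \<alpha>) summable_on I"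
    by (simp add: I_def inner_sum_left_Basis cong: prod.cong)
  then have A: "A summable_on I"
    unfolding A_def by (subst (asm) summable_on_iff_abs_summable_on_real) simp
  have K0: "0 \<le> K"
    using w(2)[of undefined] by linarith
  \<comment> \<open>These weighted moments of \<open>q\<close> carry all dependence on
    \<open>y\<close>. They are bounded uniformly in the multi-index because each \<open>q b\<close>
    is bounded by one.\<close>
  define m where "m \<alpha> = (\<integral>y. w y * (\<Prod>b\<in>Basis. q b y ^ \<alpha> b) \<partial>\<mu>)" for \<alpha>
  define M where "M = K * measure \<mu> (space \<mu>)"
  have prod_q: "\<bar>\<Prod>b\<in>Basis. q b y ^ \<alpha> b\<bar> \<le> 1" for \<alpha> y
    unfolding abs_prod by (rule prod_le_1) (auto simp: power_abs q(2) intro: power_le_one)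
  have wq: "\<bar>w y * (\<Prod>b\<in>Basis. q b y ^ \<alpha> b)\<bar> \<le> K" for \<alpha> y
    using mult_mono[OF w(2) prod_q K0] by (simp add: abs_mult)
  have int_wq: "integrable \<mu> (\<lambda>y. w y * (\<Prod>b\<in>Basis. q b y ^ \<alpha> b))" for \<alpha>
    by (rule integrable_const_bound[where B=K]) (use wq in auto)
  have m: "\<bar>m \<alpha>\<bar> \<le> M" for \<alpha>
  proof -
    have "\<bar>m \<alpha>\<bar> \<le> (\<integral>y. K \<partial>\<mu>)"
      unfolding m_def real_norm_def[symmetric]
      by (rule order_trans[OF integral_norm_bound integral_mono]) (use int_wq wq in auto)
    then show ?thesis
      by (simp add: M_def mult.commute)
  qed
  define T where "T \<alpha> z = complex_of_real (a \<alpha> * m \<alpha>) * (\<Prod>b\<in>Basis. P b z ^ \<alpha> b)" for \<alpha> z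
  define G where "G z = (\<Sum>\<^sub>\<infinity>\<alpha>\<in>I. T \<alpha> z)" for z
  have "norm (T \<alpha> z) \<le> M * A \<alpha>" if "z \<in> W" for \<alpha> z
  proof -
    have "norm (\<Prod>b\<in>Basis. P b z ^ \<alpha> b) \<le> (\<Prod>b\<in>(Basis :: 'e set). s ^ \<alpha> b)"
      unfolding prod_norm[symmetric] norm_power by (intro prod_mono) (use P_le that in \<open>auto intro: power_mono\<close>)
    then have "norm (T \<alpha> z) \<le> \<bar>a \<alpha>\<bar> * M * (\<Prod>b\<in>(Basis :: 'e set). s ^ \<alpha> b)"
      unfolding T_def norm_mult norm_of_real abs_mult using m[of \<alpha>] by (intro mult_mono) auto
    also have "\<dots> = M * A \<alpha>"
      using s by (simp add: A_def abs_mult abs_of_nonneg prod_nonneg)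
    finally show ?thesis .
  qed
  then have lim: "uniform_limit W (\<lambda>X z. \<Sum>\<alpha>\<in>X. T \<alpha> z) G (finite_subsets_at_top I)"
    unfolding G_def using summable_on_cmult_right[OF A, of M] by (intro Weierstrass_m_test_general)
  have T_hol: "(\<lambda>z. \<Sum>\<alpha>\<in>X. T \<alpha> z) holomorphic_on W" for X
    unfolding T_def by (intro holomorphic_intros P)
  \<comment> \<open>The partial sums are holomorphic and converge uniformly, so Weierstrass' theorem
    applies on small balls.\<close>
  have "G holomorphic_on W"
  proof (rule holomorphic_on_subset[OF _ order_refl], subst holomorphic_on_open[OF W], intro ballI)
    fix z assume "z \<in> W"
    then obtain e where e: "e > 0" "cball z e \<subseteq> W"
      using W open_contains_cball by blast
    have "\<forall>\<^sub>F X in finite_subsets_at_top I. continuous_on (cball z e) (\<lambda>z. \<Sum>\<alpha>\<in>X. T \<alpha> z) \<and>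
        (\<lambda>z. \<Sum>\<alpha>\<in>X. T \<alpha> z) holomorphic_on ball z e"
      using T_hol e(2) ball_subset_cball
      by (intro always_eventually allI conjI holomorphic_on_imp_continuous_on) (blast intro: holomorphic_on_subset)+
    then have "G holomorphic_on ball z e"
      using holomorphic_uniform_limit[OF _ uniform_limit_on_subset[OF lim e(2)]] by auto
    then show "\<exists>f'. (G has_field_derivative f') (at z)"
      using e(1) by (meson centre_in_ball holomorphic_on_open open_ball)
  qed
  moreover have "G (of_real t) = of_real (\<integral>y. w y * F (\<Sum>b\<in>Basis. (p b t * q b y) *\<^sub>R b) \<partial>\<mu>)" if t: "complex_of_real t \<in> W" for t
  proof -
    define U where "U \<alpha> y = (\<Prod>b\<in>Basis. (p b t * q b y) ^ \<alpha> b) * a \<alpha>" for \<alpha> y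
    have p_le: "\<bar>p b t\<bar> \<le> s" if "b \<in> Basis" for b
      using P_le[OF that t] P_real[OF that t] by simp
    have pq: "\<bar>p b t * q b y\<bar> \<le> s" if "b \<in> Basis" for b y
      using mult_mono[OF p_le[OF that] q(2)[OF that, of y]] s by (simp add: abs_mult)
    have U_le: "norm (U \<alpha> y) \<le> A \<alpha>" for \<alpha> y
    proof -
      have "\<bar>\<Prod>b\<in>Basis. (p b t * q b y) ^ \<alpha> b\<bar> \<le> (\<Prod>b\<in>(Basis :: 'e set). s ^ \<alpha> b)"
        unfolding abs_prod power_abs by (intro prod_mono) (use pq in \<open>auto intro: power_mono\<close>)
      then show ?thesis
        using s by (simp add: U_def A_def abs_mult abs_of_nonneg prod_nonneg mult_right_mono)
    qed
    have U_sum: "((\<lambda>\<alpha>. U \<alpha> y) has_sum F (\<Sum>b\<in>Basis. (p b t * q b y) *\<^sub>R b)) I" for y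
      using series[OF norm_sum_scaleR_Basis_less[OF r pq, of "\<lambda>b. b" "\<lambda>_. y"]]
      by (simp add: U_def I_def inner_sum_left_Basis cong: prod.cong)
    \<comment> \<open>The majorant \<open>A\<close> does not depend on \<open>y\<close>, so the
      series converges uniformly in \<open>y\<close> and may be integrated term by term.\<close>
    have U_lim: "uniform_limit UNIV (\<lambda>X y. \<Sum>\<alpha>\<in>X. U \<alpha> y) (\<lambda>y. F (\<Sum>b\<in>Basis. (p b t * q b y) *\<^sub>R b)) (finite_subsets_at_top I)"
      using U_le U_sum A by (intro Weierstrass_m_test_general'[where M=A])
    have U_eq: "w y * U \<alpha> y = (a \<alpha> * (\<Prod>b\<in>Basis. p b t ^ \<alpha> b)) * (w y * (\<Prod>b\<in>Basis. q b y ^ \<alpha> b))" for \<alpha> y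
      by (simp add: U_def power_mult_distrib prod.distrib mult_ac)
    have int_U: "integrable \<mu> (\<lambda>y. w y * (\<Sum>\<alpha>\<in>X. U \<alpha> y))" for X
      unfolding sum_distrib_left U_eq by (intro Bochner_Integration.integrable_sum integrable_mult_right int_wq)
    have "((\<lambda>X. \<integral>y. w y * (\<Sum>\<alpha>\<in>X. U \<alpha> y) \<partial>\<mu>) \<longlongrightarrow> (\<integral>y. w y * F (\<Sum>b\<in>Basis. (p b t * q b y) *\<^sub>R b) \<partial>\<mu>)) (finite_subsets_at_top I)"
      by (rule uniform_limit_weighted_integral[OF \<mu>(1) w(2) U_lim int_U int[OF t]])
    then have "((\<lambda>X. complex_of_real (\<integral>y. w y * (\<Sum>\<alpha>\<in>X. U \<alpha> y) \<partial>\<mu>)) \<longlongrightarrow>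
        of_real (\<integral>y. w y * F (\<Sum>b\<in>Basis. (p b t * q b y) *\<^sub>R b) \<partial>\<mu>)) (finite_subsets_at_top I)"
      by (rule tendsto_of_real)
    also have "(\<lambda>X. complex_of_real (\<integral>y. w y * (\<Sum>\<alpha>\<in>X. U \<alpha> y) \<partial>\<mu>)) = (\<lambda>X. \<Sum>\<alpha>\<in>X. T \<alpha> (of_real t))"
    proof
      fix X
      have "(\<integral>y. w y * (\<Sum>\<alpha>\<in>X. U \<alpha> y) \<partial>\<mu>) = (\<Sum>\<alpha>\<in>X. (a \<alpha> * (\<Prod>b\<in>Basis. p b t ^ \<alpha> b)) * m \<alpha>)"
        unfolding sum_distrib_left U_eq m_def using int_wq
        by (subst Bochner_Integration.integral_sum) auto
      moreover have "T \<alpha> (of_real t) = of_real ((a \<alpha> * (\<Prod>b\<in>Basis. p b t ^ \<alpha> b)) * m \<alpha>)" for \<alpha>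
        using P_real t by (simp add: T_def cong: prod.cong)
      ultimately show "complex_of_real (\<integral>y. w y * (\<Sum>\<alpha>\<in>X. U \<alpha> y) \<partial>\<mu>) = (\<Sum>\<alpha>\<in>X. T \<alpha> (of_real t))"
        by simp
    qed
    finally have "((\<lambda>X. \<Sum>\<alpha>\<in>X. T \<alpha> (of_real t)) \<longlongrightarrow>
        of_real (\<integral>y. w y * F (\<Sum>b\<in>Basis. (p b t * q b y) *\<^sub>R b) \<partial>\<mu>)) (finite_subsets_at_top I)" .
    moreover have "((\<lambda>X. \<Sum>\<alpha>\<in>X. T \<alpha> (of_real t)) \<longlongrightarrow> G (of_real t)) (finite_subsets_at_top I)"
      using lim t by (rule tendsto_uniform_limitI)
    ultimately show ?thesis
      by (intro tendsto_unique[of "finite_subsets_at_top I"]) auto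
  qed
  ultimately show ?thesis
    using that by blast
qed

text \<open>This is the case of a Dirac measure with weight and factors \<open>q\<close> equal to
  one.\<close>

lemma power_series_holomorphic:
  fixes a :: "('e::euclidean_space \<Rightarrow> nat) \<Rightarrow> real" and F :: "'e \<Rightarrow> real"
    and P :: "'e \<Rightarrow> complex \<Rightarrow> complex" and p :: "'e \<Rightarrow> real \<Rightarrow> real"
  assumes r: "r > 0" "s = r / (2 * DIM('e))"
    and series: "\<And>h. norm h < r \<Longrightarrow>
      ((\<lambda>\<alpha>. (\<Prod>b\<in>Basis. (h \<bullet> b) ^ \<alpha> b) *\<^sub>R a \<alpha>) has_sum F h) (Basis \<rightarrow>\<^sub>E UNIV)"
    and W: "open W" and P: "\<And>b. b \<in> Basis \<Longrightarrow> P b holomorphic_on W"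
    and P_le: "\<And>b z. b \<in> Basis \<Longrightarrow> z \<in> W \<Longrightarrow> norm (P b z) \<le> s"
    and P_real: "\<And>b t. b \<in> Basis \<Longrightarrow> complex_of_real t \<in> W \<Longrightarrow> P b (of_real t) = of_real (p b t)"
  obtains G where "G holomorphic_on W"
    "\<And>t. complex_of_real t \<in> W \<Longrightarrow> G (of_real t) = of_real (F (\<Sum>b\<in>Basis. p b t *\<^sub>R b))"
proof -
  let ?\<mu> = "return borel (0 :: real)"
  interpret prob_space ?\<mu>
    by (rule prob_space_return) simp
  obtain G where "G holomorphic_on W" "\<And>t. complex_of_real t \<in> W \<Longrightarrow>
      G (of_real t) = of_real (\<integral>y. 1 * F (\<Sum>b\<in>Basis. (p b t * 1) *\<^sub>R b) \<partial>?\<mu>)"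
    by (rule power_series_integral_holomorphic[OF r series W P P_le P_real, where q="\<lambda>_ _. 1" and w="\<lambda>_. 1" and \<mu>="?\<mu>" and K=1])
      (auto intro: finite_measure_axioms)
  then show ?thesis
    using that prob_space by simp
qed

lemma real_analytic_curve_holomorphic:
  fixes \<gamma> :: "real \<Rightarrow> 'e::euclidean_space"
  assumes "real_analytic_on T \<gamma>" "0 \<in> T"
  obtains R \<Gamma> where "R > 0" "\<And>b. \<Gamma> b holomorphic_on ball 0 R"
    "\<And>b t. \<bar>t\<bar> < R \<Longrightarrow> \<Gamma> b (of_real t) = of_real (\<gamma> t \<bullet> b)"
proof -
  obtain r and a :: "(real \<Rightarrow> nat) \<Rightarrow> 'e" where r: "r > 0"
    and a: "\<And>h. norm h < r \<Longrightarrow> ((\<lambda>\<alpha>. (\<Prod>b\<in>Basis. (h \<bullet> b) ^ \<alpha> b) *\<^sub>R a \<alpha>) has_sum \<gamma> (0 + h)) (Basis \<rightarrow>\<^sub>E UNIV)"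
    using assms unfolding real_analytic_on_def by blast
  define s where "s = r / (2 * DIM(real))"
  have "\<exists>G. G holomorphic_on ball 0 s \<and> (\<forall>t. \<bar>t\<bar> < s \<longrightarrow> G (of_real t) = of_real (\<gamma> t \<bullet> b))" for b
  proof -
    have *: "((\<lambda>\<alpha>. (\<Prod>b\<in>Basis. (h \<bullet> b) ^ \<alpha> b) *\<^sub>R (a \<alpha> \<bullet> b)) has_sum \<gamma> h \<bullet> b) (Basis \<rightarrow>\<^sub>E UNIV)"
      if "norm h < r" for h
      using has_sum_bounded_linear[OF bounded_linear_inner_left a[OF that], of b] by (simp add: o_def)
    obtain G where G: "G holomorphic_on ball 0 s"
      "\<And>t. complex_of_real t \<in> ball 0 s \<Longrightarrow> G (of_real t) = of_real (\<gamma> (\<Sum>b\<in>Basis. t *\<^sub>R b) \<bullet> b)"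
      by (rule power_series_holomorphic[OF r s_def *, where W="ball 0 s" and P="\<lambda>_ z. z" and p="\<lambda>_ t. t"]) auto
    then show ?thesis
      by (intro exI[of _ G]) auto
  qed
  then obtain \<Gamma> where "\<And>b. \<Gamma> b holomorphic_on ball 0 s" "\<And>b t. \<bar>t\<bar> < s \<Longrightarrow> \<Gamma> b (of_real t) = of_real (\<gamma> t \<bullet> b)"
    by metis
  moreover have "s > 0"
    using r by (simp add: s_def)
  ultimately show ?thesis
    using that by blast
qed

text \<open>The complexified coordinates of the curve, minus their values at 0, are substituted into
  the power series of \<open>F\<close> at \<open>\<gamma> 0\<close>. Continuity at 0 keeps them
  within the polydisc of radius \<open>s\<close> on a smaller disc.\<close>

lemma real_analytic_compose_curve_holomorphic:
  fixes F :: "'e::euclidean_space \<Rightarrow> real" and \<gamma> :: "real \<Rightarrow> 'e"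
  assumes F: "real_analytic_on S F" "\<gamma> 0 \<in> S"
    and R: "R > 0" and \<Gamma>: "\<And>b. b \<in> Basis \<Longrightarrow> \<Gamma> b holomorphic_on ball 0 R"
      "\<And>b t. b \<in> Basis \<Longrightarrow> \<bar>t\<bar> < R \<Longrightarrow> \<Gamma> b (of_real t) = of_real (\<gamma> t \<bullet> b)"
  obtains R' G where "R' > 0" "G holomorphic_on ball 0 R'" "\<And>t. \<bar>t\<bar> < R' \<Longrightarrow> G (of_real t) = of_real (F (\<gamma> t))"
proof -
  obtain r and a :: "('e \<Rightarrow> nat) \<Rightarrow> real" where r: "r > 0"
    and a: "\<And>h. norm h < r \<Longrightarrow> ((\<lambda>\<alpha>. (\<Prod>b\<in>Basis. (h \<bullet> b) ^ \<alpha> b) *\<^sub>R a \<alpha>) has_sum F (\<gamma> 0 + h)) (Basis \<rightarrow>\<^sub>E UNIV)"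
    using F unfolding real_analytic_on_def by blast
  define s where "s = r / (2 * DIM('e))"
  have s: "s > 0"
    using r by (simp add: s_def)
  define P where "P b z = \<Gamma> b z - of_real (\<gamma> 0 \<bullet> b)" for b z
  have P0: "P b 0 = 0" if "b \<in> Basis" for b
    using \<Gamma>(2)[OF that, of 0] R by (simp add: P_def)
  have P_hol: "P b holomorphic_on ball 0 R" if "b \<in> Basis" for b
    unfolding P_def by (intro holomorphic_intros \<Gamma> that)
  have "\<exists>d>0. \<forall>z\<in>ball 0 d. norm (P b z) \<le> s" if b: "b \<in> Basis" for b
  proof -
    have "continuous_on (ball 0 R) (P b)"
      using P_hol[OF b] by (rule holomorphic_on_imp_continuous_on)
    then have "isCont (P b) 0"
      using R by (simp add: continuous_on_eq_continuous_at)
    then obtain d where "d > 0" "\<forall>z. dist z 0 < d \<longrightarrow> dist (P b z) (P b 0) < s"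
      using s unfolding continuous_at_eps_delta by blast
    then show ?thesis
      using P0[OF b] by (intro exI[of _ d]) (auto simp: less_imp_le)
  qed
  then obtain d where d: "\<And>b. b \<in> Basis \<Longrightarrow> d b > 0" "\<And>b z. b \<in> Basis \<Longrightarrow> z \<in> ball 0 (d b) \<Longrightarrow> norm (P b z) \<le> s"
    by metis
  define R' where "R' = Min (insert R (d ` Basis))"
  have R': "R' > 0"
    using R d(1) by (simp add: R'_def)
  have "R' \<le> R" "\<And>b. b \<in> Basis \<Longrightarrow> R' \<le> d b"
    unfolding R'_def by (intro Min_le; simp)+
  note R' = R' this
  obtain G where G: "G holomorphic_on ball 0 R'" "\<And>t. complex_of_real t \<in> ball 0 R' \<Longrightarrow>
      G (of_real t) = of_real (F (\<gamma> 0 + (\<Sum>b\<in>Basis. ((\<gamma> t - \<gamma> 0) \<bullet> b) *\<^sub>R b)))"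
  proof (rule power_series_holomorphic[OF r s_def a, where W="ball 0 R'" and P=P and p="\<lambda>b t. (\<gamma> t - \<gamma> 0) \<bullet> b"])
    show "P b holomorphic_on ball 0 R'" if "b \<in> Basis" for b
      using P_hol[OF that] by (rule holomorphic_on_subset) (use R' in auto)
    show "norm (P b z) \<le> s" if "b \<in> Basis" "z \<in> ball 0 R'" for b z
      using d(2)[OF that(1), of z] R'(3)[OF that(1)] that(2) by auto
    show "P b (of_real t) = of_real ((\<gamma> t - \<gamma> 0) \<bullet> b)" if "b \<in> Basis" "complex_of_real t \<in> ball 0 R'" for b t
      using \<Gamma>(2)[OF that(1), of t] that(2) R' by (simp add: P_def inner_diff_left)
  qed auto
  show ?thesis
    by (rule that[OF R'(1) G(1)]) (use G(2) in \<open>simp add: euclidean_representation\<close>)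
qed

text \<open>Off the trivial case of a nonzero value at 0, the point \<open>t0\<close> rules out a
  constant extension, so the zero can be factored out. The cofactor at 0 is real because it is a
  limit of real values.\<close>

lemma holomorphic_leading_term:
  fixes g :: "real \<Rightarrow> real"
  assumes R: "R > 0" and G: "G holomorphic_on ball 0 R" "\<And>t. \<bar>t\<bar> < R \<Longrightarrow> G (of_real t) = of_real (g t)"
    and t0: "\<bar>t0\<bar> < R" "g t0 \<noteq> 0"
  obtains n a where "a \<noteq> 0" "((\<lambda>t. g t / t ^ n) \<longlongrightarrow> a) (at 0)"
proof -
  have "\<exists>r H n. r > 0 \<and> r \<le> R \<and> H holomorphic_on ball 0 r \<and> (\<forall>z\<in>ball 0 r. G z = z ^ n * H z) \<and> H 0 \<noteq> 0"
  proof (cases "G 0 = 0")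
    case True
    have "\<not> G constant_on ball 0 R"
    proof
      assume "G constant_on ball 0 R"
      then have "G (of_real t0) = G 0"
        unfolding constant_on_def using t0(1) R by (metis centre_in_ball mem_ball_0 norm_of_real real_norm_def)
      then show False
        using True G(2)[OF t0(1)] t0(2) by simp
    qed
    then obtain H r n where H: "r > 0" "ball 0 r \<subseteq> ball (0::complex) R" "H holomorphic_on ball 0 r"
        "\<And>z. z \<in> ball 0 r \<Longrightarrow> G z = (z - 0) ^ n * H z" "\<And>z. z \<in> ball 0 r \<Longrightarrow> H z \<noteq> 0"
      using holomorphic_factor_zero_nonconstant[OF G(1) open_ball connected_ball _ True] R
      by (metis centre_in_ball)
    then show ?thesis
      by (intro exI[of _ r] exI[of _ H] exI[of _ n]) (auto simp: ball_subset_ball_iff)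
  next
    case False
    then show ?thesis
      using R G(1) by (intro exI[of _ R] exI[of _ G] exI[of _ 0]) auto
  qed
  then obtain r H n where r: "r > 0" "r \<le> R" and H: "H holomorphic_on ball 0 r"
      "\<And>z. z \<in> ball 0 r \<Longrightarrow> G z = z ^ n * H z" "H 0 \<noteq> 0"
    by blast
  have HR: "H (of_real t) = of_real (g t / t ^ n)" if "t \<noteq> 0" "\<bar>t\<bar> < r" for t
    using H(2)[of "of_real t"] G(2)[of t] that r by (simp add: field_simps)
  have "isCont H 0"
    using holomorphic_on_imp_continuous_on[OF H(1)] r(1) by (simp add: continuous_on_eq_continuous_at)
  then have "isCont (\<lambda>t. H (of_real t)) (0 :: real)"
    by (intro continuous_intros isCont_o2[of _ of_real H]) auto
  then have "((\<lambda>t::real. H (of_real t)) \<longlongrightarrow> H 0) (at 0)"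
    by (simp add: isCont_def)
  moreover have "\<forall>\<^sub>F t::real in at 0. H (of_real t) = of_real (g t / t ^ n)"
    unfolding eventually_at using HR r(1) by (intro exI[of _ r]) (auto simp: dist_real_def)
  ultimately have lim: "((\<lambda>t. complex_of_real (g t / t ^ n)) \<longlongrightarrow> H 0) (at 0)"
    by (rule Lim_transform_eventually)
  have "((\<lambda>t. g t / t ^ n) \<longlongrightarrow> Re (H 0)) (at 0)"
    using tendsto_Re[OF lim] by simp
  moreover have "((\<lambda>t::real. 0 :: real) \<longlongrightarrow> Im (H 0)) (at 0)"
    using tendsto_Im[OF lim] by simp
  then have "Im (H 0) = 0"
    using tendsto_unique[OF _ tendsto_const] by (metis at_neq_bot)
  then have "Re (H 0) \<noteq> 0"
    using H(3) by (auto simp: complex_eq_iff)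
  ultimately show ?thesis
    using that by blast
qed


section \<open>The identity theorem for integrals of an analytic kernel\<close>

text \<open>The integral is complexified along the line through \<open>u1\<close> and
  \<open>u2\<close>. The radius 2 makes the disc contain both t = 0 and t = 1, so that information
  at \<open>u1\<close> can be carried to \<open>u2\<close> by the identity theorem.\<close>

definition line_extension ::
  "'a measure \<Rightarrow> ('e::euclidean_space \<Rightarrow> 'a \<Rightarrow> real) \<Rightarrow> 'e \<Rightarrow> real \<Rightarrow> ('a \<Rightarrow> real) \<Rightarrow> bool" where
  "line_extension \<mu> f u0 r w \<longleftrightarrow> (\<forall>u1\<in>ball u0 r. \<forall>u2\<in>ball u0 r. \<exists>G. G holomorphic_on ball 0 2 \<and>
     (\<forall>t. \<bar>t\<bar> < 2 \<longrightarrow> G (of_real t) = of_real (\<integral>y. w y * f (u1 + t *\<^sub>R (u2 - u1)) y \<partial>\<mu>)))"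

lemma line_extension_mono:
  assumes "line_extension \<mu> f u0 r w" "r' \<le> r"
  shows "line_extension \<mu> f u0 r' w"
  using assms subset_ball[OF assms(2), of u0] unfolding line_extension_def by blast

locale analytic_kernel =
  fixes B :: "('a::{t2_space, second_countable_topology}, 'e::euclidean_space) chart set"
    and D :: "'a \<Rightarrow> 'a \<Rightarrow> real" and \<mu> :: "'a measure"
  assumes atlas: "manifold_atlas real_analytic_on B" and kernel: "kernel_of_class real_analytic_on B D"
    and compact_UNIV: "compact (UNIV :: 'a set)" and cont_D: "continuous_on UNIV (\<lambda>(x, y). D x y)"
    and \<mu>: "finite_measure \<mu>" "sets \<mu> = sets borel"
begin

lemma integrable_weight_D: "bounded_borel w \<Longrightarrow> integrable \<mu> (\<lambda>y. w y * D x y)"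
  using integrable_bounded_weight[OF compact_UNIV \<mu> _ _ continuous_on_slice[of UNIV D x]] cont_D
  by (auto elim!: bounded_borelE)

text \<open>Near \<open>(z0, y0)\<close> the kernel has a power series in product coordinates.
  Restricting the weight to a patch \<open>N\<close> keeps all contributing \<open>y\<close> within
  its polydisc.\<close>

lemma local_line_extension:
  assumes U: "(U, \<phi>) \<in> B" "z0 \<in> U"
  shows "\<exists>N r. open N \<and> y0 \<in> N \<and> r > 0 \<and>
    (\<forall>w. bounded_borel w \<longrightarrow> (\<forall>y. y \<notin> N \<longrightarrow> w y = 0) \<longrightarrow>
      line_extension \<mu> (\<lambda>u. D (inv_into U \<phi> u)) (\<phi> z0) r w)"
proof -
  obtain V \<psi> where V: "(V, \<psi>) \<in> B" "y0 \<in> V"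
    using atlas_cover[OF atlas] by metis
  define u0 where "u0 = \<phi> z0"
  define v0 where "v0 = \<psi> y0"
  define D' where "D' p = (case p of (u, v) \<Rightarrow> D (inv_into U \<phi> u) (inv_into V \<psi> v))" for p
  have "real_analytic_on (\<phi> ` U \<times> \<psi> ` V) D'"
    using kernel U(1) V(1) unfolding kernel_of_class_def D'_def[abs_def] by blast
  moreover have "(u0, v0) \<in> \<phi> ` U \<times> \<psi> ` V"
    using U V by (simp add: u0_def v0_def)
  ultimately obtain R and a :: "('e \<times> 'e \<Rightarrow> nat) \<Rightarrow> real" where R: "R > 0"
    and a: "\<And>h. norm h < R \<Longrightarrow> ((\<lambda>\<alpha>. (\<Prod>b\<in>Basis. (h \<bullet> b) ^ \<alpha> b) *\<^sub>R a \<alpha>) has_sum D' ((u0, v0) + h)) (Basis \<rightarrow>\<^sub>E UNIV)"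
    unfolding real_analytic_on_def by blast
  define s where "s = R / (2 * DIM('e \<times> 'e))"
  have s: "s > 0"
    using R by (simp add: s_def)
  define N where "N = V \<inter> \<psi> -` ball v0 s"
  have \<psi>: "continuous_on V \<psi>" "open V"
    using atlas_chart[OF atlas V(1)] homeomorphism_cont1 by blast+
  have N: "open N" "y0 \<in> N" "N \<subseteq> V"
    using continuous_open_preimage[OF \<psi> open_ball, of v0 s] V s by (auto simp: N_def v0_def)
  \<comment> \<open>The coordinates of the first factor depend on t only, so here they get the
    factor 1. Those of the second factor are divided by \<open>s\<close>, which is restored by
    \<open>p\<close>; the value 0 off \<open>N\<close> makes them globally bounded and
    Borel.\<close>
  define q where "q i y = (if snd i = 0 then 1 else if y \<in> N then (\<psi> y - v0) \<bullet> snd i / s else 0)" for i :: "'e \<times> 'e" and y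
  have \<psi>N: "continuous_on N \<psi>"
    using \<psi>(1) N(3) by (rule continuous_on_subset)
  have q_meas: "q i \<in> borel_measurable borel" for i
  proof (cases "snd i = 0")
    case True
    then show ?thesis
      by (simp add: q_def[abs_def])
  next
    case False
    have "(\<lambda>y. if y \<in> N then (\<psi> y - v0) \<bullet> snd i / s else 0) \<in> borel_measurable borel"
      using N(1) s by (intro borel_measurable_continuous_on_if continuous_intros \<psi>N) auto
    then show ?thesis
      using False by (simp add: q_def[abs_def])
  qed
  have q_le: "\<bar>q i y\<bar> \<le> 1" if i: "i \<in> Basis" for i y
  proof -
    have "\<bar>(\<psi> y - v0) \<bullet> snd i\<bar> \<le> s" if "y \<in> N"
    proof -
      have "\<bar>(\<psi> y - v0) \<bullet> snd i\<bar> \<le> norm (\<psi> y - v0) * norm (snd i)"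
        by (rule Cauchy_Schwarz_ineq2)
      also have "\<dots> \<le> norm (\<psi> y - v0) * 1"
        using i by (intro mult_left_mono) (auto simp: Basis_prod_def)
      also have "\<dots> \<le> s"
        using that by (simp add: N_def dist_norm norm_minus_commute)
      finally show ?thesis .
    qed
    then show ?thesis
      using s by (auto simp: q_def)
  qed
  \<comment> \<open>The fraction 1/5 fits the disc |z| < 2: the starting point contributes at most
    s/5 and the direction at most 2 * (2s/5), which add up to \<open>s\<close>.\<close>
  have ext: "line_extension \<mu> (\<lambda>u. D (inv_into U \<phi> u)) u0 (s / 5) w"
    if w: "bounded_borel w" "\<And>y. y \<notin> N \<Longrightarrow> w y = 0" for w
    unfolding line_extension_def
  proof (intro ballI)
    fix u1 u2 assume u: "u1 \<in> ball u0 (s / 5)" "u2 \<in> ball u0 (s / 5)"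
    obtain K where K: "w \<in> borel_measurable borel" "\<And>y. \<bar>w y\<bar> \<le> K"
      using w(1) by (rule bounded_borelE) blast
    define p where "p i t = (if snd i = 0 then (u1 - u0) \<bullet> fst i + t * ((u2 - u1) \<bullet> fst i) else s)" for i :: "'e \<times> 'e" and t
    define P where "P i z = (if snd i = 0 then of_real ((u1 - u0) \<bullet> fst i) + z * of_real ((u2 - u1) \<bullet> fst i) else complex_of_real s)"
      for i :: "'e \<times> 'e" and z
    have sum_eq: "(\<Sum>i\<in>Basis. (p i t * q i y) *\<^sub>R i) = (u1 + t *\<^sub>R (u2 - u1) - u0, \<psi> y - v0)" if "y \<in> N" for t y
    proof -
      have "(\<Sum>i\<in>Basis. (p i t * q i y) *\<^sub>R i) =
          (\<Sum>b\<in>Basis. ((u1 + t *\<^sub>R (u2 - u1) - u0) \<bullet> b) *\<^sub>R (b, 0)) + (\<Sum>b\<in>Basis. ((\<psi> y - v0) \<bullet> b) *\<^sub>R (0, b))"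
        unfolding sum_Basis_prod_eq using s that
        by (intro arg_cong2[where f="(+)"] sum.cong refl) (auto simp: p_def q_def inner_simps)
      also have "\<dots> = (u1 + t *\<^sub>R (u2 - u1) - u0, \<psi> y - v0)"
        by (simp add: prod_eq_iff fst_sum snd_sum euclidean_representation)
      finally show ?thesis .
    qed
    have D_eq: "w y * D' ((u0, v0) + (\<Sum>i\<in>Basis. (p i t * q i y) *\<^sub>R i)) =
        w y * D (inv_into U \<phi> (u1 + t *\<^sub>R (u2 - u1))) y" for t y
    proof (cases "y \<in> N")
      case True
      have "inv_into V \<psi> (\<psi> y) = y"
        using homeomorphism_apply1[OF atlas_chart(3)[OF atlas V(1)]] True N(3) by blast
      then show ?thesis
        by (simp add: sum_eq[OF True] D'_def)
    qed (simp add: w(2))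
    obtain G where "G holomorphic_on ball 0 2" "\<And>t. complex_of_real t \<in> ball 0 2 \<Longrightarrow>
        G (of_real t) = of_real (\<integral>y. w y * D' ((u0, v0) + (\<Sum>i\<in>Basis. (p i t * q i y) *\<^sub>R i)) \<partial>\<mu>)"
    proof (rule power_series_integral_holomorphic[OF R s_def a open_ball, where P=P and p=p and q=q and w=w and K=K])
      show "P i holomorphic_on ball 0 2" for i
        unfolding P_def by (cases "snd i = 0") (auto intro!: holomorphic_intros)
      show "norm (P i z) \<le> s" if i: "i \<in> Basis" and z: "z \<in> ball 0 2" for i z
      proof (cases "snd i = 0")
        case True
        have fi: "norm (fst i) \<le> 1"
          using i by (auto simp: Basis_prod_def)
        have le: "\<bar>x \<bullet> fst i\<bar> \<le> norm x" for x
          using Cauchy_Schwarz_ineq2[of x "fst i"] mult_left_mono[OF fi norm_ge_zero[of x]] by simp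
        have u': "norm (u1 - u0) \<le> s / 5" "norm (u2 - u0) \<le> s / 5"
          using u by (auto simp: dist_norm norm_minus_commute)
        then have "norm (u2 - u1) \<le> 2 * s / 5"
          using norm_triangle_ineq4[of "u2 - u0" "u1 - u0"] by simp
        then have "\<bar>(u2 - u1) \<bullet> fst i\<bar> \<le> 2 * s / 5"
          using le[of "u2 - u1"] by linarith
        moreover have "\<bar>(u1 - u0) \<bullet> fst i\<bar> \<le> s / 5"
          using le[of "u1 - u0"] u'(1) by linarith
        moreover have "norm (P i z) \<le> \<bar>(u1 - u0) \<bullet> fst i\<bar> + norm z * \<bar>(u2 - u1) \<bullet> fst i\<bar>"
          using norm_triangle_ineq[of "of_real ((u1 - u0) \<bullet> fst i)" "z * of_real ((u2 - u1) \<bullet> fst i)"]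
          unfolding P_def if_P[OF True] by (simp only: norm_mult norm_of_real)
        moreover have "norm z * \<bar>(u2 - u1) \<bullet> fst i\<bar> \<le> 2 * (2 * s / 5)"
          using z by (intro mult_mono calculation(1)) auto
        ultimately have "norm (P i z) \<le> s / 5 + 2 * (2 * s / 5)"
          by linarith
        then show ?thesis
          by simp
      qed (use s in \<open>simp add: P_def\<close>)
      show "P i (of_real t) = of_real (p i t)" for i t
        by (simp add: P_def p_def)
      show "integrable \<mu> (\<lambda>y. w y * D' ((u0, v0) + (\<Sum>i\<in>Basis. (p i t * q i y) *\<^sub>R i)))" for t
        unfolding D_eq by (rule integrable_weight_D[OF w(1)])
    qed (use q_meas q_le \<mu> K in auto)
    then show "\<exists>G. G holomorphic_on ball 0 2 \<and> (\<forall>t. \<bar>t\<bar> < 2 \<longrightarrow>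
        G (of_real t) = of_real (\<integral>y. w y * D (inv_into U \<phi> (u1 + t *\<^sub>R (u2 - u1))) y \<partial>\<mu>))"
      unfolding D_eq by (intro exI[of _ G]) auto
  qed
  show ?thesis
    unfolding u0_def[symmetric]
    by (rule exI[of _ N], rule exI[of _ "s / 5"]) (use N s ext in auto)
qed

text \<open>Finitely many patches cover the compact space, and the extension property is additive in
  the weight, with the radius replaced by a minimum.\<close>

lemma line_extension_chart:
  assumes U: "(U, \<phi>) \<in> B" "z0 \<in> U"
  obtains r where "r > 0" "\<And>w. bounded_borel w \<Longrightarrow> line_extension \<mu> (\<lambda>u. D (inv_into U \<phi> u)) (\<phi> z0) r w"
proof -
  define Q where "Q N \<longleftrightarrow> (\<exists>r>0. \<forall>w. bounded_borel w \<longrightarrow> (\<forall>y. y \<notin> N \<longrightarrow> w y = 0) \<longrightarrow>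
      line_extension \<mu> (\<lambda>u. D (inv_into U \<phi> u)) (\<phi> z0) r w)" for N
  obtain N where N: "\<And>y. open (N y)" "\<And>y. y \<in> N y" "\<And>y. Q (N y)"
    using local_line_extension[OF U] unfolding Q_def by metis
  obtain Y where Y: "finite Y" "UNIV \<subseteq> (\<Union>y\<in>Y. N y)"
    by (rule compactE_image[OF compact_UNIV, of UNIV N]) (use N in auto)
  have Q_Un: "Q (X \<union> Z)" if XZ: "Q X" "open X" "Q Z" for X Z
  proof -
    obtain r1 where r1: "r1 > 0" "\<And>w. bounded_borel w \<Longrightarrow> (\<And>y. y \<notin> X \<Longrightarrow> w y = 0) \<Longrightarrow>
        line_extension \<mu> (\<lambda>u. D (inv_into U \<phi> u)) (\<phi> z0) r1 w"
      using XZ(1) unfolding Q_def by blast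
    obtain r2 where r2: "r2 > 0" "\<And>w. bounded_borel w \<Longrightarrow> (\<And>y. y \<notin> Z \<Longrightarrow> w y = 0) \<Longrightarrow>
        line_extension \<mu> (\<lambda>u. D (inv_into U \<phi> u)) (\<phi> z0) r2 w"
      using XZ(3) unfolding Q_def by blast
    have "line_extension \<mu> (\<lambda>u. D (inv_into U \<phi> u)) (\<phi> z0) (min r1 r2) w"
      if w: "bounded_borel w" "\<forall>y. y \<notin> X \<union> Z \<longrightarrow> w y = 0" for w
    proof -
      \<comment> \<open>Cutting sharply along the open set \<open>X\<close> suffices, since weights
        only have to be bounded and Borel, not continuous.\<close>
      define w1 where "w1 y = w y * indicator X y" for y
      define w2 where "w2 y = w y * indicator (- X) y" for y
      have b: "bounded_borel w1" "bounded_borel w2"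
        unfolding w1_def w2_def using w(1) XZ(2) by (auto intro!: bounded_borel_mult bounded_borel_indicator)
      have l1: "line_extension \<mu> (\<lambda>u. D (inv_into U \<phi> u)) (\<phi> z0) (min r1 r2) w1"
        by (rule line_extension_mono[OF r1(2)[OF b(1)]]) (auto simp: w1_def)
      have l2: "line_extension \<mu> (\<lambda>u. D (inv_into U \<phi> u)) (\<phi> z0) (min r1 r2) w2"
        by (rule line_extension_mono[OF r2(2)[OF b(2)]]) (use w(2) in \<open>auto simp: w2_def indicator_def\<close>)
      have w_eq: "w y * x = w1 y * x + w2 y * x" for x y
        by (simp add: w1_def w2_def indicator_def)
      have int_eq: "(\<integral>y. w y * D x y \<partial>\<mu>) = (\<integral>y. w1 y * D x y \<partial>\<mu>) + (\<integral>y. w2 y * D x y \<partial>\<mu>)" for x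
        unfolding w_eq using b by (intro Bochner_Integration.integral_add integrable_weight_D)
      show ?thesis
        unfolding line_extension_def int_eq
      proof (intro ballI)
        fix u1 u2 assume u: "u1 \<in> ball (\<phi> z0) (min r1 r2)" "u2 \<in> ball (\<phi> z0) (min r1 r2)"
        obtain G1 where G1: "G1 holomorphic_on ball 0 2" "\<And>t. \<bar>t\<bar> < 2 \<Longrightarrow>
            G1 (of_real t) = of_real (\<integral>y. w1 y * D (inv_into U \<phi> (u1 + t *\<^sub>R (u2 - u1))) y \<partial>\<mu>)"
          using l1 u unfolding line_extension_def by blast
        obtain G2 where G2: "G2 holomorphic_on ball 0 2" "\<And>t. \<bar>t\<bar> < 2 \<Longrightarrow>
            G2 (of_real t) = of_real (\<integral>y. w2 y * D (inv_into U \<phi> (u1 + t *\<^sub>R (u2 - u1))) y \<partial>\<mu>)"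
          using l2 u unfolding line_extension_def by blast
        show "\<exists>G. G holomorphic_on ball 0 2 \<and> (\<forall>t. \<bar>t\<bar> < 2 \<longrightarrow> G (of_real t) = of_real
            ((\<integral>y. w1 y * D (inv_into U \<phi> (u1 + t *\<^sub>R (u2 - u1))) y \<partial>\<mu>) +
             (\<integral>y. w2 y * D (inv_into U \<phi> (u1 + t *\<^sub>R (u2 - u1))) y \<partial>\<mu>)))"
          by (rule exI[of _ "\<lambda>z. G1 z + G2 z"]) (simp add: G1 G2 holomorphic_on_add)
      qed
    qed
    moreover have "min r1 r2 > 0"
      using r1(1) r2(1) by simp
    ultimately show ?thesis
      unfolding Q_def by blast
  qed
  have "Q {}"
    unfolding Q_def
    by (intro exI[of _ 1]) (auto simp: line_extension_def intro!: exI[of _ "\<lambda>_. 0"])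
  with Y(1) have "Q (\<Union>y\<in>Y. N y)"
    by (induction Y rule: finite_induct) (auto intro!: Q_Un N)
  moreover have "(\<Union>y\<in>Y. N y) = UNIV"
    using Y(2) by blast
  ultimately show ?thesis
    using that unfolding Q_def by auto
qed

text \<open>The interior of the level set is shown to be closed as well; connectedness then makes it
  the whole space.\<close>

theorem weighted_integral_identity:
  assumes conn: "connected (UNIV :: 'a set)" and w: "bounded_borel w"
    and O: "open O'" "O' \<noteq> {}" "\<And>x. x \<in> O' \<Longrightarrow> (\<integral>y. w y * D x y \<partial>\<mu>) = S"
  shows "(\<integral>y. w y * D x y \<partial>\<mu>) = S"
proof -
  define H where "H x = (\<integral>y. w y * D x y \<partial>\<mu>)" for x
  define Z where "Z = interior {x. H x = S}"
  have "O' \<subseteq> Z"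
    unfolding Z_def using O by (intro interior_maximal) (auto simp: H_def)
  then have "Z \<noteq> {}"
    using O(2) by blast
  moreover have "closed Z"
  proof -
    have "z0 \<in> Z" if z0: "z0 \<in> closure Z" for z0
    proof -
      obtain U \<phi> where U: "(U, \<phi>) \<in> B" "z0 \<in> U"
        using atlas_cover[OF atlas] by metis
      note chart = atlas_chart[OF atlas U(1)]
      obtain r1 where r1: "r1 > 0" "line_extension \<mu> (\<lambda>u. D (inv_into U \<phi> u)) (\<phi> z0) r1 w"
        using line_extension_chart[OF U] w by metis
      obtain r2 where r2: "r2 > 0" "ball (\<phi> z0) r2 \<subseteq> \<phi> ` U"
        using chart(2) U(2) openE by blast
      define r where "r = min r1 r2"
      have r: "r > 0" "ball (\<phi> z0) r \<subseteq> \<phi> ` U"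
        using r1(1) r2 by (auto simp: r_def)
      have ext: "line_extension \<mu> (\<lambda>u. D (inv_into U \<phi> u)) (\<phi> z0) r w"
        by (rule line_extension_mono[OF r1(2)]) (simp add: r_def)
      define V where "V = U \<inter> \<phi> -` ball (\<phi> z0) r"
      have V: "open V" "z0 \<in> V"
        using continuous_open_preimage[OF homeomorphism_cont1[OF chart(3)] chart(1) open_ball] U(2) r(1)
        by (auto simp: V_def)
      \<comment> \<open>The chart image of \<open>V\<close> is a ball, hence convex: every other
        point of \<open>V\<close> is joined to \<open>z1\<close> by a segment on which the function
        is constant near its start.\<close>
      obtain z1 where z1: "z1 \<in> V" "z1 \<in> Z"
        using z0 V by (auto simp: closure_iff_nhds_not_empty)
      have "H z2 = S" if z2: "z2 \<in> V" for z2
      proof -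
        have u: "\<phi> z1 \<in> ball (\<phi> z0) r" "\<phi> z2 \<in> ball (\<phi> z0) r" and UU: "z1 \<in> U" "z2 \<in> U"
          using z1(1) z2 by (auto simp: V_def)
        let ?l = "\<lambda>t. \<phi> z1 + t *\<^sub>R (\<phi> z2 - \<phi> z1)"
        obtain G where G: "G holomorphic_on ball 0 2" "\<And>t. \<bar>t\<bar> < 2 \<Longrightarrow> G (of_real t) = of_real (H (inv_into U \<phi> (?l t)))"
          using ext u unfolding line_extension_def H_def by blast
        have inv1: "inv_into U \<phi> (\<phi> z1) = z1" and inv2: "inv_into U \<phi> (\<phi> z2) = z2"
          using homeomorphism_apply1[OF chart(3)] UU by blast+
        have "isCont (inv_into U \<phi>) (\<phi> z1)"
          using homeomorphism_cont2[OF chart(3)] chart(2) UU(1) by (simp add: continuous_on_eq_continuous_at)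
        then have "(inv_into U \<phi> \<longlongrightarrow> z1) (nhds (\<phi> z1))"
          by (metis inv1 isCont_def tendsto_at_iff_tendsto_nhds)
        moreover have "(?l \<longlongrightarrow> \<phi> z1) (at 0)"
          by (auto intro!: tendsto_eq_intros)
        ultimately have "((\<lambda>t. inv_into U \<phi> (?l t)) \<longlongrightarrow> z1) (at 0)"
          by (rule filterlim_compose)
        then have "\<forall>\<^sub>F t in at 0. inv_into U \<phi> (?l t) \<in> Z"
          by (rule topological_tendstoD) (auto simp: Z_def z1(2)[unfolded Z_def])
        then obtain d where d: "d > 0" "\<And>t. t \<noteq> 0 \<Longrightarrow> \<bar>t\<bar> < d \<Longrightarrow> inv_into U \<phi> (?l t) \<in> Z"
          unfolding eventually_at by (auto simp: dist_real_def)
        \<comment> \<open>The limit at 0 controls only parameters different from 0; the remaining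
          real points still accumulate at 0, as the identity theorem requires.\<close>
        define X where "X = complex_of_real ` {t. t \<noteq> 0 \<and> \<bar>t\<bar> < min d 2}"
        have X0: "G z - of_real S = 0" if "z \<in> X" for z
        proof -
          obtain t where t: "z = of_real t" "t \<noteq> 0" "\<bar>t\<bar> < d" "\<bar>t\<bar> < 2"
            using \<open>z \<in> X\<close> by (auto simp: X_def)
          have "H (inv_into U \<phi> (?l t)) = S"
            using d(2)[OF t(2,3)] interior_subset unfolding Z_def by blast
          then show ?thesis
            using G(2)[OF t(4)] t(1) by simp
        qed
        have "0 islimpt X"
          unfolding islimpt_approachable
        proof (intro allI impI)
          fix e :: real assume "e > 0"
          define t where "t = min e (min d 2) / 2"
          have "t > 0" "t < e" "t < d" "t < 2"
            using \<open>e > 0\<close> d(1) by (auto simp: t_def)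
          then show "\<exists>x'\<in>X. x' \<noteq> 0 \<and> dist x' 0 < e"
            by (intro bexI[of _ "of_real t"]) (auto simp: X_def)
        qed
        then have "G 1 - of_real S = 0"
          by (intro analytic_continuation[of "\<lambda>z. G z - of_real S" "ball 0 2" X 0 1])
            (use X0 G(1) in \<open>auto intro!: holomorphic_intros simp: X_def\<close>)
        then show ?thesis
          using G(2)[of 1] inv2 by simp
      qed
      then have "V \<subseteq> Z"
        unfolding Z_def using V(1) by (intro interior_maximal) auto
      then show ?thesis
        using V(2) by blast
    qed
    then show ?thesis
      using closure_subset_eq by blast
  qed
  moreover have "open Z"
    by (simp add: Z_def)
  ultimately have "Z = UNIV"
    using conn unfolding connected_clopen by (auto simp: openin_open closedin_closed)
  then show ?thesis
    using interior_subset[of "{x. H x = S}"] unfolding Z_def H_def by blast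
qed

end


section \<open>Generic sign constancy\<close>

text \<open>Compact Hausdorff spaces are locally compact and regular, hence Baire spaces.\<close>

lemma baire_dense_Inter:
  fixes \<G> :: "'a::t2_space set set"
  assumes "compact (UNIV :: 'a set)" "countable \<G>" "\<And>T. T \<in> \<G> \<Longrightarrow> open T \<and> closure T = UNIV"
    and G: "open G" "G \<noteq> {}"
  obtains x where "x \<in> G" "\<And>T. T \<in> \<G> \<Longrightarrow> x \<in> T"
proof -
  have c: "compact_space (euclidean :: 'a topology)"
    using assms(1) by (simp add: compact_space_def)
  have h: "Hausdorff_space (euclidean :: 'a topology)"
    unfolding Hausdorff_space_def using hausdorff by (auto simp: disjnt_def)
  have "euclidean closure_of \<Inter>\<G> = topspace (euclidean :: 'a topology)"
  proof (rule Baire_category[OF disjI2 assms(2)])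
    show "locally_compact_space (euclidean :: 'a topology) \<and> regular_space (euclidean :: 'a topology)"
      using c h compact_imp_locally_compact_space compact_Hausdorff_imp_regular_space by blast
    show "openin euclidean T \<and> euclidean closure_of T = topspace euclidean" if "T \<in> \<G>" for T
    proof
      show "openin euclidean T"
        using assms(3)[OF that] by simp
      have "\<exists>y. y \<in> T \<and> y \<in> W" if "z \<in> W" "open W" for z W
        using open_Int_closure_eq_empty[OF that(2), of T] assms(3)[OF \<open>T \<in> \<G>\<close>] that(1) by auto
      then show "euclidean closure_of T = topspace euclidean"
        unfolding closure_of_def by auto
    qed
  qed
  then have dense: "euclidean closure_of \<Inter>\<G> = UNIV"
    by simp
  obtain z where z: "z \<in> G"
    using G(2) by auto
  have "z \<in> euclidean closure_of \<Inter>\<G>"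
    unfolding dense by (rule UNIV_I)
  moreover have "openin euclidean G"
    using G(1) by simp
  ultimately have "\<exists>x\<in>\<Inter>\<G>. x \<in> G"
    unfolding in_closure_of using z by blast
  then show ?thesis
    using that by blast
qed

text \<open>If \<open>y\<close> is outside one of the two closures, the corresponding strict sign is
  absent nearby. If it is in both but not in \<open>K_set D x\<close>, it is interior to one of the
  two sets and \<open>D x y\<close> has a strict sign.\<close>

lemma not_K_set_local_sign:
  assumes cont: "continuous_on UNIV (D x)" and y: "y \<notin> K_set D x"
  obtains s :: real and V where "s = 1 \<or> s = - 1" "open V" "y \<in> V" "\<And>z. z \<in> V \<Longrightarrow> 0 \<le> s * D x z"
proof -
  have o: "open {z. 0 < D x z}" "open {z. D x z < 0}"
    by (intro open_Collect_less cont continuous_intros)+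
  have "\<exists>s V. (s = 1 \<or> s = - 1) \<and> open V \<and> y \<in> V \<and> (\<forall>z\<in>V. 0 \<le> s * D x z)"
  proof (cases "y \<in> closure (I_set D x)")
    case False
    then show ?thesis
      using closure_subset[of "I_set D x"]
      by (intro exI[of _ "- 1"] exI[of _ "- closure (I_set D x)"]) (auto simp: I_set_def not_less[symmetric])
  next
    case yI: True
    show ?thesis
    proof (cases "y \<in> closure (UNIV - J_set D x)")
      case False
      then show ?thesis
        using closure_subset[of "UNIV - J_set D x"]
        by (intro exI[of _ 1] exI[of _ "- closure (UNIV - J_set D x)"]) (auto simp: J_set_def)
    next
      case True
      have "y \<in> interior (I_set D x) \<or> y \<in> interior (UNIV - J_set D x)"
        using y yI True unfolding K_set_def frontier_def by blast
      then have "0 < D x y \<or> D x y < 0"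
        using interior_subset by (fastforce simp: I_set_def J_set_def)
      then show ?thesis
      proof
        assume "0 < D x y"
        then show ?thesis
          using o by (intro exI[of _ 1] exI[of _ "{z. 0 < D x z}"]) auto
      next
        assume "D x y < 0"
        then show ?thesis
          using o by (intro exI[of _ "- 1"] exI[of _ "{z. D x z < 0}"]) auto
      qed
    qed
  qed
  then show ?thesis
    using that by blast
qed

text \<open>Sign constancy of \<open>D x\<close> near every point of \<open>S\<close> does not by itself control \<open>D z\<close> for \<open>z\<close> close to
  \<open>x\<close>. It does so for generic \<open>x\<close>: for a basic open set \<open>V\<close>, the points \<open>x\<close> with \<open>D x \<ge> 0\<close> on \<open>V\<close> form a
  closed set, whose frontier is nowhere dense and hence avoided by a point \<open>x\<close> provided by Baire's theorem.\<close>

lemma generic_sign_constancy: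
  fixes D :: "'a::{t2_space, second_countable_topology} \<Rightarrow> 'a \<Rightarrow> real"
  assumes comp: "compact (UNIV :: 'a set)" and cont: "continuous_on UNIV (\<lambda>(x, y). D x y)"
    and G: "open G" "G \<noteq> {}" and S: "closed S"
    and sign: "\<And>x y. x \<in> G \<Longrightarrow> y \<in> S \<Longrightarrow> y \<notin> K_set D x"
  obtains x U E where "x \<in> G" "open U" "x \<in> U" "U \<subseteq> G" "closed E"
    "\<And>z y. z \<in> U \<Longrightarrow> y \<in> S \<Longrightarrow> y \<in> E \<Longrightarrow> 0 \<le> D z y"
    "\<And>z y. z \<in> U \<Longrightarrow> y \<notin> E \<Longrightarrow> D z y \<le> 0"
    "\<And>y. y \<in> S \<Longrightarrow> y \<in> E \<Longrightarrow> y \<notin> closure (I_set D x) \<Longrightarrow> \<exists>W. open W \<and> x \<in> W \<and> (\<forall>z\<in>W. D z y = 0)"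
proof -
  obtain \<B> :: "'a set set" where \<B>: "countable \<B>" "topological_basis \<B>"
    using ex_countable_basis by blast
  define P where "P s V = {x. \<forall>y\<in>V. 0 \<le> s * D x y}" for s :: real and V
  have cont1: "continuous_on UNIV (\<lambda>x. D x y)" for y
    using continuous_on_slice_fst[of UNIV D y] cont by simp
  have cont2: "continuous_on UNIV (D x)" for x
    using continuous_on_slice[of UNIV D x] cont by simp
  have P: "closed (P s V)" for s V
  proof -
    have "P s V = (\<Inter>y\<in>V. {x. 0 \<le> s * D x y})"
      by (auto simp: P_def)
    then show ?thesis
      by (auto intro!: closed_Collect_le continuous_intros cont1)
  qed
  define \<G> where "\<G> = (\<Union>s\<in>{1, - 1}. (\<lambda>V. - frontier (P s V)) ` \<B>)"
  have c: "countable \<G>"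
    unfolding \<G>_def using \<B>(1) by (intro countable_UN countable_image) auto
  have d: "open T \<and> closure T = UNIV" if TG: "T \<in> \<G>" for T
  proof -
    obtain s V where T: "T = - frontier (P s V)"
      using TG by (auto simp: \<G>_def)
    \<comment> \<open>A closed set contains its frontier, so an interior point of the frontier would
      also be interior to the set, which the frontier excludes.\<close>
    have "interior (frontier (P s V)) \<subseteq> interior (P s V)"
      by (intro interior_mono frontier_subset_closed P)
    then have "interior (frontier (P s V)) = {}"
      using interior_subset[of "frontier (P s V)"] by (auto simp: frontier_def)
    then show ?thesis
      using open_Compl[OF frontier_closed] by (simp add: T closure_complement)
  qed
  obtain x where x: "x \<in> G" "\<And>T. T \<in> \<G> \<Longrightarrow> x \<in> T"
    by (rule baire_dense_Inter[OF comp c d G]) blast+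
  \<comment> \<open>This is the gain from genericity: a weak sign of \<open>D x\<close> on a basic
    open set persists for all points near \<open>x\<close>.\<close>
  have gen: "x \<in> interior (P s V)" if "s = 1 \<or> s = - 1" "V \<in> \<B>" "x \<in> P s V" for s V
  proof -
    have "- frontier (P s V) \<in> \<G>"
      using that(1,2) by (auto simp: \<G>_def)
    then have "x \<notin> frontier (P s V)"
      using x(2) by blast
    then show ?thesis
      using that(3) closure_subset by (auto simp: frontier_def)
  qed
  have "\<exists>s V. (s = 1 \<or> s = - 1) \<and> V \<in> \<B> \<and> y \<in> V \<and> x \<in> P s V" if y: "y \<in> S" for y
  proof -
    obtain s :: real and V0 where s: "s = 1 \<or> s = - 1" and V0: "open V0" "y \<in> V0" "\<And>z. z \<in> V0 \<Longrightarrow> 0 \<le> s * D x z"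
      by (rule not_K_set_local_sign[OF cont2 sign[OF x(1) y]]) blast
    obtain V where "V \<in> \<B>" "y \<in> V" "V \<subseteq> V0"
      using topological_basisE[OF \<B>(2) V0(1,2)] by blast
    then show ?thesis
      using s V0(3) by (intro exI[of _ s] exI[of _ V]) (auto simp: P_def)
  qed
  then obtain s V where sV: "\<And>y. y \<in> S \<Longrightarrow> s y = 1 \<or> s y = - 1" "\<And>y. y \<in> S \<Longrightarrow> V y \<in> \<B>"
      "\<And>y. y \<in> S \<Longrightarrow> y \<in> V y" "\<And>y. y \<in> S \<Longrightarrow> x \<in> P (s y) (V y)"
    by metis
  have "compact S"
    using compact_Int_closed[OF comp S] by simp
  then obtain Y where Y: "Y \<subseteq> S" "finite Y" "S \<subseteq> (\<Union>y\<in>Y. V y)"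
  proof (rule compactE_image[of S S V])
    show "open (V y)" if "y \<in> S" for y
      using topological_basis_open[OF \<B>(2) sV(2)[OF that]] .
    show "S \<subseteq> (\<Union>y\<in>S. V y)"
      using sV(3) by blast
  qed
  define U where "U = G \<inter> (\<Inter>y\<in>Y. interior (P (s y) (V y)))"
  \<comment> \<open>Removing every patch of negative sign leaves points of \<open>S\<close> that lie
    only in patches of positive sign; on overlaps of both kinds \<open>D\<close> vanishes, so the
    allocation is harmless.\<close>
  define E where "E = - (\<Union>y\<in>{y\<in>Y. s y = - 1}. V y)"
  show ?thesis
  proof (rule that[OF x(1)])
    show "open U"
      unfolding U_def using G(1) Y(2) by (intro open_Int open_INT) auto
    have "x \<in> interior (P (s y) (V y))" if "y \<in> Y" for y
      using gen[OF sV(1,2,4)] Y(1) that by (simp add: subset_iff)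
    then show xU: "x \<in> U"
      unfolding U_def using x(1) by simp
    show "U \<subseteq> G"
      by (simp add: U_def)
    show "closed E"
    proof -
      have "open (\<Union>y\<in>{y\<in>Y. s y = - 1}. V y)"
        using Y(1) sV(2) topological_basis_open[OF \<B>(2)] by (intro open_UN) auto
      then show ?thesis
        by (simp add: E_def closed_def)
    qed
    have UP: "0 \<le> s y' * D z y" if "z \<in> U" "y' \<in> Y" "y \<in> V y'" for z y y'
      using that interior_subset[of "P (s y') (V y')"] by (auto simp: U_def P_def)
    show pos: "0 \<le> D z y" if zU: "z \<in> U" and yS: "y \<in> S" and yE: "y \<in> E" for z y
    proof -
      obtain y' where y': "y' \<in> Y" "y \<in> V y'"
        using Y(3) yS by blast
      then have "s y' = 1"
        using yE sV(1) Y(1) by (auto simp: E_def)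
      then show ?thesis
        using UP[OF zU y'] by simp
    qed
    show "D z y \<le> 0" if zU: "z \<in> U" and yE: "y \<notin> E" for z y
    proof -
      obtain y' where y': "y' \<in> Y" "y \<in> V y'" "s y' = - 1"
        using yE by (auto simp: E_def)
      then show ?thesis
        using UP[OF zU y'(1,2)] by simp
    qed
    \<comment> \<open>Near \<open>y\<close> the sign of \<open>D x\<close> is nonpositive, and
      genericity carries this to nearby \<open>z\<close>. Together with the nonnegativity on
      \<open>E\<close> it forces zero.\<close>
    show "\<exists>W. open W \<and> x \<in> W \<and> (\<forall>z\<in>W. D z y = 0)"
      if y: "y \<in> S" "y \<in> E" "y \<notin> closure (I_set D x)" for y
    proof -
      obtain V' where V': "V' \<in> \<B>" "y \<in> V'" "V' \<subseteq> - closure (I_set D x)"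
        using topological_basisE[OF \<B>(2), of "- closure (I_set D x)" y] y(3) by blast
      then have "x \<in> P (- 1) V'"
        using closure_subset[of "I_set D x"] by (auto simp: P_def I_set_def not_less[symmetric])
      then have xW: "x \<in> U \<inter> interior (P (- 1) V')"
        using gen[of "- 1" V'] V'(1) xU by simp
      have "D z y = 0" if "z \<in> U \<inter> interior (P (- 1) V')" for z
        using pos[of z y] y that interior_subset[of "P (- 1) V'"] V'(2) by (force simp: P_def)
      then show ?thesis
        using xW \<open>open U\<close> by (intro exI[of _ "U \<inter> interior (P (- 1) V')"]) auto
    qed
  qed
qed

lemma kernel_continuous:
  fixes A :: "('a::t2_space, 'e::euclidean_space) chart set"
  assumes A: "manifold_atlas Q A" and D: "kernel_of_class smooth_on A D"
  shows "continuous_on UNIV (\<lambda>(x, y). D x y)"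
proof -
  have "isCont (\<lambda>(x, y). D x y) p" for p
  proof -
    obtain U \<phi> where U: "(U, \<phi>) \<in> A" "fst p \<in> U"
      using atlas_cover[OF A] by metis
    obtain V \<psi> where V: "(V, \<psi>) \<in> A" "snd p \<in> V"
      using atlas_cover[OF A] by metis
    note cU = atlas_chart[OF A U(1)] and cV = atlas_chart[OF A V(1)]
    let ?f = "\<lambda>(u, v). D (inv_into U \<phi> u) (inv_into V \<psi> v)"
    have "smooth_on (\<phi> ` U \<times> \<psi> ` V) ?f"
      using D U(1) V(1) unfolding kernel_of_class_def by blast
    then have c: "continuous_on (\<phi> ` U \<times> \<psi> ` V) ?f"
      unfolding smooth_on_def by (blast intro: Ck_on_imp_continuous_on)
    have "continuous_on (U \<times> V) (\<lambda>p. (\<phi> (fst p), \<psi> (snd p)))"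
      using homeomorphism_cont1[OF cU(3)] homeomorphism_cont1[OF cV(3)]
      by (auto intro!: continuous_on_Pair continuous_on_compose2[of U \<phi> "U \<times> V" fst]
          continuous_on_compose2[of V \<psi> "U \<times> V" snd] continuous_on_fst continuous_on_snd)
    then have "continuous_on (U \<times> V) (\<lambda>p. ?f (\<phi> (fst p), \<psi> (snd p)))"
      by (rule continuous_on_compose2[OF c]) auto
    then have "continuous_on (U \<times> V) (\<lambda>(x, y). D x y)"
      by (rule continuous_on_eq) (use homeomorphism_apply1[OF cU(3)] homeomorphism_apply1[OF cV(3)] in auto)
    moreover have o: "open (U \<times> V)" and p: "p \<in> U \<times> V"
      using cU(1) cV(1) U(2) V(2) by (auto simp: mem_Times_iff intro: open_Times)
    ultimately show ?thesis
      unfolding continuous_on_eq_continuous_at[OF o] by blast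
  qed
  then show ?thesis
    by (simp add: continuous_at_imp_continuous_on)
qed

section \<open>From minimizers on the manifold to the abstract kernel\<close>

lemma minimizer_minimizing_kernel:
  fixes D :: "'a::{t2_space, second_countable_topology} \<Rightarrow> 'a \<Rightarrow> real"
  assumes "compact (UNIV :: 'a set)" and cont: "continuous_on UNIV (\<lambda>(x, y). D x y)"
    and sym: "\<And>x y. D x y = D y x" and min: "minimizer D \<rho>"
  shows "minimizing_kernel \<rho> (lagrangian D)"
proof -
  have reg: "\<rho> \<in> regular_prob_measures"
    using min by (simp add: minimizer_def)
  then have sets: "sets \<rho> = sets borel" and one: "emeasure \<rho> UNIV = 1"
    unfolding regular_prob_measures_def by blast+
  have space: "space \<rho> = UNIV"
    using sets_eq_imp_space_eq[OF sets] by simp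
  interpret prob_space \<rho>
    by standard (simp add: one space)
  have "continuous_on UNIV (\<lambda>p. max 0 ((\<lambda>(x, y). D x y) p))"
    by (intro continuous_intros cont)
  then have "continuous_on UNIV (\<lambda>(x, y). lagrangian D x y)"
    by (simp add: lagrangian_def[abs_def] case_prod_unfold)
  moreover have "action D \<rho> \<le> action D \<nu>" if "\<nu> \<in> regular_prob_measures" for \<nu> :: "'a measure"
  proof -
    \<comment> \<open>The infimum is taken in the reals, so it is a lower bound only because the
      actions are bounded below.\<close>
    have "bdd_below (action D ` regular_prob_measures)"
      by (rule bdd_belowI2[of _ 0]) (simp add: action_def lagrangian_def)
    then show ?thesis
      using min that cINF_lower[of "action D" regular_prob_measures \<nu>] by (simp add: minimizer_def)
  qed
  ultimately show ?thesis
    by unfold_locales (use assms(1) sets reg sym in \<open>auto simp: action_def lagrangian_def\<close>)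
qed

lemma open_positive_measure:
  assumes "sets \<rho> = sets borel" "open W" "AE y in \<rho>. y \<notin> W" "y \<in> W"
  shows "y \<notin> supp \<rho>"
proof -
  have "{y \<in> space \<rho>. \<not> y \<notin> W} = W"
    using sets_eq_imp_space_eq[OF assms(1)] by auto
  then have "emeasure \<rho> W = 0"
    using assms(1-3) AE_iff_measurable[of W \<rho> "\<lambda>y. y \<notin> W"] by simp
  then show ?thesis
    using assms(2,4) by (auto simp: supp_def)
qed

section \<open>Sign changes along the given curves and the representation by a fixed set\<close>

locale symmetric_kernel =
  fixes A :: "('a::{t2_space, second_countable_topology}, 'e::euclidean_space) chart set"
    and D :: "'a \<Rightarrow> 'a \<Rightarrow> real" and T :: "'a \<Rightarrow> 'a \<Rightarrow> real set" and c :: "'a \<Rightarrow> 'a \<Rightarrow> real \<Rightarrow> 'a"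
  assumes atlas: "manifold_atlas smooth_on A" and compact_UNIV: "compact (UNIV :: 'a set)"
    and kernel: "kernel_of_class smooth_on A D"
    and D_sym: "\<And>x y. D x y = D y x" and D_pos: "\<And>x. D x x > 0"
    and curve: "\<And>x y. y \<in> K_set D x \<Longrightarrow>
           smooth_curve_joining A x y (T x y) (c x y) \<and>
           locally_translation_symmetric D x (T x y) (c x y) \<and>
           changes_sign_at_0 (\<lambda>t. D (c x y t) y)"
begin

lemma continuous_D: "continuous_on UNIV (\<lambda>(x, y). D x y)"
  by (rule kernel_continuous[OF atlas kernel])

lemma continuous_D_left: "continuous_on UNIV (\<lambda>x. D x y)"
  using continuous_on_slice_fst[of UNIV D y] continuous_D by simp

lemma continuous_D_right: "continuous_on UNIV (D x)"
  using continuous_on_slice[of UNIV D x] continuous_D by simp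

lemma curve_basic:
  assumes "y \<in> K_set D x"
  shows "open (T x y)" "0 \<in> T x y" "continuous_on (T x y) (c x y)" "c x y 0 = x"
  using curve[OF assms] unfolding smooth_curve_joining_def curve_of_class_def by blast+

lemma curve_near_0:
  assumes "y \<in> K_set D x" "open O'" "x \<in> O'"
  obtains e where "e > 0" "\<And>t. \<bar>t\<bar> < e \<Longrightarrow> t \<in> T x y \<and> c x y t \<in> O'"
proof -
  note b = curve_basic[OF assms(1)]
  have "open (T x y \<inter> c x y -` O')"
    using continuous_open_preimage[OF b(3,1) assms(2)] .
  moreover have "0 \<in> T x y \<inter> c x y -` O'"
    using b assms(3) by simp
  ultimately obtain e where "e > 0" "ball 0 e \<subseteq> T x y \<inter> c x y -` O'"
    using openE by blast
  then show ?thesis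
    by (intro that[of e]) (auto simp: subset_iff)
qed

lemma isCont_D_curve:
  assumes "y \<in> K_set D x"
  shows "isCont (\<lambda>t. D (c x y t) y) 0"
proof -
  note b = curve_basic[OF assms]
  have "continuous_on (T x y) (\<lambda>t. D (c x y t) y)"
    by (rule continuous_on_compose2[OF continuous_D_left b(3)]) auto
  then show ?thesis
    using b(1,2) by (simp add: continuous_on_eq_continuous_at)
qed

lemma K_set_disjoint_supp:
  assumes min: "minimizer D \<rho>" and x: "x \<in> interior (supp \<rho>)" and y: "y \<in> supp \<rho>"
    and K: "y \<in> K_set D x" and lead: "a \<noteq> 0" "((\<lambda>t. D (c x y t) y / t ^ n) \<longlongrightarrow> a) (at 0)"
  shows False
proof -
  interpret minimizing_kernel \<rho> "lagrangian D"
    by (rule minimizer_minimizing_kernel[OF compact_UNIV continuous_D D_sym min])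
  obtain e0 f where e0: "e0 > 0" and f: "smooth_on {-2*e0<..<2*e0} f"
    "\<And>t t'. t \<in> {-e0<..<e0} \<Longrightarrow> t' \<in> {-e0<..<e0} \<Longrightarrow> D (c x y t) (c x y t') = f (t - t')"
    using curve[OF K] unfolding locally_translation_symmetric_def by blast
  have "open {p. 0 < (\<lambda>(x, y). D x y) p}"
    by (intro open_Collect_less continuous_D continuous_intros)
  moreover have "(x, x) \<in> {p. 0 < (\<lambda>(x, y). D x y) p}"
    using D_pos by simp
  ultimately obtain O1 O2 where O12: "open O1" "open O2" "(x, x) \<in> O1 \<times> O2"
      "O1 \<times> O2 \<subseteq> {p. 0 < (\<lambda>(x, y). D x y) p}"
    by (rule open_prod_elim)
  \<comment> \<open>Near \<open>x\<close> the kernel is positive, so on the curve \<open>L\<close>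
    coincides with \<open>D\<close> and inherits its translation symmetry; the interior of the
    support keeps the sample points admissible.\<close>
  define O' where "O' = O1 \<inter> O2 \<inter> interior (supp \<rho>)"
  have "open O'" "x \<in> O'"
    using O12 x by (auto simp: O'_def)
  then obtain e1 where e1: "e1 > 0" "\<And>t. \<bar>t\<bar> < e1 \<Longrightarrow> t \<in> T x y \<and> c x y t \<in> O'"
    by (rule curve_near_0[OF K]) blast
  define e where "e = min e0 e1"
  have e: "e > 0" "e \<le> e0" "e \<le> e1"
    using e0 e1(1) by (auto simp: e_def)
  show False
  proof (rule no_sign_change_along_symmetric_curve[where q="c x y" and g="\<lambda>t. D (c x y t) y" and f=f and e=e and y=y and p=n and a=a])
    show "c x y t \<in> supp \<rho>" if "\<bar>t\<bar> < e" for t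
      using e1(2)[of t] that e(3) interior_subset by (fastforce simp: O'_def)
    show "0 < lagrangian D y y"
      using D_pos by (simp add: lagrangian_def)
    show "smooth_on {-2*e<..<2*e} f"
    proof -
      have "{-2*e<..<2*e} \<subseteq> {-2*e0<..<2*e0}"
        using e(2) by auto
      then show ?thesis
        using f(1) Ck_on_subset unfolding smooth_on_def by blast
    qed
    show "lagrangian D (c x y t) (c x y t') = f (t - t')" if "\<bar>t\<bar> < e" "\<bar>t'\<bar> < e" for t t'
    proof -
      have "0 < D (c x y t) (c x y t')"
        using e1(2)[of t] e1(2)[of t'] that e(3) O12(4) by (auto simp: O'_def)
      moreover have "D (c x y t) (c x y t') = f (t - t')"
        using that e(2) by (intro f(2)) auto
      ultimately show ?thesis
        by (simp add: lagrangian_def)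
    qed
    show "lagrangian D (c x y t) y = max 0 (D (c x y t) y)" for t
      by (simp add: lagrangian_def)
    show "changes_sign_at_0 (\<lambda>t. D (c x y t) y)"
      using curve[OF K] by blast
  qed (use e(1) y lead isCont_D_curve[OF K] in auto)
qed

text \<open>On \<open>U\<close> the Euler-Lagrange equations become linear in \<open>D\<close> with
  a weight independent of \<open>z\<close>, which makes differentiation and analytic continuation
  available.\<close>

lemma generic_representation:
  assumes min: "minimizer D \<rho>" and ne: "interior (supp \<rho>) \<noteq> {}"
    and lead: "\<And>x y. y \<in> K_set D x \<Longrightarrow> \<exists>n a. a \<noteq> 0 \<and> ((\<lambda>t. D (c x y t) y / t ^ n) \<longlongrightarrow> a) (at 0)"
  obtains x U E S where "open U" "x \<in> U" "U \<subseteq> supp \<rho>" "closed E"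
    "\<And>y. y \<notin> E \<Longrightarrow> D x y \<le> 0"
    "\<And>y. y \<in> supp \<rho> \<Longrightarrow> y \<in> E \<Longrightarrow> y \<notin> closure (I_set D x) \<Longrightarrow> \<exists>W. open W \<and> x \<in> W \<and> (\<forall>z\<in>W. D z y = 0)"
    "\<And>z. z \<in> U \<Longrightarrow> (\<integral>y. indicator E y * D z y \<partial>\<rho>) = S"
    "\<And>z. z \<in> supp \<rho> \<Longrightarrow> (\<integral>y. lagrangian D z y \<partial>\<rho>) = S"
proof -
  interpret minimizing_kernel \<rho> "lagrangian D"
    by (rule minimizer_minimizing_kernel[OF compact_UNIV continuous_D D_sym min])
  have noK: "y \<notin> K_set D x" if "x \<in> interior (supp \<rho>)" "y \<in> supp \<rho>" for x y
    using K_set_disjoint_supp[OF min that] lead by blast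
  obtain x U E where UE: "x \<in> interior (supp \<rho>)" "open U" "x \<in> U" "U \<subseteq> interior (supp \<rho>)" "closed E"
    and pos: "\<And>z y. z \<in> U \<Longrightarrow> y \<in> supp \<rho> \<Longrightarrow> y \<in> E \<Longrightarrow> 0 \<le> D z y"
    and neg: "\<And>z y. z \<in> U \<Longrightarrow> y \<notin> E \<Longrightarrow> D z y \<le> 0"
    and zero: "\<And>y. y \<in> supp \<rho> \<Longrightarrow> y \<in> E \<Longrightarrow> y \<notin> closure (I_set D x) \<Longrightarrow> \<exists>W. open W \<and> x \<in> W \<and> (\<forall>z\<in>W. D z y = 0)"
    by (rule generic_sign_constancy[OF compact_UNIV continuous_D open_interior ne closed_supp noK]) blast+
  have Us: "U \<subseteq> supp \<rho>"
    using UE(4) interior_subset by blast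
  have rep: "(\<integral>y. indicator E y * D z y \<partial>\<rho>) = S" if z: "z \<in> U" for z
  proof -
    have "(\<integral>y. indicator E y * D z y \<partial>\<rho>) = ell z"
      unfolding ell_def
    proof (rule integral_cong_AE)
      show "AE y in \<rho>. indicator E y * D z y = lagrangian D z y"
        using AE_supp[OF sets]
      proof eventually_elim
        case (elim y)
        then show ?case
          using pos[OF z elim] neg[OF z] by (cases "y \<in> E") (auto simp: lagrangian_def)
      qed
      have "bounded_borel (\<lambda>y. indicator E y * D z y)"
        using UE(5) by (intro bounded_borel_mult bounded_borel_indicator bounded_borel_continuous[OF compact_UNIV continuous_D_right]) auto
      then show "(\<lambda>y. indicator E y * D z y) \<in> borel_measurable \<rho>"
        by (simp add: bounded_borel_def cong: measurable_cong_sets)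
      show "lagrangian D z \<in> borel_measurable \<rho>"
        using bounded_borel_slice[of z] by (simp add: bounded_borel_def cong: measurable_cong_sets)
    qed
    then show ?thesis
      using ell_eq_S z Us by auto
  qed
  show ?thesis
  proof (rule that[OF UE(2,3) Us UE(5)])
    show "(\<integral>y. indicator E y * D z y \<partial>\<rho>) = S" if "z \<in> U" for z
      by (rule rep[OF that])
    show "D x y \<le> 0" if "y \<notin> E" for y
      by (rule neg[OF UE(3) that])
    show "\<exists>W. open W \<and> x \<in> W \<and> (\<forall>z\<in>W. D z y = 0)"
      if "y \<in> supp \<rho>" "y \<in> E" "y \<notin> closure (I_set D x)" for y
      by (rule zero[OF that])
    show "(\<integral>y. lagrangian D z y \<partial>\<rho>) = S" if "z \<in> supp \<rho>" for z
      using ell_eq_S[OF that] by (simp add: ell_def)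
  qed
qed

lemma analytic_leading_term:
  assumes B: "manifold_atlas real_analytic_on B" "kernel_of_class real_analytic_on B D"
    and K: "y \<in> K_set D x" and d: "d > 0" "curve_of_class real_analytic_on B {-d<..<d} (c x y)"
  shows "\<exists>n a. a \<noteq> 0 \<and> ((\<lambda>t. D (c x y t) y / t ^ n) \<longlongrightarrow> a) (at 0)"
proof -
  obtain U \<phi> where U: "(U, \<phi>) \<in> B" "x \<in> U"
    using atlas_cover[OF B(1)] by metis
  obtain V \<psi> where V: "(V, \<psi>) \<in> B" "y \<in> V"
    using atlas_cover[OF B(1)] by metis
  note b = curve_basic[OF K]
  have "real_analytic_on {t \<in> {-d<..<d}. c x y t \<in> U} (\<phi> \<circ> c x y)"
    using d(2) U(1) unfolding curve_of_class_def by blast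
  moreover have "0 \<in> {t \<in> {-d<..<d}. c x y t \<in> U}"
    using d(1) b(4) U(2) by simp
  ultimately obtain R \<Gamma> where R: "R > 0" and \<Gamma>: "\<And>b. \<Gamma> b holomorphic_on ball 0 R"
      "\<And>b t. \<bar>t\<bar> < R \<Longrightarrow> \<Gamma> b (of_real t) = of_real ((\<phi> \<circ> c x y) t \<bullet> b)"
    by (rule real_analytic_curve_holomorphic) blast
  define \<gamma> where "\<gamma> t = (\<phi> (c x y t), \<psi> y)" for t
  define \<Gamma>' where "\<Gamma>' b z = \<Gamma> (fst b) z + of_real (\<psi> y \<bullet> snd b)" for b z
  define F where "F = (\<lambda>(u, v). D (inv_into U \<phi> u) (inv_into V \<psi> v))"
  have F: "real_analytic_on (\<phi> ` U \<times> \<psi> ` V) F"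
    using B(2) U(1) V(1) unfolding kernel_of_class_def F_def by blast
  have \<gamma>0: "\<gamma> 0 \<in> \<phi> ` U \<times> \<psi> ` V"
    using U(2) V(2) b(4) by (simp add: \<gamma>_def)
  obtain R' G where R': "R' > 0" and G: "G holomorphic_on ball 0 R'"
      "\<And>t. \<bar>t\<bar> < R' \<Longrightarrow> G (of_real t) = of_real (F (\<gamma> t))"
  proof (rule real_analytic_compose_curve_holomorphic[where \<gamma>=\<gamma> and \<Gamma>=\<Gamma>', OF F \<gamma>0 R])
    show "\<Gamma>' b holomorphic_on ball 0 R" for b
      unfolding \<Gamma>'_def by (intro holomorphic_intros \<Gamma>)
    show "\<Gamma>' b (of_real t) = of_real (\<gamma> t \<bullet> b)" if "\<bar>t\<bar> < R" for b t
      using \<Gamma>(2)[OF that] by (simp add: \<Gamma>'_def \<gamma>_def inner_prod_def)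
  qed auto
  obtain e where e: "e > 0" "\<And>t. \<bar>t\<bar> < e \<Longrightarrow> t \<in> T x y \<and> c x y t \<in> U"
    by (rule curve_near_0[OF K atlas_chart(1)[OF B(1) U(1)] U(2)]) blast
  define r where "r = min R' e"
  have r: "r > 0" "r \<le> R'" "r \<le> e"
    using R' e(1) by (auto simp: r_def)
  have G': "G (of_real t) = of_real (D (c x y t) y)" if "\<bar>t\<bar> < r" for t
    using G(2)[of t] e(2)[of t] that r homeomorphism_apply1[OF atlas_chart(3)[OF B(1) U(1)]]
      homeomorphism_apply1[OF atlas_chart(3)[OF B(1) V(1)] V(2)]
    by (simp add: F_def \<gamma>_def)
  \<comment> \<open>The sign change supplies a nonzero value arbitrarily close to 0, so the analytic
    function cannot vanish identically.\<close>
  obtain t0 where t0: "\<bar>t0\<bar> < r" "D (c x y t0) y > 0"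
    using curve[OF K] r(1) unfolding changes_sign_at_0_def by blast
  have hol: "G holomorphic_on ball 0 r"
    by (rule holomorphic_on_subset[OF G(1) subset_ball[OF r(2)]])
  obtain n a where "a \<noteq> 0" "((\<lambda>t. D (c x y t) y / t ^ n) \<longlongrightarrow> a) (at 0)"
    by (rule holomorphic_leading_term[OF r(1) hol G' t0(1)]) (use t0(2) in auto)
  then show ?thesis
    by blast
qed

lemma smooth_fst_chart:
  assumes "(U, \<phi>) \<in> A"
  shows "smooth_fst (\<phi> ` U) (\<lambda>u y. D (inv_into U \<phi> u) y)"
  unfolding smooth_fst_def
proof
  fix k
  show "Ck_fst k (\<phi> ` U) (\<lambda>u y. D (inv_into U \<phi> u) y)"
  proof (rule Ck_fst_chartwise[OF atlas atlas_chart(2)[OF atlas assms]])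
    fix V \<psi> assume "(V, \<psi>) \<in> A"
    then show "Ck_on k (\<phi> ` U \<times> \<psi> ` V) (\<lambda>(u, v). D (inv_into U \<phi> u) (inv_into V \<psi> v))"
      using kernel assms unfolding kernel_of_class_def smooth_on_def by blast
  qed
qed

lemma smooth_leading_term:
  assumes K: "y \<in> K_set D x" and p: "(deriv ^^ p) (\<lambda>t. D (c x y t) y) 0 \<noteq> 0"
  shows "\<exists>n a. a \<noteq> 0 \<and> ((\<lambda>t. D (c x y t) y / t ^ n) \<longlongrightarrow> a) (at 0)"
proof -
  obtain U \<phi> where U: "(U, \<phi>) \<in> A" "x \<in> U"
    using atlas_cover[OF atlas] by metis
  note b = curve_basic[OF K] and ch = atlas_chart[OF atlas U(1)]
  define T' where "T' = {t \<in> T x y. c x y t \<in> U}"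
  have T': "open T'" "0 \<in> T'"
  proof -
    have "T' = T x y \<inter> c x y -` U"
      by (auto simp: T'_def)
    then show "open T'" "0 \<in> T'"
      using continuous_open_preimage[OF b(3,1) ch(1)] b(2,4) U(2) by auto
  qed
  have sm: "smooth_on T' (\<phi> \<circ> c x y)"
    using curve[OF K] U(1) unfolding smooth_curve_joining_def curve_of_class_def T'_def by blast
  have "smooth_on T' (\<lambda>t. D (c x y t) y)"
    unfolding smooth_on_def
  proof
    fix k
    have "Ck_on k (\<phi> ` U) (\<lambda>u. D (inv_into U \<phi> u) y)"
      using smooth_fst_chart[OF U(1)] Ck_fst_imp_Ck_on[of k "\<phi> ` U" "\<lambda>u y. D (inv_into U \<phi> u) y" y]
      by (simp add: smooth_fst_def)
    moreover have "Ck_on k T' (\<lambda>t. \<phi> (c x y t))"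
      using sm by (simp add: smooth_on_def o_def)
    ultimately have "Ck_on k T' (\<lambda>t. D (inv_into U \<phi> (\<phi> (c x y t))) y)"
      by (intro Ck_on_compose[OF ch(2) T'(1)]) (auto simp: T'_def)
    moreover have "D (inv_into U \<phi> (\<phi> (c x y t))) y = D (c x y t) y" if "t \<in> T'" for t
      using that homeomorphism_apply1[OF ch(3)] by (simp add: T'_def)
    then have "Ck_on k T' (\<lambda>t. D (inv_into U \<phi> (\<phi> (c x y t))) y) \<longleftrightarrow> Ck_on k T' (\<lambda>t. D (c x y t) y)"
      by (rule Ck_on_cong[OF T'(1)])
    ultimately show "Ck_on k T' (\<lambda>t. D (c x y t) y)"
      by (rule rev_iffD1)
  qed
  from smooth_on_leading_term[OF T' this p] show ?thesis
    by metis
qed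

end


section \<open>The two cases of the theorem\<close>

context symmetric_kernel
begin

text \<open>Continuation spreads the representation by \<open>E\<close> to the whole manifold,
  although the sign information behind \<open>E\<close> is available only on
  \<open>U\<close>.\<close>

lemma analytic_case:
  assumes conn: "connected (UNIV :: 'a set)"
    and B: "manifold_atlas real_analytic_on B" "kernel_of_class real_analytic_on B D"
    and an: "\<And>x y. y \<in> K_set D x \<Longrightarrow> \<exists>d>0. curve_of_class real_analytic_on B {-d<..<d} (c x y)"
    and min: "minimizer D \<rho>" and ne: "interior (supp \<rho>) \<noteq> {}"
  shows "generically_timelike D \<rho>"
proof -
  interpret minimizing_kernel \<rho> "lagrangian D"
    by (rule minimizer_minimizing_kernel[OF compact_UNIV continuous_D D_sym min])
  have lead: "\<exists>n a. a \<noteq> 0 \<and> ((\<lambda>t. D (c x y t) y / t ^ n) \<longlongrightarrow> a) (at 0)" if "y \<in> K_set D x" for x y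
    using an[OF that] analytic_leading_term[OF B that] by blast
  obtain x U E k where U: "open U" "x \<in> U" and E: "closed E"
    and rep: "\<And>z. z \<in> U \<Longrightarrow> (\<integral>y. indicator E y * D z y \<partial>\<rho>) = k"
    and EL: "\<And>z. z \<in> supp \<rho> \<Longrightarrow> (\<integral>y. lagrangian D z y \<partial>\<rho>) = k"
    by (rule generic_representation[OF min ne lead]) blast+
  have bE: "bounded_borel (indicator E :: 'a \<Rightarrow> real)"
    using E by (intro bounded_borel_indicator) auto
  have bD: "bounded_borel (D z)" for z
    by (rule bounded_borel_continuous[OF compact_UNIV continuous_D_right])
  interpret an: analytic_kernel B D \<rho>
    by unfold_locales (use B compact_UNIV continuous_D sets finite_measure_axioms in auto)
  have rep': "(\<integral>y. indicator E y * D z y \<partial>\<rho>) = k" for z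
    by (rule an.weighted_integral_identity[OF conn bE U(1) _ rep]) (use U(2) in auto)
  \<comment> \<open>The positive part of \<open>D\<close> dominates \<open>D\<close> restricted to
    \<open>E\<close>. Both have integral \<open>k\<close> when \<open>z\<close> is in the support,
    so they agree almost everywhere.\<close>
  have eq: "AE y in \<rho>. lagrangian D z y = indicator E y * D z y" if z: "z \<in> supp \<rho>" for z
  proof -
    have i: "integrable \<rho> (lagrangian D z)" "integrable \<rho> (\<lambda>y. indicator E y * D z y)"
      using bounded_borel_slice bounded_borel_mult[OF bE bD] by auto
    have "(\<integral>y. lagrangian D z y - indicator E y * D z y \<partial>\<rho>) = 0"
      using i EL[OF z] rep'[of z] by simp
    moreover have "0 \<le> lagrangian D z y - indicator E y * D z y" for y
      by (simp add: lagrangian_def indicator_def)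
    ultimately have "AE y in \<rho>. lagrangian D z y - indicator E y * D z y = 0"
      using integral_nonneg_eq_0_iff_AE[OF Bochner_Integration.integrable_diff[OF i]] by simp
    then show ?thesis
      by eventually_elim simp
  qed
  have AE_E: "AE y in \<rho>. y \<in> E"
    using AE_supp[OF sets]
  proof eventually_elim
    case (elim y)
    show "y \<in> E"
    proof (rule ccontr)
      assume y: "y \<notin> E"
      \<comment> \<open>Positivity on the diagonal makes this a neighborhood of \<open>y\<close>. On
        it the Lagrangian is positive while the restriction to \<open>E\<close> is zero, so
        \<open>eq\<close> makes it null.\<close>
      define W where "W = {z. 0 < D y z} \<inter> - E"
      have "open W"
        unfolding W_def using E by (intro open_Int open_Collect_less continuous_D_right continuous_intros) auto
      moreover have "y \<in> W"
        using D_pos y by (simp add: W_def)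
      moreover have "AE z in \<rho>. z \<notin> W"
        using eq[OF elim] by eventually_elim (auto simp: W_def lagrangian_def indicator_def split: if_splits)
      ultimately show False
        using open_positive_measure[OF sets] elim by blast
    qed
  qed
  have "0 \<le> D z y" if z: "z \<in> supp \<rho>" and y: "y \<in> supp \<rho>" for z y
  proof (rule ccontr)
    assume neg: "\<not> 0 \<le> D z y"
    \<comment> \<open>Almost every point lies in \<open>E\<close>, so \<open>eq\<close> says that
      \<open>D z\<close> equals its positive part almost everywhere and this open set is
      null.\<close>
    define W where "W = {y. D z y < 0}"
    have "open W"
      unfolding W_def by (intro open_Collect_less continuous_D_right continuous_intros)
    moreover have "y \<in> W"
      using neg by (simp add: W_def)
    moreover have "AE y in \<rho>. y \<notin> W"
      using eq[OF z] AE_E by eventually_elim (auto simp: W_def lagrangian_def indicator_def split: if_splits)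
    ultimately show False
      using open_positive_measure[OF sets] y by blast
  qed
  moreover have "(\<integral>y. D z y \<partial>\<rho>) = k" for z
  proof -
    have "(\<integral>y. D z y \<partial>\<rho>) = (\<integral>y. indicator E y * D z y \<partial>\<rho>)"
    proof (rule integral_cong_AE)
      show "AE y in \<rho>. D z y = indicator E y * D z y"
        using AE_E by eventually_elim simp
    qed (use bD[of z] bounded_borel_mult[OF bE bD[of z]] in \<open>auto simp: bounded_borel_def cong: measurable_cong_sets\<close>)
    then show ?thesis
      using rep' by simp
  qed
  ultimately show ?thesis
    using min unfolding generically_timelike_def by blast
qed

lemma smooth_case:
  assumes \<Delta>: "differential_operator A \<Delta>" "\<And>k. \<Delta> (\<lambda>_. k) = (\<lambda>_. 0)"
      "\<And>x y. y \<in> I_set D x \<Longrightarrow> \<Delta> (\<lambda>z. D z y) x < 0"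
    and p: "\<And>x y. y \<in> K_set D x \<Longrightarrow> \<exists>p. (deriv ^^ p) (\<lambda>t. D (c x y t) y) 0 \<noteq> 0"
    and min: "minimizer D \<rho>"
  shows "interior (supp \<rho>) = {}"
proof (rule ccontr)
  assume ne: "interior (supp \<rho>) \<noteq> {}"
  interpret minimizing_kernel \<rho> "lagrangian D"
    by (rule minimizer_minimizing_kernel[OF compact_UNIV continuous_D D_sym min])
  have lead: "\<exists>n a. a \<noteq> 0 \<and> ((\<lambda>t. D (c x y t) y / t ^ n) \<longlongrightarrow> a) (at 0)" if "y \<in> K_set D x" for x y
    using p[OF that] smooth_leading_term[OF that] by blast
  obtain x W E k where W: "open W" "x \<in> W" "W \<subseteq> supp \<rho>" and E: "closed E"
    and neg: "\<And>y. y \<notin> E \<Longrightarrow> D x y \<le> 0"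
    and zero: "\<And>y. y \<in> supp \<rho> \<Longrightarrow> y \<in> E \<Longrightarrow> y \<notin> closure (I_set D x) \<Longrightarrow> \<exists>W. open W \<and> x \<in> W \<and> (\<forall>z\<in>W. D z y = 0)"
    and rep: "\<And>z. z \<in> W \<Longrightarrow> (\<integral>y. indicator E y * D z y \<partial>\<rho>) = k"
    by (rule generic_representation[OF min ne lead]) blast+
  obtain U \<phi> where U: "(U, \<phi>) \<in> A" "x \<in> U"
    using atlas_cover[OF atlas] by metis
  note ch = atlas_chart[OF atlas U(1)]
  obtain n :: nat and a :: "'e list \<Rightarrow> 'e \<Rightarrow> real" where \<Delta>_eq: "\<And>f. smooth_fun A f \<Longrightarrow> \<Delta> f x =
      (\<Sum>bs | set bs \<subseteq> Basis \<and> length bs \<le> n. a bs (\<phi> x) * iterated_partial bs (f \<circ> inv_into U \<phi>) (\<phi> x))"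
    using \<Delta>(1) U unfolding differential_operator_def by fast
  have fin: "finite {bs :: 'e list. set bs \<subseteq> Basis \<and> length bs \<le> n}"
    by (rule finite_lists_length_le) simp
  \<comment> \<open>A differential operator depends only on the germ at \<open>x\<close>; this is
    needed because \<open>H\<close> is known to be constant only near \<open>x\<close>.\<close>
  have local: "\<Delta> f x = \<Delta> g x"
    if fg: "smooth_fun A f" "smooth_fun A g" and O': "open O'" "x \<in> O'" "\<And>z. z \<in> O' \<Longrightarrow> f z = g z" for f g O'
  proof -
    have "open (\<phi> ` U \<inter> inv_into U \<phi> -` O')"
      by (rule continuous_open_preimage[OF homeomorphism_cont2[OF ch(3)] ch(2) O'(1)])
    moreover have "\<phi> x \<in> \<phi> ` U \<inter> inv_into U \<phi> -` O'"
      using homeomorphism_apply1[OF ch(3) U(2)] U(2) O'(2) by simp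
    ultimately have "iterated_partial bs (f \<circ> inv_into U \<phi>) (\<phi> x) = iterated_partial bs (g \<circ> inv_into U \<phi>) (\<phi> x)" for bs
      by (intro iterated_partial_cong) (auto simp: O'(3))
    then show ?thesis
      by (simp add: \<Delta>_eq fg)
  qed
  have sm_const: "smooth_fun A (\<lambda>_. r)" for r
    by (simp add: smooth_fun_def o_def smooth_on_const)
  have sm_D: "smooth_fun A (\<lambda>z. D z y)" for y
    unfolding smooth_fun_def o_def
  proof clarify
    fix V \<psi> assume "(V, \<psi>) \<in> A"
    from smooth_fst_chart[OF this]
    show "smooth_on (\<psi> ` V) (\<lambda>u. D (inv_into V \<psi> u) y)"
      using Ck_fst_imp_Ck_on[of _ "\<psi> ` V" "\<lambda>u y. D (inv_into V \<psi> u) y" y] by (simp add: smooth_fst_def smooth_on_def)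
  qed
  define w :: "'a \<Rightarrow> real" where "w = indicator E"
  have w: "w \<in> borel_measurable borel" "\<And>y. \<bar>w y\<bar> \<le> 1"
    using E by (auto simp: w_def indicator_def)
  note wi = compact_UNIV finite_measure_axioms sets w
  define H where "H z = (\<integral>y. w y * D z y \<partial>\<rho>)" for z
  have sm_H: "smooth_fun A H"
    unfolding smooth_fun_def o_def
  proof clarify
    fix V \<psi> assume V: "(V, \<psi>) \<in> A"
    show "smooth_on (\<psi> ` V) (\<lambda>u. H (inv_into V \<psi> u))"
      using smooth_fst_chart[OF V] Ck_on_weighted_integral[OF wi atlas_chart(2)[OF atlas V]]
      unfolding smooth_on_def smooth_fst_def H_def by simp
  qed
  define d where "d y = \<Delta> (\<lambda>z. D z y) x" for y
  let ?g = "\<lambda>u y. D (inv_into U \<phi> u) y"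
  have d_eq: "d y = (\<Sum>bs | set bs \<subseteq> Basis \<and> length bs \<le> n. a bs (\<phi> x) * iterated_partial bs (\<lambda>u. ?g u y) (\<phi> x))" for y
    unfolding d_def by (simp add: \<Delta>_eq sm_D o_def)
  have cont_ip: "continuous_on UNIV (\<lambda>y. iterated_partial bs (\<lambda>u. ?g u y) (\<phi> x))" for bs
  proof (rule continuous_on_slice[where S="\<phi> ` U" and u="\<phi> x" and f="\<lambda>u y. iterated_partial bs (\<lambda>u. ?g u y) u"])
    show "continuous_on (\<phi> ` U \<times> UNIV) (\<lambda>(u, y). iterated_partial bs (\<lambda>u. ?g u y) u)"
      using smooth_fst_iterated_partial[OF smooth_fst_chart[OF U(1)]] Ck_fst_continuous unfolding smooth_fst_def by blast
  qed (use U(2) in simp)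
  have cont_d: "continuous_on UNIV d"
    unfolding d_eq[abs_def] by (intro continuous_intros cont_ip)
  have "0 = \<Delta> (\<lambda>_. k) x"
    by (simp add: \<Delta>(2))
  also have "\<dots> = \<Delta> H x"
    by (rule local[OF sm_const sm_H W(1,2)]) (simp add: H_def w_def rep)
  also have "\<dots> = (\<Sum>bs | set bs \<subseteq> Basis \<and> length bs \<le> n.
      a bs (\<phi> x) * (\<integral>y. w y * iterated_partial bs (\<lambda>u. ?g u y) (\<phi> x) \<partial>\<rho>))"
    unfolding \<Delta>_eq[OF sm_H]
  proof (rule sum.cong[OF refl], rule arg_cong[where f="(*) _"])
    fix bs
    show "iterated_partial bs (H \<circ> inv_into U \<phi>) (\<phi> x) = (\<integral>y. w y * iterated_partial bs (\<lambda>u. ?g u y) (\<phi> x) \<partial>\<rho>)"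
      unfolding H_def o_def
      by (rule iterated_partial_weighted_integral[OF wi ch(2) smooth_fst_chart[OF U(1)]]) (use U(2) in simp)
  qed
  also have "\<dots> = (\<integral>y. (\<Sum>bs | set bs \<subseteq> Basis \<and> length bs \<le> n.
      a bs (\<phi> x) * (w y * iterated_partial bs (\<lambda>u. ?g u y) (\<phi> x))) \<partial>\<rho>)"
    using integrable_bounded_weight[OF wi cont_ip] by (subst Bochner_Integration.integral_sum) auto
  also have "\<dots> = (\<integral>y. w y * d y \<partial>\<rho>)"
    by (simp add: d_eq sum_distrib_left mult.left_commute)
  finally have int0: "(\<integral>y. - (w y * d y) \<partial>\<rho>) = 0"
    by simp
  \<comment> \<open>The strict inequality is assumed on I(x) only; continuity of \<open>d\<close>
    extends its weak form to the closure.\<close>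
  have "d y \<le> 0" if "y \<in> closure (I_set D x)" for y
  proof -
    have "closed {y. d y \<le> 0}"
      by (intro closed_Collect_le cont_d continuous_intros)
    moreover have "I_set D x \<subseteq> {y. d y \<le> 0}"
      using \<Delta>(3) by (auto simp: d_def less_imp_le)
    ultimately show ?thesis
      using that closure_minimal by blast
  qed
  moreover have "d y = 0" if y: "y \<in> supp \<rho>" "y \<in> E" "y \<notin> closure (I_set D x)" for y
  proof -
    obtain W' where W': "open W'" "x \<in> W'" "\<forall>z\<in>W'. D z y = 0"
      using zero[OF y] by blast
    have "d y = \<Delta> (\<lambda>_. 0) x"
      unfolding d_def by (rule local[OF sm_D sm_const W'(1,2)]) (use W'(3) in auto)
    then show ?thesis
      by (simp add: \<Delta>(2))
  qed
  ultimately have le: "w y * d y \<le> 0" if "y \<in> supp \<rho>" for y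
    using that by (cases "y \<in> E") (fastforce simp: w_def)+
  have "AE y in \<rho>. 0 \<le> - (w y * d y)"
    using AE_supp[OF sets] by eventually_elim (use le in auto)
  moreover have "integrable \<rho> (\<lambda>y. - (w y * d y))"
    using integrable_bounded_weight[OF wi cont_d] by simp
  ultimately have ae: "AE y in \<rho>. - (w y * d y) = 0"
    using int0 integral_nonneg_eq_0_iff_AE by blast
  have "open (I_set D x)"
    unfolding I_set_def by (intro open_Collect_less continuous_D_right continuous_intros)
  moreover have "x \<in> I_set D x"
    by (simp add: I_set_def D_pos)
  \<comment> \<open>The integrand has one sign and integral zero, so it vanishes almost everywhere.
    On I(x), which is contained in \<open>E\<close>, it is strictly negative before the change of
    sign, so the open neighborhood I(x) of \<open>x\<close> is null.\<close>
  moreover have "AE y in \<rho>. y \<notin> I_set D x"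
    using ae
  proof eventually_elim
    case (elim y)
    show ?case
    proof
      assume y: "y \<in> I_set D x"
      then have "y \<in> E"
        using neg[of y] by (auto simp: I_set_def)
      then show False
        using elim \<Delta>(3)[OF y] by (simp add: w_def d_def)
    qed
  qed
  ultimately have "x \<notin> supp \<rho>"
    using open_positive_measure[OF sets] by blast
  then show False
    using W by blast
qed

end

text \<open>\<open>T\<close> and \<open>c\<close> fix one choice of curve for each pair, so that the
  analyticity proviso in (A) and the nonvanishing derivative in (B) refer to the same curves. The
  analytic structure is an atlas \<open>B\<close> smoothly compatible with \<open>A\<close>;
  connectedness enters (A) through the identity theorem.\<close>

theorem theorem3p18:
  fixes A :: "('a::{t2_space, second_countable_topology}, 'e::euclidean_space) chart set"
    and D :: "'a \<Rightarrow> 'a \<Rightarrow> real"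
    and T :: "'a \<Rightarrow> 'a \<Rightarrow> real set"
    and c :: "'a \<Rightarrow> 'a \<Rightarrow> real \<Rightarrow> 'a"
  assumes "manifold_atlas smooth_on A" and "compact (UNIV :: 'a set)"
    and "kernel_of_class smooth_on A D"
    and "\<And>x y. D x y = D y x"
    and "\<And>x. D x x > 0"
    and "\<And>x y. y \<in> K_set D x \<Longrightarrow>
           smooth_curve_joining A x y (T x y) (c x y) \<and>
           locally_translation_symmetric D x (T x y) (c x y) \<and>
           changes_sign_at_0 (\<lambda>t. D (c x y t) y)"
  shows
    "(\<forall>B :: ('a, 'e) chart set.
        connected (UNIV :: 'a set) \<longrightarrow>
        manifold_atlas real_analytic_on B \<longrightarrow> manifold_atlas smooth_on (A \<union> B) \<longrightarrow>
        kernel_of_class real_analytic_on B D \<longrightarrow>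
        (\<forall>x. \<forall>y\<in>K_set D x. \<exists>\<delta>>0. {-\<delta><..<\<delta>} \<subseteq> T x y \<and>
           curve_of_class real_analytic_on B {-\<delta><..<\<delta>} (c x y)) \<longrightarrow>
        (\<forall>\<rho>. minimizer D \<rho> \<longrightarrow> generically_timelike D \<rho> \<or> interior (supp \<rho>) = {}))
     \<and>
     ((\<forall>x. \<forall>y\<in>K_set D x. \<exists>p::nat. (deriv ^^ p) (\<lambda>t. D (c x y t) y) 0 \<noteq> 0) \<longrightarrow>
        (\<exists>\<Delta>. differential_operator A \<Delta> \<and>
           (\<forall>k. \<Delta> (\<lambda>_. k) = (\<lambda>_. 0)) \<and>
           (\<forall>x. \<forall>y\<in>I_set D x. \<Delta> (\<lambda>z. D z y) x < 0)) \<longrightarrow>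
        (\<forall>\<rho>. minimizer D \<rho> \<longrightarrow> interior (supp \<rho>) = {}))"
proof -
  interpret symmetric_kernel A D T c
    by unfold_locales (use assms in blast)+
  show ?thesis
  proof (intro conjI allI impI)
    fix B :: "('a, 'e) chart set" and \<rho>
    assume B: "connected (UNIV :: 'a set)" "manifold_atlas real_analytic_on B" "kernel_of_class real_analytic_on B D"
      and an: "\<forall>x. \<forall>y\<in>K_set D x. \<exists>\<delta>>0. {-\<delta><..<\<delta>} \<subseteq> T x y \<and>
           curve_of_class real_analytic_on B {-\<delta><..<\<delta>} (c x y)"
      and min: "minimizer D \<rho>"
    show "generically_timelike D \<rho> \<or> interior (supp \<rho>) = {}"
      using analytic_case[OF B _ min] an by blast
  next
    fix \<rho>
    assume p: "\<forall>x. \<forall>y\<in>K_set D x. \<exists>p::nat. (deriv ^^ p) (\<lambda>t. D (c x y t) y) 0 \<noteq> 0"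
      and ex: "\<exists>\<Delta>. differential_operator A \<Delta> \<and> (\<forall>k. \<Delta> (\<lambda>_. k) = (\<lambda>_. 0)) \<and>
           (\<forall>x. \<forall>y\<in>I_set D x. \<Delta> (\<lambda>z. D z y) x < 0)"
      and min: "minimizer D \<rho>"
    obtain \<Delta> where \<Delta>: "differential_operator A \<Delta>" "\<And>k. \<Delta> (\<lambda>_. k) = (\<lambda>_. 0)"
        "\<And>x y. y \<in> I_set D x \<Longrightarrow> \<Delta> (\<lambda>z. D z y) x < 0"
      using ex by blast
    show "interior (supp \<rho>) = {}"
      by (rule smooth_case[OF \<Delta> _ min]) (use p in blast)+
  qed
qed

end
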